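(* Let $\lambda/\mu$ and $\nu/\rho$ be skew shapes and let $D$ be the shuffle diagram of shape $(\lambda/\mu)\circledast(\nu/\rho)$. For every partition $\kappa$, the Littlewood--Richardson coefficient $c^{\kappa}_{\lambda/\mu,\nu/\rho}$ equals the number of $D$-peelable tableaux of shape $\kappa$.
   Context: Young diagrams are drawn in English convention: position $(i,j)$ is row $i$ (rows numbered top to bottom) and column $j$ (columns numbered left to right). The shuffle diagram $D$ of shape $(\lambda/\mu)\circledast(\nu/\rho)$ is the set of squares consisting of a square at position $(2i-1,2j-1)$ for every square $(i,j)$ of $\lambda/\mu$ and a square at position $(2i,2j)$ for every square $(i,j)$ of $\nu/\rho$. Thus row $2i-1$ of $D$ has $\lambda_i-\mu_i$ squares and row $2i$ has $\nu_i-\rho_i$ squares. For $i\ge 1$ let $a_i$ be the number of columns of $D$ that contain a square in row $i$ and a square in row $i+2$. A $D$-peelable tableau is a semistandard Young tableau $T$ (of some partition shape) whose content is $(\lambda_1-\mu_1,\nu_1-\rho_1,\lambda_2-\mu_2,\nu_2-\rho_2,\ldots)$ (i.e. the number of entries equal to $r$ is the number of squares in row $r$ of $D$), such that for every $i\ge1$ there are at least $a_i$ pairwise disjoint pairs (a square of $T$ containing $i$, a square of $T$ containing $i+2$) in which the $i$-square lies Northeast of the $(i+2)$-square, i.e. in a row weakly above and a column weakly to the right of it. The coefficient $c^{\kappa}_{\lambda/\mu,\nu/\rho}$ is defined by $s_{\lambda/\mu}s_{\nu/\rho}=\sum_\kappa c^{\kappa}_{\lambda/\mu,\nu/\rho}s_\kappa$,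 where $s$ denotes (skew) Schur functions. *)

theory Defs
  imports Main "HOL-Library.Multiset"
begin

text \<open>
  Partitions are lists of positive parts, so each partition has exactly one representation;
  \<open>part la i\<close> is the part with 1-based index \<open>i\<close>, extended by zero beyond the length.
\<close>

definition is_partition :: "nat list \<Rightarrow> bool" where
  "is_partition la \<longleftrightarrow> sorted_wrt (\<ge>) la \<and> (\<forall>p\<in>set la. p > 0)"

definition part :: "nat list \<Rightarrow> nat \<Rightarrow> nat" where
  "part la i = (if 1 \<le> i \<and> i \<le> length la then la ! (i - 1) else 0)"

definition is_skew_shape :: "nat list \<Rightarrow> nat list \<Rightarrow> bool" where
  "is_skew_shape la mu \<longleftrightarrow>
     is_partition la \<and> is_partition mu \<and> (\<forall>i. part mu i \<le> part la i)"

text \<open>A square is a pair (row, column), both numbered from 1, in English convention.\<close>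

type_synonym square = "nat \<times> nat"

definition skew_diagram :: "nat list \<Rightarrow> nat list \<Rightarrow> square set" where
  "skew_diagram la mu = {(i, j). 1 \<le> i \<and> part mu i < j \<and> j \<le> part la i}"

abbreviation young_diagram :: "nat list \<Rightarrow> square set" where
  "young_diagram la \<equiv> skew_diagram la []"

text \<open>
  Fillings are total functions that take the dummy value 0 outside the diagram, so that
  tableaux of a given shape can be counted; genuine entries are positive.
\<close>

definition is_ssyt :: "square set \<Rightarrow> (square \<Rightarrow> nat) \<Rightarrow> bool" where
  "is_ssyt S T \<longleftrightarrow>
     (\<forall>s\<in>S. T s \<ge> 1) \<and> (\<forall>s. s \<notin> S \<longrightarrow> T s = 0) \<and>
     (\<forall>i j j'. (i, j) \<in> S \<longrightarrow> (i, j') \<in> S \<longrightarrow> j < j' \<longrightarrow> T (i, j) \<le> T (i, j')) \<and>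
     (\<forall>i i' j. (i, j) \<in> S \<longrightarrow> (i', j) \<in> S \<longrightarrow> i < i' \<longrightarrow> T (i, j) < T (i', j))"

text \<open>
  Formal power series with integer coefficients in the variables \<open>x\<^sub>1, x\<^sub>2, \<dots>\<close>, given by their
  coefficients. The multiset \<open>M\<close> stands for the monomial \<open>\<Prod>i\<in>#M. x\<^sub>i\<close>, so multiplying
  monomials is adding multisets. The skew Schur function is the generating function of
  semistandard tableaux by content.
\<close>

type_synonym power_series = "nat multiset \<Rightarrow> int"

definition ps_mult :: "power_series \<Rightarrow> power_series \<Rightarrow> power_series" where
  "ps_mult f g = (\<lambda>M. \<Sum>(A, B) \<in> {(A, B). A + B = M}. f A * g B)"

definition skew_schur :: "nat list \<Rightarrow> nat list \<Rightarrow> power_series" where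
  "skew_schur la mu = (\<lambda>M. int (card {T. is_ssyt (skew_diagram la mu) T \<and>
     image_mset T (mset_set (skew_diagram la mu)) = M}))"

abbreviation schur :: "nat list \<Rightarrow> power_series" where
  "schur la \<equiv> skew_schur la []"

definition is_schur_expansion :: "power_series \<Rightarrow> (nat list \<Rightarrow> int) \<Rightarrow> bool" where
  "is_schur_expansion f c \<longleftrightarrow>
     finite {ka. c ka \<noteq> 0} \<and> (\<forall>ka. \<not> is_partition ka \<longrightarrow> c ka = 0) \<and>
     f = (\<lambda>M. \<Sum>ka | c ka \<noteq> 0. c ka * schur ka M)"

definition lr_coeff ::
  "nat list \<Rightarrow> nat list \<Rightarrow> nat list \<Rightarrow> nat list \<Rightarrow> nat list \<Rightarrow> int" where
  "lr_coeff la mu nu rho =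
     (THE c. is_schur_expansion (ps_mult (skew_schur la mu) (skew_schur nu rho)) c)"

definition shuffle_diagram ::
  "nat list \<Rightarrow> nat list \<Rightarrow> nat list \<Rightarrow> nat list \<Rightarrow> square set" where
  "shuffle_diagram la mu nu rho =
     (\<lambda>(i, j). (2 * i - 1, 2 * j - 1)) ` skew_diagram la mu \<union>
     (\<lambda>(i, j). (2 * i, 2 * j)) ` skew_diagram nu rho"

definition common_columns :: "square set \<Rightarrow> nat \<Rightarrow> nat" where
  "common_columns D i = card {j. (i, j) \<in> D \<and> (i + 2, j) \<in> D}"

definition northeast :: "square \<Rightarrow> square \<Rightarrow> bool" where
  "northeast s t \<longleftrightarrow> fst s \<le> fst t \<and> snd t \<le> snd s"

definition is_peelable :: "square set \<Rightarrow> nat list \<Rightarrow> (square \<Rightarrow> nat) \<Rightarrow> bool" where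
  "is_peelable D ka T \<longleftrightarrow>
     is_ssyt (young_diagram ka) T \<and>
     (\<forall>r\<ge>1. card {s \<in> young_diagram ka. T s = r} = card {s \<in> D. fst s = r}) \<and>
     (\<forall>i\<ge>1. \<exists>P.
        (\<forall>(s, t)\<in>P. s \<in> young_diagram ka \<and> t \<in> young_diagram ka \<and>
           T s = i \<and> T t = i + 2 \<and> northeast s t) \<and>
        pairwise (\<lambda>p q. disjnt {fst p, snd p} {fst q, snd q}) P \<and>
        card P \<ge> common_columns D i)"

end

(*
  A tableau is a chain of shapes whose steps are horizontal strips, one step per letter, and
  adjacent letters can be interchanged by Bender-Knuth toggles. Interchanging letters of two
  alphabets in all possible ways produces a growth diagram on a rectangular grid, which is
  determined by its restriction to any lattice path. The key point is that the number of
  bracketed pairs of consecutive letters i, i + 1 of one alphabet does not change while a letter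
  of the other alphabet passes both of them, and that while the foreign letter stands between
  the two, this number is the maximal size of a Northeast pairing.

  Moving a superstandard prefix past a tableau yields the Littlewood-Richardson rule for skew
  Schur functions and, applied again, the symmetry of its coefficients; companion tableaux turn
  these into tableaux T of shape kappa whose content is the difference of the outer and inner
  shape and in which enough letters i, i + 1 are bracketed. For the disjoint union of the two skew
  shapes the letters of T come in two blocks, one per factor, and shuffling the two blocks
  turns the bracketing condition into the Northeast pairings of i and i + 2 in the definition of
  peelable tableaux.
*)
theory Submission
  imports Defs
begin

section \<open>Shapes, horizontal strips and Bender--Knuth toggles\<close>

text \<open>Conditions are phrased by unmatched letters, not by pairs, because this removes a
  truncation. Let \<open>l\<close>, \<open>m\<close> be the outer and inner shape. Row
  \<open>i + 1\<close> has \<open>l (i+1) - m (i+1)\<close> squares and shares max(0, l(i+1) - m(i))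
  columns with row \<open>i\<close>; asking for that many pairs leaves at most
  \<open>m i - m (i+1)\<close> letters unmatched. This bound does not mention \<open>l\<close>, and
  if \<open>m i > l (i+1)\<close> both forms hold trivially. The same number appears independently
  for companion tableaux, where it expresses column strictness relative to the inner shape; this
  coincidence is what links the two sides.

  The obstacle is the seam between the two blocks: in the disjoint union the last row of the first
  factor and the first row of the second are consecutive, whereas peelability never compares them. A
  horizontal shift by \<open>Q\<close> makes the bound at the seam so generous that it always holds.

  All bijections on chains that exchange or shuffle alphabets are one transport: complete a chain to
  its growth diagram along one lattice path and read the diagram along another.\<close>

type_synonym shape = "nat \<Rightarrow> nat"

definition hstrip :: "shape \<Rightarrow> shape \<Rightarrow> bool" where
  "hstrip a b \<longleftrightarrow> (\<forall>i. a i \<le> b i \<and> b (Suc i) \<le> a i)"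

text \<open>
  The Bender--Knuth involution on the middle shape of a chain of two horizontal strips;
  no subtraction truncates when \<open>a\<close>, \<open>b\<close>, \<open>d\<close> are successive horizontal strips.
\<close>

definition toggle :: "shape \<Rightarrow> shape \<Rightarrow> shape \<Rightarrow> shape" where
  "toggle a b d i =
     (case i of 0 \<Rightarrow> d 0 | Suc i' \<Rightarrow> min (a i') (d i)) + max (a i) (d (Suc i)) - b i"

text \<open>Summing over the support avoids a bound argument. For infinite support the sum is 0 by
  convention, so facts about sizes carry a bound \<open>R\<close> from which on the shape
  vanishes.\<close>

definition shape_size :: "shape \<Rightarrow> nat" where
  "shape_size a = (\<Sum>i | a i \<noteq> 0. a i)"

text \<open>
  Bracket the letters 1 filling \<open>b/a\<close> with the letters 2 filling \<open>c/b\<close> in reading order: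
  for \<open>k \<ge> 0\<close>, \<open>excess_le a b c k\<close> says that at most \<open>k\<close> letters 2 stay unmatched. Similarly,
  by Hall's condition, \<open>ne_excess_le a b c d k\<close> says that at most \<open>k\<close> letters 3 filling \<open>d/c\<close>
  are left over by the best Northeast pairing with the letters 1 filling \<open>b/a\<close>.
\<close>

definition excess_le :: "shape \<Rightarrow> shape \<Rightarrow> shape \<Rightarrow> int \<Rightarrow> bool" where
  "excess_le a b c k \<longleftrightarrow>
     (\<forall>r. (\<Sum>i\<le>r. int (c i) - int (b i)) \<le> k + (\<Sum>i<r. int (b i) - int (a i)))"

definition ne_excess_le :: "shape \<Rightarrow> shape \<Rightarrow> shape \<Rightarrow> shape \<Rightarrow> int \<Rightarrow> bool" where
  "ne_excess_le a b c d k \<longleftrightarrow>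
     (\<forall>r. (\<Sum>i\<le>r. int (d i) - int (c i)) + max 0 (int (d (Suc r)) - int (b r))
        \<le> k + (\<Sum>i<r. int (b i) - int (a i)))"

lemma hstripD:
  assumes "hstrip a b"
  shows "a i \<le> b i" "b (Suc i) \<le> a i"
  using assms by (auto simp: hstrip_def)

lemma hstrip_mono: "hstrip a b \<Longrightarrow> a \<le> b"
  by (auto simp: hstrip_def le_fun_def)

lemma hstrip_antimono:
  assumes "hstrip a b"
  shows "antimono a" "antimono b"
  using assms by (auto intro!: antimono_iff_le_Suc[THEN iffD2] simp: hstrip_def intro: order_trans)

lemma toggle_add:
  assumes "hstrip a b" "hstrip b d"
  shows "toggle a b d i + b i =
    (case i of 0 \<Rightarrow> d 0 | Suc i' \<Rightarrow> min (a i') (d i)) + max (a i) (d (Suc i))"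
  using hstripD[OF assms(1)] hstripD[OF assms(2)]
  by (auto simp: toggle_def split: nat.split intro!: le_add_diff_inverse2 trans_le_add1)

text \<open>A shape fits between \<open>a\<close> and \<open>d\<close> with strips on both sides iff
  each entry \<open>i\<close> lies between \<open>max (a i) (d (Suc i))\<close> and the minimum of
  \<open>a (i - 1)\<close> and \<open>d i\<close> (just \<open>d 0\<close> in row 0). The toggle
  reflects \<open>b i\<close> in this interval, hence it stays admissible and is an
  involution.\<close>

lemma hstrip_toggle:
  assumes "hstrip a b" "hstrip b d"
  shows "hstrip a (toggle a b d)" "hstrip (toggle a b d) d"
proof -
  have *: "toggle a b d i \<ge> max (a i) (d (Suc i)) \<and>
    toggle a b d i \<le> (case i of 0 \<Rightarrow> d 0 | Suc i' \<Rightarrow> min (a i') (d i))" for i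
  proof -
    have "b i \<le> (case i of 0 \<Rightarrow> d 0 | Suc i' \<Rightarrow> min (a i') (d i))"
      using hstripD[OF assms(1)] hstripD[OF assms(2)] by (auto split: nat.split)
    moreover have "max (a i) (d (Suc i)) \<le> b i"
      using hstripD[OF assms(1)] hstripD[OF assms(2)] by auto
    ultimately show ?thesis
      using toggle_add[OF assms, of i] by linarith
  qed
  show "hstrip a (toggle a b d)"
    unfolding hstrip_def
  proof (intro allI conjI)
    fix i
    show "a i \<le> toggle a b d i"
      using *[of i] by auto
    show "toggle a b d (Suc i) \<le> a i"
      using *[of "Suc i"] by auto
  qed
  show "hstrip (toggle a b d) d"
    unfolding hstrip_def
  proof (intro allI conjI)
    fix i
    show "toggle a b d i \<le> d i"
      using *[of i] by (cases i) auto
    show "d (Suc i) \<le> toggle a b d i"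
      using *[of i] by auto
  qed
qed

lemma toggle_toggle:
  assumes "hstrip a b" "hstrip b d"
  shows "toggle a (toggle a b d) d = b"
proof
  fix i
  show "toggle a (toggle a b d) d i = b i"
    using toggle_add[OF assms, of i] toggle_add[OF hstrip_toggle[OF assms], of i] by linarith
qed

text \<open>The \<open>max\<close> of row \<open>i\<close> and the \<open>min\<close> of row
  \<open>Suc i\<close> have the same two arguments and add up to \<open>a i + d (Suc i)\<close>.
  Only the \<open>max\<close> of the last row has no partner; it yields the boundary term.\<close>

lemma sum_toggle:
  assumes "hstrip a b" "hstrip b d"
  shows "(\<Sum>i\<le>r. int (toggle a b d i)) + (\<Sum>i\<le>r. int (b i)) =
    (\<Sum>i\<le>r. int (a i)) + (\<Sum>i\<le>r. int (d i)) + max 0 (int (d (Suc r)) - int (a r))"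
proof (induction r)
  case 0
  show ?case
    using toggle_add[OF assms, of 0] by simp
next
  case (Suc r)
  have "int (toggle a b d (Suc r)) + int (b (Suc r)) =
      int (min (a r) (d (Suc r))) + int (max (a (Suc r)) (d (Suc (Suc r))))"
    using toggle_add[OF assms, of "Suc r"] by (simp flip: of_nat_add)
  then show ?case
    using Suc.IH by (simp add: of_nat_max of_nat_min max_def min_def split: if_splits)
qed

text \<open>
  Moving the middle letter of three out of the way, to either side, turns the Northeast pairing
  of the outer two letters into the bracketing of adjacent letters. Both sums telescope by
  \<open>sum_toggle\<close>.
\<close>

lemma excess_le_toggle_right:
  assumes "hstrip b c" "hstrip c d"
  shows "excess_le a b (toggle b c d) k \<longleftrightarrow> ne_excess_le a b c d k"
proof -
  have "(\<Sum>i\<le>r. int (toggle b c d i) - int (b i)) =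
      (\<Sum>i\<le>r. int (d i) - int (c i)) + max 0 (int (d (Suc r)) - int (b r))" for r
    using sum_toggle[OF assms, of r] by (simp add: sum_subtractf)
  then show ?thesis
    unfolding excess_le_def ne_excess_le_def by simp
qed

lemma all_nat_iff: "(\<forall>r. P r) \<longleftrightarrow> P 0 \<and> (\<forall>r. P (Suc r))" for P :: "nat \<Rightarrow> bool"
  by (metis not0_implies_Suc)

lemma excess_le_toggle_left:
  assumes "hstrip a b" "hstrip b c" "hstrip c d"
  shows "excess_le (toggle a b c) c d k \<longleftrightarrow> ne_excess_le a b c d k"
proof -
  define X where "X r = (\<Sum>i\<le>r. int (d i) - int (c i))" for r
  define Y where "Y r = (\<Sum>i<r. int (b i) - int (a i))" for r
  have X_Suc: "X (Suc r) = X r + (int (d (Suc r)) - int (c (Suc r)))" for r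
    by (simp add: X_def)
  have Y_Suc: "Y (Suc r) = Y r + (int (b r) - int (a r))" for r
    by (simp add: Y_def)
  have toggled: "(\<Sum>i<Suc r. int (c i) - int (toggle a b c i)) =
      Y (Suc r) - max 0 (int (c (Suc r)) - int (a r))" for r
    using sum_toggle[OF assms(1,2), of r]
    unfolding Y_def sum_subtractf lessThan_Suc_atMost by linarith
  have "excess_le (toggle a b c) c d k \<longleftrightarrow> X 0 \<le> k \<and>
      (\<forall>r. X (Suc r) \<le> k + (Y (Suc r) - max 0 (int (c (Suc r)) - int (a r))))"
    unfolding excess_le_def X_def[symmetric] by (subst all_nat_iff) (simp only: toggled, simp)
  also have "\<dots> \<longleftrightarrow> X 0 \<le> k + Y 0 \<and> (\<forall>r. X (Suc r) \<le> k + Y (Suc r)) \<and>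
      (\<forall>r. X r + (int (d (Suc r)) - int (b r)) \<le> k + Y r)"
  proof -
    \<comment> \<open>The bound by the positive part is two inequalities. In the second, expanding
      the last summands of \<open>X\<close> and \<open>Y\<close> cancels \<open>a r\<close> and
      \<open>c (Suc r)\<close>, so the index drops from \<open>Suc r\<close> to \<open>r\<close>.
      This produces the boundary term of \<open>ne_excess_le\<close>.\<close>
    have "X (Suc r) \<le> k + (Y (Suc r) - max 0 (int (c (Suc r)) - int (a r))) \<longleftrightarrow>
        X (Suc r) \<le> k + Y (Suc r) \<and> X r + (int (d (Suc r)) - int (b r)) \<le> k + Y r" for r
      unfolding max_def using X_Suc[of r] Y_Suc[of r] by presburger
    moreover have "Y 0 = 0"
      by (simp add: Y_def)
    ultimately show ?thesis
      by auto
  qed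
  also have "\<dots> \<longleftrightarrow> (\<forall>r. X r \<le> k + Y r) \<and> (\<forall>r. X r + (int (d (Suc r)) - int (b r)) \<le> k + Y r)"
    using all_nat_iff[of "\<lambda>r. X r \<le> k + Y r"] by blast
  also have "\<dots> \<longleftrightarrow> ne_excess_le a b c d k"
  proof -
    have "X r + max 0 (int (d (Suc r)) - int (b r)) \<le> k + Y r \<longleftrightarrow>
        X r \<le> k + Y r \<and> X r + (int (d (Suc r)) - int (b r)) \<le> k + Y r" for r
      unfolding max_def by presburger
    then show ?thesis
      unfolding ne_excess_le_def X_def[symmetric] Y_def[symmetric] by blast
  qed
  finally show ?thesis .
qed

lemma shape_size_eq:
  assumes "\<forall>i\<ge>R. a i = 0"
  shows "shape_size a = (\<Sum>i<R. a i)"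
  unfolding shape_size_def
  by (rule sum.mono_neutral_left) (use assms not_less in auto)

lemma shape_size_toggle:
  assumes "hstrip a b" "hstrip b d" "\<forall>i\<ge>R. d i = 0"
  shows "shape_size (toggle a b d) + shape_size b = shape_size a + shape_size d"
proof -
  have z: "\<forall>i\<ge>Suc R. a i = 0" "\<forall>i\<ge>Suc R. b i = 0" "\<forall>i\<ge>Suc R. toggle a b d i = 0" "\<forall>i\<ge>Suc R. d i = 0"
    using assms hstripD(1)[OF assms(1)] hstripD(1)[OF assms(2)]
      hstripD(1)[OF hstrip_toggle(2)[OF assms(1,2)]] by (metis Suc_leD le_zero_eq)+
  have "int (shape_size (toggle a b d)) + int (shape_size b) = int (shape_size a) + int (shape_size d)"
    using sum_toggle[OF assms(1,2), of R] assms(3)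
    by (simp add: shape_size_eq[OF z(1)] shape_size_eq[OF z(2)] shape_size_eq[OF z(3)]
        shape_size_eq[OF z(4)] lessThan_Suc_atMost)
  then show ?thesis
    by linarith
qed

section \<open>Growth diagrams\<close>

text \<open>
  Two alphabets of \<open>l\<close> and \<open>n\<close> letters: a lattice path from \<open>(0, 0)\<close> to \<open>(l, n)\<close> is a way to
  shuffle them, and the shapes along the path form a tableau for that order of the letters.
\<close>

definition growth :: "nat \<Rightarrow> nat \<Rightarrow> (nat \<Rightarrow> nat \<Rightarrow> shape) \<Rightarrow> bool" where
  "growth l n G \<longleftrightarrow>
     (\<forall>i<l. \<forall>j\<le>n. hstrip (G i j) (G (Suc i) j)) \<and>
     (\<forall>i\<le>l. \<forall>j<n. hstrip (G i j) (G i (Suc j))) \<and>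
     (\<forall>i<l. \<forall>j<n. G i (Suc j) = toggle (G i j) (G (Suc i) j) (G (Suc i) (Suc j)))"

lemma growth_transpose:
  assumes "growth l n G"
  shows "growth n l (\<lambda>i j. G j i)"
  using assms unfolding growth_def by (auto simp: toggle_toggle)

text \<open>The new shape \<open>x\<close> sits at the far end, so the column is forced from index
  \<open>n\<close> down to 0. The induction therefore strips off the first entry of \<open>a\<close>
  and recovers the first entry of \<open>b\<close> by one toggle at the end.\<close>

lemma growth_extend_column:
  fixes a :: "nat \<Rightarrow> shape"
  assumes "\<forall>j<n. hstrip (a j) (a (Suc j))" "hstrip (a n) x"
  shows "\<exists>b. b n = x \<and> (\<forall>j\<le>n. hstrip (a j) (b j)) \<and> (\<forall>j<n. hstrip (b j) (b (Suc j))) \<and>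
    (\<forall>j<n. b j = toggle (a j) (a (Suc j)) (b (Suc j)))"
  using assms
proof (induction n arbitrary: a)
  case 0
  then show ?case
    by (intro exI[of _ "\<lambda>_. x"]) auto
next
  case (Suc n)
  have "\<exists>b. b n = x \<and> (\<forall>j\<le>n. hstrip (a (Suc j)) (b j)) \<and> (\<forall>j<n. hstrip (b j) (b (Suc j))) \<and>
    (\<forall>j<n. b j = toggle (a (Suc j)) (a (Suc (Suc j))) (b (Suc j)))"
    using Suc.prems by (intro Suc.IH[of "\<lambda>j. a (Suc j)"]) auto
  then obtain b where b: "b n = x" "\<forall>j\<le>n. hstrip (a (Suc j)) (b j)" "\<forall>j<n. hstrip (b j) (b (Suc j))"
    "\<forall>j<n. b j = toggle (a (Suc j)) (a (Suc (Suc j))) (b (Suc j))"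
    by blast
  define b' where "b' j = (case j of 0 \<Rightarrow> toggle (a 0) (a 1) (b 0) | Suc j' \<Rightarrow> b j')" for j
  have h: "hstrip (a 0) (a 1)" "hstrip (a 1) (b 0)"
    using Suc.prems b(2) by auto
  show ?case
  proof (intro exI[of _ b'] conjI allI impI)
    show "b' (Suc n) = x"
      using b(1) by (simp add: b'_def)
    show "hstrip (a j) (b' j)" if "j \<le> Suc n" for j
      using that b(2) hstrip_toggle(1)[OF h] by (cases j) (auto simp: b'_def)
    show "hstrip (b' j) (b' (Suc j))" if "j < Suc n" for j
      using that b(3) hstrip_toggle(2)[OF h] by (cases j) (auto simp: b'_def)
    show "b' j = toggle (a j) (a (Suc j)) (b' (Suc j))" if "j < Suc n" for j
      using that b(4) by (cases j) (auto simp: b'_def)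
  qed
qed

lemma growth_extend:
  assumes "growth l n G" "hstrip (G l n) x"
  shows "\<exists>G'. growth (Suc l) n G' \<and> (\<forall>i\<le>l. G' i = G i) \<and> G' (Suc l) n = x"
proof -
  obtain b where b: "b n = x" "\<forall>j\<le>n. hstrip (G l j) (b j)" "\<forall>j<n. hstrip (b j) (b (Suc j))"
    "\<forall>j<n. b j = toggle (G l j) (G l (Suc j)) (b (Suc j))"
    using growth_extend_column[of n "G l" x] assms by (auto simp: growth_def)
  define G' where "G' = G(Suc l := b)"
  have [simp]: "G' i = G i" if "i \<le> l" for i
    using that by (simp add: G'_def)
  have [simp]: "G' (Suc l) = b"
    by (simp add: G'_def)
  have "growth (Suc l) n G'"
    unfolding growth_def
  proof (intro conjI allI impI)
    fix i j assume "i < Suc l" "j \<le> n"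
    then show "hstrip (G' i j) (G' (Suc i) j)"
      using assms(1) b(2) unfolding growth_def by (cases "i = l") auto
  next
    fix i j assume "i \<le> Suc l" "j < n"
    then show "hstrip (G' i j) (G' i (Suc j))"
      using assms(1) b(3) unfolding growth_def by (cases "i = Suc l") auto
  next
    fix i j assume ij: "i < Suc l" "j < n"
    show "G' i (Suc j) = toggle (G' i j) (G' (Suc i) j) (G' (Suc i) (Suc j))"
    proof (cases "i = l")
      case True
      \<comment> \<open>The column was built with the toggle that computes the opposite corner of
        each cell; involutivity gives the rule in the direction demanded by
        \<open>growth\<close>.\<close>
      have "toggle (G l j) (b j) (b (Suc j)) = G l (Suc j)"
        using toggle_toggle[of "G l j" "G l (Suc j)" "b (Suc j)"] assms(1) b ij
        unfolding growth_def by auto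
      then show ?thesis
        using True by simp
    next
      case False
      then show ?thesis
        using assms(1) ij unfolding growth_def by auto
    qed
  qed
  then show ?thesis
    using b(1) by (intro exI[of _ G']) auto
qed

section \<open>Existence and uniqueness of growth diagrams along a lattice path\<close>

definition lattice_path :: "nat \<Rightarrow> (nat \<Rightarrow> nat) \<Rightarrow> (nat \<Rightarrow> nat) \<Rightarrow> bool" where
  "lattice_path N x y \<longleftrightarrow> x 0 = 0 \<and> y 0 = 0 \<and>
     (\<forall>k<N. x (Suc k) = Suc (x k) \<and> y (Suc k) = y k \<or> x (Suc k) = x k \<and> y (Suc k) = Suc (y k))"

lemma lattice_path_Suc:
  assumes "lattice_path (Suc N) x y"
  shows "lattice_path N x y" "x N \<le> x (Suc N)" "y N \<le> y (Suc N)"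
proof -
  show "lattice_path N x y"
    using assms by (simp add: lattice_path_def)
  show "x N \<le> x (Suc N)" "y N \<le> y (Suc N)"
    using assms unfolding lattice_path_def by (metis le_SucI lessI order_refl)+
qed

lemma lattice_path_mono:
  assumes "lattice_path N x y" "k \<le> N"
  shows "x k \<le> x N" "y k \<le> y N"
proof -
  have "lattice_path N x y \<longrightarrow> x k \<le> x N \<and> y k \<le> y N"
    using assms(2)
    by (induction N rule: dec_induct) (auto dest: lattice_path_Suc intro: order_trans)
  then show "x k \<le> x N" "y k \<le> y N"
    using assms(1) by auto
qed

text \<open>Each step of the path enlarges the spanned rectangle by one column or one row, and a row
  is a column of the transposed diagram.\<close>

lemma growth_exists_on_path:
  assumes "lattice_path N x y" "\<forall>k<N. hstrip (c k) (c (Suc k))"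
  shows "\<exists>G. growth (x N) (y N) G \<and> (\<forall>k\<le>N. G (x k) (y k) = c k)"
  using assms
proof (induction N)
  case 0
  then show ?case
    by (intro exI[of _ "\<lambda>_ _. c 0"]) (auto simp: lattice_path_def growth_def)
next
  case (Suc N)
  have path: "lattice_path N x y"
    using lattice_path_Suc[OF Suc.prems(1)] by auto
  then obtain G where G: "growth (x N) (y N) G" "\<forall>k\<le>N. G (x k) (y k) = c k"
    using Suc.IH[OF path] Suc.prems(2) by auto
  have hs: "hstrip (G (x N) (y N)) (c (Suc N))"
    using G Suc.prems by auto
  consider "x (Suc N) = Suc (x N)" "y (Suc N) = y N" | "x (Suc N) = x N" "y (Suc N) = Suc (y N)"
    using Suc.prems by (auto simp: lattice_path_def)
  then show ?case
  proof cases
    case 1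
    obtain G' where "growth (Suc (x N)) (y N) G'" "\<forall>i\<le>x N. G' i = G i" "G' (Suc (x N)) (y N) = c (Suc N)"
      using growth_extend[OF G(1) hs] by auto
    then have "G' (x k) (y k) = c k" if "k \<le> Suc N" for k
      using that 1 G(2) lattice_path_mono[OF path, of k] by (cases "k = Suc N") simp_all
    then show ?thesis
      using 1 \<open>growth (Suc (x N)) (y N) G'\<close> by (intro exI[of _ G']) simp
  next
    case 2
    obtain G' where G': "growth (Suc (y N)) (x N) G'" "\<forall>i\<le>y N. G' i = (\<lambda>j. G j i)"
      "G' (Suc (y N)) (x N) = c (Suc N)"
      using growth_extend[OF growth_transpose[OF G(1)] hs] by auto
    have "G' (y k) (x k) = c k" if "k \<le> Suc N" for k
      using that 2 G(2) G'(2,3) lattice_path_mono[OF path, of k] by (cases "k = Suc N") simp_all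
    then show ?thesis
      using 2 growth_transpose[OF G'(1)] by (intro exI[of _ "\<lambda>i j. G' j i"]) simp
  qed
qed

lemma growth_last_column_unique:
  assumes "growth (Suc l) n G" "growth (Suc l) n G'" "\<forall>i\<le>l. \<forall>j\<le>n. G i j = G' i j"
    "G (Suc l) n = G' (Suc l) n" "j \<le> n"
  shows "G (Suc l) j = G' (Suc l) j"
  using assms(5)
proof (induction j rule: inc_induct)
  case (step j)
  have "G (Suc l) j = toggle (G l j) (G l (Suc j)) (G (Suc l) (Suc j))"
    using growth_transpose[OF assms(1)] step unfolding growth_def by auto
  also have "\<dots> = toggle (G' l j) (G' l (Suc j)) (G' (Suc l) (Suc j))"
    using step assms(3) by auto
  also have "\<dots> = G' (Suc l) j"
    using growth_transpose[OF assms(2)] step unfolding growth_def by auto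
  finally show ?case .
qed (use assms in auto)

lemma growth_restrict:
  "growth l n G \<Longrightarrow> l' \<le> l \<Longrightarrow> n' \<le> n \<Longrightarrow> growth l' n' G"
  unfolding growth_def by auto

lemma growth_unique_on_path:
  assumes "lattice_path N x y" "growth (x N) (y N) G" "growth (x N) (y N) G'"
    "\<forall>k\<le>N. G (x k) (y k) = G' (x k) (y k)" "i \<le> x N" "j \<le> y N"
  shows "G i j = G' i j"
  using assms
proof (induction N arbitrary: i j)
  case 0
  then show ?case
    by (auto simp: lattice_path_def)
next
  case (Suc N)
  have path: "lattice_path N x y"
    using lattice_path_Suc[OF Suc.prems(1)] by auto
  have le: "x N \<le> x (Suc N)" "y N \<le> y (Suc N)"
    using lattice_path_Suc[OF Suc.prems(1)] by auto
  have IH: "G i j = G' i j" if "i \<le> x N" "j \<le> y N" for i j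
    by (rule Suc.IH[OF path growth_restrict[OF Suc.prems(2) le] growth_restrict[OF Suc.prems(3) le]])
      (use Suc.prems(4) that in simp_all)
  have last: "G (x (Suc N)) (y (Suc N)) = G' (x (Suc N)) (y (Suc N))"
    using Suc.prems(4) by blast
  consider "x (Suc N) = Suc (x N)" "y (Suc N) = y N" | "x (Suc N) = x N" "y (Suc N) = Suc (y N)"
    using Suc.prems(1) unfolding lattice_path_def by blast
  then show ?case
  proof cases
    case 1
    show ?thesis
    proof (cases "i = Suc (x N)")
      case True
      have "G (Suc (x N)) j = G' (Suc (x N)) j"
        by (rule growth_last_column_unique[OF Suc.prems(2,3)[unfolded 1]])
          (use IH last 1 Suc.prems(6) in simp_all)
      then show ?thesis
        using True by simp
    next
      case False
      then have "i \<le> x N" "j \<le> y N"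
        using Suc.prems(5,6) 1 by simp_all
      then show ?thesis
        by (rule IH)
    qed
  next
    case 2
    show ?thesis
    proof (cases "j = Suc (y N)")
      case True
      have "G i (Suc (y N)) = G' i (Suc (y N))"
        by (rule growth_last_column_unique[OF Suc.prems(2,3)[unfolded 2, THEN growth_transpose]])
          (use IH last 2 Suc.prems(5) in simp_all)
      then show ?thesis
        using True by simp
    next
      case False
      then have "i \<le> x N" "j \<le> y N"
        using Suc.prems(5,6) 2 by simp_all
      then show ?thesis
        by (rule IH)
    qed
  qed
qed

section \<open>Invariants of growth diagrams: multiplicities and unmatched letters\<close>

lemma growthD:
  assumes "growth l n G"
  shows "i < l \<Longrightarrow> j \<le> n \<Longrightarrow> hstrip (G i j) (G (Suc i) j)"
    and "i \<le> l \<Longrightarrow> j < n \<Longrightarrow> hstrip (G i j) (G i (Suc j))"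
    and "i < l \<Longrightarrow> j < n \<Longrightarrow> G i (Suc j) = toggle (G i j) (G (Suc i) j) (G (Suc i) (Suc j))"
    and "i < l \<Longrightarrow> j < n \<Longrightarrow> G (Suc i) j = toggle (G i j) (G i (Suc j)) (G (Suc i) (Suc j))"
proof -
  show "i < l \<Longrightarrow> j \<le> n \<Longrightarrow> hstrip (G i j) (G (Suc i) j)"
    and "i \<le> l \<Longrightarrow> j < n \<Longrightarrow> hstrip (G i j) (G i (Suc j))"
    and "i < l \<Longrightarrow> j < n \<Longrightarrow> G i (Suc j) = toggle (G i j) (G (Suc i) j) (G (Suc i) (Suc j))"
    using assms unfolding growth_def by blast+
  show "i < l \<Longrightarrow> j < n \<Longrightarrow> G (Suc i) j = toggle (G i j) (G i (Suc j)) (G (Suc i) (Suc j))"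
    using growth_transpose[OF assms] unfolding growth_def by blast
qed

lemma growth_le_corner:
  assumes "growth l n G" "i \<le> l" "j \<le> n"
  shows "G i j \<le> G l n"
proof -
  have "G i j \<le> G l j"
    using assms(2)
  proof (induction i rule: inc_induct)
    case (step i)
    then have "G i j \<le> G (Suc i) j"
      using assms(1,3) by (intro hstrip_mono) (simp add: growth_def)
    then show ?case
      using step.IH by (rule order_trans)
  qed simp
  moreover have "G l j \<le> G l n"
    using assms(3)
  proof (induction j rule: inc_induct)
    case (step j)
    then have "G l j \<le> G l (Suc j)"
      using assms(1) by (intro hstrip_mono) (simp add: growth_def)
    then show ?case
      using step.IH by (rule order_trans)
  qed simp
  ultimately show ?thesis
    by (rule order_trans)
qed

text \<open>A toggle interchanges the sizes of two consecutive strips, so a letter keeps its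
  multiplicity while letters of the other alphabet pass it.\<close>

lemma growth_size:
  assumes "growth l n G" "\<forall>r\<ge>R. G l n r = 0" "i < l" "j \<le> n"
  shows "shape_size (G (Suc i) j) + shape_size (G i 0) = shape_size (G i j) + shape_size (G (Suc i) 0)"
  using assms(4)
proof (induction j)
  case (Suc j)
  have "\<forall>r\<ge>R. G (Suc i) (Suc j) r = 0"
    using growth_le_corner[OF assms(1), of "Suc i" "Suc j"] assms(2,3) Suc.prems
    by (auto simp: le_fun_def) (metis le_zero_eq)
  moreover have "hstrip (G i j) (G (Suc i) j)" "hstrip (G (Suc i) j) (G (Suc i) (Suc j))"
    "toggle (G i j) (G (Suc i) j) (G (Suc i) (Suc j)) = G i (Suc j)"
    using assms(3) Suc.prems by (simp_all add: growthD(1,2)[OF assms(1)] flip: growthD(3)[OF assms(1)])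
  ultimately have "shape_size (G i (Suc j)) + shape_size (G (Suc i) j) =
      shape_size (G i j) + shape_size (G (Suc i) (Suc j))"
    using shape_size_toggle by metis
  then show ?case
    using Suc by linarith
qed simp

text \<open>The common right-hand side is read along the path through \<open>(i, j)\<close>,
  \<open>(i+1, j)\<close>, \<open>(i+1, j+1)\<close>, \<open>(i+2, j+1)\<close>, where foreign
  letter \<open>j\<close> separates letters \<open>i\<close> and \<open>i + 1\<close>. Toggling it
  past letter \<open>i + 1\<close> gives the path at height \<open>j\<close>; toggling it before
  letter \<open>i\<close> gives the one at height \<open>j + 1\<close>.\<close>

lemma growth_excess_step:
  assumes "growth l n G" "Suc (Suc i) \<le> l" "j < n"
  shows "excess_le (G i j) (G (Suc i) j) (G (Suc (Suc i)) j) k \<longleftrightarrow>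
      ne_excess_le (G i j) (G (Suc i) j) (G (Suc i) (Suc j)) (G (Suc (Suc i)) (Suc j)) k"
    and "excess_le (G i (Suc j)) (G (Suc i) (Suc j)) (G (Suc (Suc i)) (Suc j)) k \<longleftrightarrow>
      ne_excess_le (G i j) (G (Suc i) j) (G (Suc i) (Suc j)) (G (Suc (Suc i)) (Suc j)) k"
proof -
  have strips: "hstrip (G i j) (G (Suc i) j)" "hstrip (G (Suc i) j) (G (Suc i) (Suc j))"
    "hstrip (G (Suc i) (Suc j)) (G (Suc (Suc i)) (Suc j))"
    by (rule growthD[OF assms(1)]; use assms(2,3) in simp)+
  have "G i (Suc j) = toggle (G i j) (G (Suc i) j) (G (Suc i) (Suc j))"
    "G (Suc (Suc i)) j = toggle (G (Suc i) j) (G (Suc i) (Suc j)) (G (Suc (Suc i)) (Suc j))"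
    by (rule growthD[OF assms(1)]; use assms(2,3) in simp)+
  then show "excess_le (G i j) (G (Suc i) j) (G (Suc (Suc i)) j) k \<longleftrightarrow>
      ne_excess_le (G i j) (G (Suc i) j) (G (Suc i) (Suc j)) (G (Suc (Suc i)) (Suc j)) k"
    and "excess_le (G i (Suc j)) (G (Suc i) (Suc j)) (G (Suc (Suc i)) (Suc j)) k \<longleftrightarrow>
      ne_excess_le (G i j) (G (Suc i) j) (G (Suc i) (Suc j)) (G (Suc (Suc i)) (Suc j)) k"
    using excess_le_toggle_left[OF strips] excess_le_toggle_right[OF strips(2,3)] by simp_all
qed

lemma growth_excess:
  assumes "growth l n G" "Suc (Suc i) \<le> l" "j \<le> n"
  shows "excess_le (G i j) (G (Suc i) j) (G (Suc (Suc i)) j) k \<longleftrightarrow>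
    excess_le (G i 0) (G (Suc i) 0) (G (Suc (Suc i)) 0) k"
  using assms(3)
proof (induction j)
  case (Suc j)
  then show ?case
    using growth_excess_step[OF assms(1,2), of j k] by simp
qed simp

section \<open>Counting chains with prescribed multiplicities and bracketing\<close>

text \<open>Chains are total functions frozen at \<open>d\<close> from index \<open>N\<close> on, so
  each chain has a unique representative and can be counted.\<close>

definition strip_chains :: "nat \<Rightarrow> shape \<Rightarrow> shape \<Rightarrow> (nat \<Rightarrow> shape) set" where
  "strip_chains N a d =
     {c. c 0 = a \<and> (\<forall>k\<ge>N. c k = d) \<and> (\<forall>k<N. hstrip (c k) (c (Suc k)))}"

text \<open>The offset \<open>s\<close> singles out one block of letters of a longer chain. For two
  adjacent blocks nothing is required of the pair of letters that straddles their boundary.\<close>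

definition segment_cond ::
  "(nat \<Rightarrow> shape) \<Rightarrow> nat \<Rightarrow> nat \<Rightarrow> (nat \<Rightarrow> nat) \<Rightarrow> (nat \<Rightarrow> int) \<Rightarrow> bool" where
  "segment_cond c s l p K \<longleftrightarrow>
     (\<forall>i<l. shape_size (c (s + Suc i)) = shape_size (c (s + i)) + p i) \<and>
     (\<forall>i. Suc (Suc i) \<le> l \<longrightarrow> excess_le (c (s + i)) (c (s + Suc i)) (c (s + Suc (Suc i))) (K i))"

text \<open>For partitions \<open>a\<close>, \<open>b\<close> and \<open>K\<close> constantly 0
  these are the Littlewood-Richardson tableaux of shape \<open>b/a\<close> and content
  \<open>p\<close>. If \<open>K i\<close> is at least \<open>p (Suc i)\<close>, they are all
  semistandard tableaux of that content.\<close>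

definition chains :: "shape \<Rightarrow> shape \<Rightarrow> nat \<Rightarrow> (nat \<Rightarrow> nat) \<Rightarrow> (nat \<Rightarrow> int) \<Rightarrow> (nat \<Rightarrow> shape) set" where
  "chains a b l p K = {c \<in> strip_chains l a b. segment_cond c 0 l p K}"

lemma segment_cond_cong:
  assumes "\<And>i. i \<le> l \<Longrightarrow> c (s + i) = c' (s' + i)"
  shows "segment_cond c s l p K \<longleftrightarrow> segment_cond c' s' l p K"
proof -
  have "i < l \<Longrightarrow> c (s + Suc i) = c' (s' + Suc i)" "i < l \<Longrightarrow> c (s + i) = c' (s' + i)" for i
    using assms[of "Suc i"] assms[of i] by auto
  moreover have "Suc (Suc i) \<le> l \<Longrightarrow> c (s + Suc (Suc i)) = c' (s' + Suc (Suc i))" for i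
    using assms[of "Suc (Suc i)"] by auto
  ultimately show ?thesis
    unfolding segment_cond_def by (auto simp: Suc_le_eq)
qed

lemma growth_segment_cond:
  assumes "growth l n G" "\<forall>r\<ge>R. G l n r = 0" "j \<le> n"
  shows "segment_cond (\<lambda>i. G i j) 0 l p K \<longleftrightarrow> segment_cond (\<lambda>i. G i 0) 0 l p K"
proof -
  have "shape_size (G (Suc i) j) = shape_size (G i j) + p i \<longleftrightarrow>
      shape_size (G (Suc i) 0) = shape_size (G i 0) + p i" if "i < l" for i
    using growth_size[OF assms(1,2) that assms(3)] by linarith
  then show ?thesis
    unfolding segment_cond_def using growth_excess[OF assms(1) _ assms(3)] by auto
qed

lemma strip_chains_le:
  assumes "c \<in> strip_chains N a d"
  shows "c k \<le> d"
proof (cases "k \<le> N")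
  case True
  then show ?thesis
  proof (induction k rule: inc_induct)
    case base
    then show ?case
      using assms by (simp add: strip_chains_def)
  next
    case (step k)
    then have "c k \<le> c (Suc k)"
      using assms by (intro hstrip_mono) (simp add: strip_chains_def)
    then show ?case
      using step.IH by (rule order_trans)
  qed
next
  case False
  then show ?thesis
    using assms by (simp add: strip_chains_def)
qed

lemma finite_shapes_le:
  fixes d :: shape
  assumes "\<forall>i\<ge>R. d i = 0"
  shows "finite {b. b \<le> d}"
proof -
  have "{b. b \<le> d} \<subseteq> {f. \<forall>x. (x \<in> {..<R} \<longrightarrow> f x \<in> {..Max (d ` {..<R})}) \<and> (x \<notin> {..<R} \<longrightarrow> f x = 0)}"
  proof (intro subsetI CollectI allI conjI impI)
    fix b x assume "b \<in> {b. b \<le> d}"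
    then have le: "b x \<le> d x" by (simp add: le_fun_def)
    show "b x \<in> {..Max (d ` {..<R})}" if "x \<in> {..<R}"
      using order_trans[OF le Max_ge[of "d ` {..<R}" "d x"]] that by simp
    show "b x = 0" if "x \<notin> {..<R}"
      using that le assms by (simp add: not_less)
  qed
  then show ?thesis
    by (rule finite_subset) (rule finite_set_of_finite_funs; simp)
qed

lemma finite_strip_chains:
  assumes "\<forall>i\<ge>R. d i = 0"
  shows "finite (strip_chains N a d)"
proof (rule inj_on_finite)
  show "inj_on (\<lambda>c. map c [0..<N]) (strip_chains N a d)"
  proof (rule inj_onI, rule ext)
    fix c c' k
    assume *: "c \<in> strip_chains N a d" "c' \<in> strip_chains N a d" "map c [0..<N] = map c' [0..<N]"
    show "c k = c' k"
      using * by (cases "k < N") (auto simp: strip_chains_def not_less)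
  qed
  show "(\<lambda>c. map c [0..<N]) ` strip_chains N a d \<subseteq> {xs. set xs \<subseteq> {b. b \<le> d} \<and> length xs = N}"
    using strip_chains_le by auto
  show "finite {xs. set xs \<subseteq> {b. b \<le> d} \<and> length xs = N}"
    by (rule finite_lists_length_eq[OF finite_shapes_le[OF assms]])
qed

lemma growth_path_strip_chain:
  assumes "lattice_path N x y" "growth (x N) (y N) G"
  shows "(\<lambda>k. G (x (min k N)) (y (min k N))) \<in> strip_chains N (G 0 0) (G (x N) (y N))"
proof -
  have "hstrip (G (x k) (y k)) (G (x (Suc k)) (y (Suc k)))" if "k < N" for k
  proof -
    have "x k \<le> x N" "y k \<le> y N" "x (Suc k) \<le> x N" "y (Suc k) \<le> y N"
      using lattice_path_mono[OF assms(1), of k] lattice_path_mono[OF assms(1), of "Suc k"] that by simp_all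
    moreover have "x (Suc k) = Suc (x k) \<and> y (Suc k) = y k \<or> x (Suc k) = x k \<and> y (Suc k) = Suc (y k)"
      using assms(1) that unfolding lattice_path_def by blast
    ultimately show ?thesis
      using assms(2) unfolding growth_def by auto
  qed
  then show ?thesis
    using assms(1) unfolding strip_chains_def by (auto simp: lattice_path_def min_def)
qed

text \<open>\<open>P\<close> and \<open>P'\<close> express one property of a growth diagram, read
  off two different paths. Completing along one path and reading along the other is a bijection,
  since a diagram is determined by either path.\<close>

lemma card_chains_on_paths:
  assumes path: "lattice_path N x y" and path': "lattice_path N x' y'"
    and ends: "x N = l" "y N = n" "x' N = l" "y' N = n"
    and P: "\<And>G c c'. growth l n G \<Longrightarrow> G l n = d \<Longrightarrow> (\<And>k. k \<le> N \<Longrightarrow> c k = G (x k) (y k)) \<Longrightarrow>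
      (\<And>k. k \<le> N \<Longrightarrow> c' k = G (x' k) (y' k)) \<Longrightarrow> P c \<longleftrightarrow> P' c'"
  shows "card {c \<in> strip_chains N a d. P c} = card {c \<in> strip_chains N a d. P' c}"
proof -
  have "\<exists>G. growth l n G \<and> (\<forall>k\<le>N. G (x k) (y k) = c k)" if "c \<in> strip_chains N a d" for c
    using growth_exists_on_path[OF path, of c] that ends by (simp add: strip_chains_def)
  then obtain \<Gamma> where \<Gamma>: "\<And>c. c \<in> strip_chains N a d \<Longrightarrow> growth l n (\<Gamma> c)"
    "\<And>c k. c \<in> strip_chains N a d \<Longrightarrow> k \<le> N \<Longrightarrow> \<Gamma> c (x k) (y k) = c k"
    by metis
  have "\<exists>G. growth l n G \<and> (\<forall>k\<le>N. G (x' k) (y' k) = c k)" if "c \<in> strip_chains N a d" for c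
    using growth_exists_on_path[OF path', of c] that ends by (simp add: strip_chains_def)
  then obtain \<Gamma>' where \<Gamma>': "\<And>c. c \<in> strip_chains N a d \<Longrightarrow> growth l n (\<Gamma>' c)"
    "\<And>c k. c \<in> strip_chains N a d \<Longrightarrow> k \<le> N \<Longrightarrow> \<Gamma>' c (x' k) (y' k) = c k"
    by metis
  have start: "x 0 = 0" "y 0 = 0" "x' 0 = 0" "y' 0 = 0"
    using path path' by (simp_all add: lattice_path_def)
  \<comment> \<open>\<open>min k N\<close> freezes the chain at the corner of the rectangle, as
    \<open>strip_chains\<close> demands.\<close>
  define f where "f c k = \<Gamma> c (x' (min k N)) (y' (min k N))" for c k
  define g where "g c k = \<Gamma>' c (x (min k N)) (y (min k N))" for c k
  have f_app: "f c k = \<Gamma> c (x' (min k N)) (y' (min k N))"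
    and g_app: "g c k = \<Gamma>' c (x (min k N)) (y (min k N))" for c k
    by (simp_all add: f_def g_def)
  have corner: "\<Gamma> c 0 0 = a" "\<Gamma> c l n = d" if "c \<in> strip_chains N a d" for c
    using \<Gamma>(2)[OF that, of 0] \<Gamma>(2)[OF that, of N] that ends start by (simp_all add: strip_chains_def)
  have corner': "\<Gamma>' c 0 0 = a" "\<Gamma>' c l n = d" if "c \<in> strip_chains N a d" for c
    using \<Gamma>'(2)[OF that, of 0] \<Gamma>'(2)[OF that, of N] that ends start by (simp_all add: strip_chains_def)
  have f_in: "f c \<in> strip_chains N a d" if "c \<in> strip_chains N a d" for c
    using growth_path_strip_chain[OF path', of "\<Gamma> c"] \<Gamma>(1)[OF that] corner[OF that] ends
    unfolding f_def by simp
  have g_in: "g c \<in> strip_chains N a d" if "c \<in> strip_chains N a d" for c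
    using growth_path_strip_chain[OF path, of "\<Gamma>' c"] \<Gamma>'(1)[OF that] corner'[OF that] ends
    unfolding g_def by simp
  have f_P: "P c \<longleftrightarrow> P' (f c)" if "c \<in> strip_chains N a d" for c
    by (rule P[OF \<Gamma>(1)[OF that] corner(2)[OF that]]) (use \<Gamma>(2)[OF that] in \<open>simp_all add: f_app\<close>)
  have g_P: "P (g c) \<longleftrightarrow> P' c" if "c \<in> strip_chains N a d" for c
    by (rule P[OF \<Gamma>'(1)[OF that] corner'(2)[OF that]]) (use \<Gamma>'(2)[OF that] in \<open>simp_all add: g_app\<close>)
  have gf: "g (f c) = c" if c: "c \<in> strip_chains N a d" for c
  proof
    fix k
    have "\<Gamma>' (f c) (x' k) (y' k) = \<Gamma> c (x' k) (y' k)" if "k \<le> N" for k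
      using \<Gamma>'(2)[OF f_in[OF c] that] that by (simp add: f_app)
    then have "\<Gamma>' (f c) i j = \<Gamma> c i j" if "i \<le> l" "j \<le> n" for i j
      by (intro growth_unique_on_path[OF path'])
        (use ends \<Gamma>(1)[OF c] \<Gamma>'(1)[OF f_in[OF c]] that in simp_all)
    then have "g (f c) k = \<Gamma> c (x (min k N)) (y (min k N))"
      using lattice_path_mono[OF path, of "min k N"] ends unfolding g_app by simp
    also have "\<dots> = c (min k N)"
      using \<Gamma>(2)[OF c] by simp
    also have "\<dots> = c k"
      using c by (simp add: strip_chains_def min_def)
    finally show "g (f c) k = c k" .
  qed
  have fg: "f (g c) = c" if c: "c \<in> strip_chains N a d" for c
  proof
    fix k
    have "\<Gamma> (g c) (x k) (y k) = \<Gamma>' c (x k) (y k)" if "k \<le> N" for k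
      using \<Gamma>(2)[OF g_in[OF c] that] that by (simp add: g_app)
    then have "\<Gamma> (g c) i j = \<Gamma>' c i j" if "i \<le> l" "j \<le> n" for i j
      by (intro growth_unique_on_path[OF path])
        (use ends \<Gamma>'(1)[OF c] \<Gamma>(1)[OF g_in[OF c]] that in simp_all)
    then have "f (g c) k = \<Gamma>' c (x' (min k N)) (y' (min k N))"
      using lattice_path_mono[OF path', of "min k N"] ends unfolding f_app by simp
    also have "\<dots> = c (min k N)"
      using \<Gamma>'(2)[OF c] by simp
    also have "\<dots> = c k"
      using c by (simp add: strip_chains_def min_def)
    finally show "f (g c) k = c k" .
  qed
  have "bij_betw f {c \<in> strip_chains N a d. P c} {c \<in> strip_chains N a d. P' c}"
    by (rule bij_betw_byWitness[where f' = g]) (use gf fg f_in g_in f_P g_P in auto)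
  then show ?thesis
    by (rule bij_betw_same_card)
qed

lemma card_concatenated_chains:
  assumes "\<forall>i\<ge>R. d i = 0"
  shows "card {c \<in> strip_chains (l + n) a d. segment_cond c 0 l p K \<and> segment_cond c l n q L} =
    (\<Sum>b | b \<le> d. card (chains a b l p K) * card (chains b d n q L))"
proof -
  let ?X = "{c \<in> strip_chains (l + n) a d. segment_cond c 0 l p K \<and> segment_cond c l n q L}"
  let ?F = "\<lambda>b. {c \<in> ?X. c l = b}"
  have fin: "finite ?X" "finite {b. b \<le> d}"
    using finite_strip_chains[OF assms] finite_shapes_le[OF assms] by simp_all
  have "card ?X = card (\<Union>b\<in>{b. b \<le> d}. ?F b)"
    using strip_chains_le by (intro arg_cong[where f = card]) auto
  also have "\<dots> = (\<Sum>b | b \<le> d. card (?F b))"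
  proof (rule card_UN_disjoint)
    show "\<forall>b\<in>{b. b \<le> d}. finite (?F b)"
      by (intro ballI finite_subset[OF _ fin(1)]) blast
    show "finite {b. b \<le> d}"
      by (rule fin(2))
  qed blast
  also have "\<dots> = (\<Sum>b | b \<le> d. card (chains a b l p K \<times> chains b d n q L))"
  proof (intro sum.cong refl bij_betw_same_card)
    fix b assume "b \<in> {b. b \<le> d}"
    let ?f = "\<lambda>c. (\<lambda>k. c (min k l), \<lambda>k. c (l + k))"
    let ?g = "\<lambda>(u, v). \<lambda>k. if k \<le> l then u k else v (k - l)"
    show "bij_betw ?f (?F b) (chains a b l p K \<times> chains b d n q L)"
    proof (rule bij_betw_byWitness[where f' = ?g])
      show "\<forall>c\<in>?F b. ?g (?f c) = c"
        by auto
      show "\<forall>w\<in>chains a b l p K \<times> chains b d n q L. ?f (?g w) = w"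
        by (fastforce simp: chains_def strip_chains_def fun_eq_iff min_def)
      show "?f ` ?F b \<subseteq> chains a b l p K \<times> chains b d n q L"
      proof (rule image_subsetI)
        fix c assume c: "c \<in> ?F b"
        have "segment_cond (\<lambda>k. c (min k l)) 0 l p K = segment_cond c 0 l p K"
          "segment_cond (\<lambda>k. c (l + k)) 0 n q L = segment_cond c l n q L"
          by (rule segment_cond_cong; simp)+
        then show "?f c \<in> chains a b l p K \<times> chains b d n q L"
          using c by (auto simp: chains_def strip_chains_def min_def)
      qed
      show "?g ` (chains a b l p K \<times> chains b d n q L) \<subseteq> ?F b"
      proof (rule image_subsetI)
        fix w assume "w \<in> chains a b l p K \<times> chains b d n q L"
        then obtain u v where w: "w = (u, v)" "u \<in> chains a b l p K" "v \<in> chains b d n q L"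
          by blast
        then have joint: "u l = v 0" "u l = b"
          by (auto simp: chains_def strip_chains_def)
        have "segment_cond (?g w) 0 l p K = segment_cond u 0 l p K"
          by (rule segment_cond_cong) (simp add: w)
        moreover have "segment_cond (?g w) l n q L = segment_cond v 0 n q L"
          by (rule segment_cond_cong) (use w joint in auto)
        moreover have "?g w \<in> strip_chains (l + n) a d"
        proof -
          have "hstrip (?g w k) (?g w (Suc k))" if "k < l + n" for k
          proof -
            consider "k < l" | "k = l" | "k > l" by linarith
            then show ?thesis
            proof cases
              case 2
              then show ?thesis
                using w joint that by (auto simp: chains_def strip_chains_def)
            next
              case 3
              then show ?thesis
                using w that by (auto simp: chains_def strip_chains_def Suc_diff_le)
            qed (use w in \<open>auto simp: chains_def strip_chains_def\<close>)
          qed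
          moreover have "?g w 0 = a"
            using w by (auto simp: chains_def strip_chains_def)
          moreover have "?g w k = d" if "k \<ge> l + n" for k
            using w joint that by (cases "k = l") (auto simp: chains_def strip_chains_def)
          ultimately show ?thesis
            unfolding strip_chains_def by blast
        qed
        ultimately show "?g w \<in> ?F b"
          using w joint by (auto simp: chains_def)
      qed
    qed
  qed
  finally show ?thesis
    by (simp add: card_cartesian_product)
qed

text \<open>The two sides read the rectangle along its two boundary paths; the conditions on either
  alphabet are the same on opposite sides of the rectangle.\<close>

theorem card_chains_swap:
  assumes "\<forall>i\<ge>R. d i = 0"
  shows "(\<Sum>b | b \<le> d. card (chains a b l p K) * card (chains b d n q L)) =
    (\<Sum>b | b \<le> d. card (chains a b n q L) * card (chains b d l p K))"
proof -
  have "card {c \<in> strip_chains (l + n) a d. segment_cond c 0 l p K \<and> segment_cond c l n q L} =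
      card {c \<in> strip_chains (l + n) a d. segment_cond c 0 n q L \<and> segment_cond c n l p K}"
  proof (rule card_chains_on_paths)
    show "lattice_path (l + n) (\<lambda>k. min k l) (\<lambda>k. k - l)"
      "lattice_path (l + n) (\<lambda>k. k - n) (\<lambda>k. min k n)"
      by (auto simp: lattice_path_def)
    fix G c c'
    assume G: "growth l n G" "G l n = d"
      and c: "\<And>k. k \<le> l + n \<Longrightarrow> c k = G (min k l) (k - l)"
      and c': "\<And>k. k \<le> l + n \<Longrightarrow> c' k = G (k - n) (min k n)"
    have R: "\<forall>r\<ge>R. G l n r = 0"
      using assms G by simp
    have "segment_cond c 0 l p K = segment_cond (\<lambda>i. G i 0) 0 l p K"
      "segment_cond c l n q L = segment_cond (\<lambda>j. G l j) 0 n q L"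
      by (rule segment_cond_cong; simp add: c)+
    moreover have "segment_cond c' 0 n q L = segment_cond (\<lambda>j. G 0 j) 0 n q L"
      "segment_cond c' n l p K = segment_cond (\<lambda>i. G i n) 0 l p K"
      by (rule segment_cond_cong; simp add: c')+
    moreover have "segment_cond (\<lambda>i. G i n) 0 l p K = segment_cond (\<lambda>i. G i 0) 0 l p K"
      by (rule growth_segment_cond[OF G(1) R]) simp
    moreover have "segment_cond (\<lambda>j. G l j) 0 n q L = segment_cond (\<lambda>j. G 0 j) 0 n q L"
      by (rule growth_segment_cond[OF growth_transpose[OF G(1)] R]) simp
    ultimately show "(segment_cond c 0 l p K \<and> segment_cond c l n q L) =
        (segment_cond c' 0 n q L \<and> segment_cond c' n l p K)"
      by blast
  qed simp_all
  then show ?thesis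
    using card_concatenated_chains[OF assms, of l n a p K q L]
      card_concatenated_chains[OF assms, of n l a q L p K] by (simp add: add.commute)
qed

text \<open>Letter \<open>i\<close> of the first alphabet is step \<open>2 * i\<close>, letter
  \<open>i\<close> of the second is step \<open>2 * i + 1\<close>. As step \<open>k\<close> carries
  the tableau entry \<open>k + 1\<close>, they match the entries \<open>2 * i + 1\<close> and
  \<open>2 * i + 2\<close>, that is, the odd and even rows of the shuffle diagram.\<close>

definition shuffled_chains ::
  "shape \<Rightarrow> shape \<Rightarrow> nat \<Rightarrow> (nat \<Rightarrow> nat) \<Rightarrow> (nat \<Rightarrow> int) \<Rightarrow> (nat \<Rightarrow> nat) \<Rightarrow> (nat \<Rightarrow> int) \<Rightarrow>
    (nat \<Rightarrow> shape) set" where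
  "shuffled_chains a d n p K q L = {c \<in> strip_chains (2 * n) a d.
     (\<forall>i<n. shape_size (c (2 * i + 1)) = shape_size (c (2 * i)) + p i \<and>
       shape_size (c (2 * i + 2)) = shape_size (c (2 * i + 1)) + q i) \<and>
     (\<forall>i. Suc (Suc i) \<le> n \<longrightarrow>
       ne_excess_le (c (2 * i)) (c (2 * i + 1)) (c (2 * i + 2)) (c (2 * i + 3)) (K i) \<and>
       ne_excess_le (c (2 * i + 1)) (c (2 * i + 2)) (c (2 * i + 3)) (c (2 * i + 4)) (L i))}"

text \<open>A boundary path is compared with the staircase along the diagonal: on the staircase any
  two consecutive letters of one alphabet are separated by exactly one letter of the other, which is
  the situation of \<open>growth_excess_step\<close>.\<close>

theorem card_shuffled_chains:
  assumes "\<forall>i\<ge>R. d i = 0"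
  shows "card (shuffled_chains a d n p K q L) =
    (\<Sum>b | b \<le> d. card (chains a b n p K) * card (chains b d n q L))"
proof -
  have "card {c \<in> strip_chains (2 * n) a d. segment_cond c 0 n p K \<and> segment_cond c n n q L} =
      card (shuffled_chains a d n p K q L)"
    unfolding shuffled_chains_def
  proof (rule card_chains_on_paths)
    show "lattice_path (2 * n) (\<lambda>k. min k n) (\<lambda>k. k - n)"
      by (auto simp: lattice_path_def)
    have "(k + 1) div 2 = k div 2 \<or> (k + 1) div 2 = Suc (k div 2)"
      "(Suc k + 1) div 2 = Suc (k div 2)" for k :: nat
      by linarith+
    then show "lattice_path (2 * n) (\<lambda>k. (k + 1) div 2) (\<lambda>k. k div 2)"
      unfolding lattice_path_def by (auto simp: Suc_eq_plus1[symmetric] simp del: Suc_eq_plus1)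
    fix G c c'
    assume G: "growth n n G" "G n n = d"
      and c: "\<And>k. k \<le> 2 * n \<Longrightarrow> c k = G (min k n) (k - n)"
      and c': "\<And>k. k \<le> 2 * n \<Longrightarrow> c' k = G ((k + 1) div 2) (k div 2)"
    have R: "\<forall>r\<ge>R. G n n r = 0"
      using assms G by simp
    note G' = growth_transpose[OF G(1)]
    have "segment_cond c 0 n p K = segment_cond (\<lambda>i. G i 0) 0 n p K"
      "segment_cond c n n q L = segment_cond (\<lambda>j. G n j) 0 n q L"
      by (rule segment_cond_cong; simp add: c)+
    moreover have "segment_cond (\<lambda>j. G n j) 0 n q L = segment_cond (\<lambda>j. G 0 j) 0 n q L"
      by (rule growth_segment_cond[OF G' R]) simp
    moreover have c'_simps: "c' (2 * i) = G i i" "i < n \<Longrightarrow> c' (2 * i + 1) = G (Suc i) i"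
      "i < n \<Longrightarrow> c' (2 * i + 2) = G (Suc i) (Suc i)"
      "Suc i < n \<Longrightarrow> c' (2 * i + 3) = G (Suc (Suc i)) (Suc i)"
      "Suc i < n \<Longrightarrow> c' (2 * i + 4) = G (Suc (Suc i)) (Suc (Suc i))" if "i \<le> n" for i
    proof -
      have "(2 * i + 1) div 2 = i" "(2 * i + 1 + 1) div 2 = Suc i" "(2 * i + 2) div 2 = Suc i"
        "(2 * i + 2 + 1) div 2 = Suc i" "(2 * i + 3) div 2 = Suc i" "(2 * i + 3 + 1) div 2 = Suc (Suc i)"
        "(2 * i + 4) div 2 = Suc (Suc i)" "(2 * i + 4 + 1) div 2 = Suc (Suc i)"
        by linarith+
      then show "c' (2 * i) = G i i" "i < n \<Longrightarrow> c' (2 * i + 1) = G (Suc i) i"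
        "i < n \<Longrightarrow> c' (2 * i + 2) = G (Suc i) (Suc i)"
        "Suc i < n \<Longrightarrow> c' (2 * i + 3) = G (Suc (Suc i)) (Suc i)"
        "Suc i < n \<Longrightarrow> c' (2 * i + 4) = G (Suc (Suc i)) (Suc (Suc i))"
        using c'[of "2 * i"] c'[of "2 * i + 1"] c'[of "2 * i + 2"] c'[of "2 * i + 3"] c'[of "2 * i + 4"] that
        by simp_all
    qed
    moreover have "segment_cond (\<lambda>i. G i 0) 0 n p K \<longleftrightarrow>
        (\<forall>i<n. shape_size (G (Suc i) i) = shape_size (G i i) + p i) \<and>
        (\<forall>i. Suc (Suc i) \<le> n \<longrightarrow>
          ne_excess_le (G i i) (G (Suc i) i) (G (Suc i) (Suc i)) (G (Suc (Suc i)) (Suc i)) (K i))"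
    proof -
      have "shape_size (G (Suc i) 0) = shape_size (G i 0) + p i \<longleftrightarrow>
          shape_size (G (Suc i) i) = shape_size (G i i) + p i" if "i < n" for i
        using growth_size[OF G(1) R that, of i] that by linarith
      \<comment> \<open>On the staircase the letters \<open>i\<close> and \<open>i + 1\<close> of
        the first alphabet are separated by letter \<open>i\<close> of the second, hence height
        \<open>i\<close>.\<close>
      moreover have "excess_le (G i 0) (G (Suc i) 0) (G (Suc (Suc i)) 0) (K i) \<longleftrightarrow>
          ne_excess_le (G i i) (G (Suc i) i) (G (Suc i) (Suc i)) (G (Suc (Suc i)) (Suc i)) (K i)"
        if "Suc (Suc i) \<le> n" for i
        using growth_excess[OF G(1) that, of i "K i"] growth_excess_step(1)[OF G(1) that, of i "K i"] that
        by simp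
      ultimately show ?thesis
        unfolding segment_cond_def by (simp cong: conj_cong)
    qed
    moreover have "segment_cond (\<lambda>j. G 0 j) 0 n q L \<longleftrightarrow>
        (\<forall>i<n. shape_size (G (Suc i) (Suc i)) = shape_size (G (Suc i) i) + q i) \<and>
        (\<forall>i. Suc (Suc i) \<le> n \<longrightarrow>
          ne_excess_le (G (Suc i) i) (G (Suc i) (Suc i)) (G (Suc (Suc i)) (Suc i)) (G (Suc (Suc i)) (Suc (Suc i))) (L i))"
    proof -
      have "shape_size (G 0 (Suc i)) = shape_size (G 0 i) + q i \<longleftrightarrow>
          shape_size (G (Suc i) (Suc i)) = shape_size (G (Suc i) i) + q i" if "i < n" for i
        using growth_size[OF G' R that, of "Suc i"] that by linarith
      \<comment> \<open>For the second alphabet the separating letter is letter \<open>Suc i\<close>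
        of the first, hence the index is shifted by one.\<close>
      moreover have "excess_le (G 0 i) (G 0 (Suc i)) (G 0 (Suc (Suc i))) (L i) \<longleftrightarrow>
          ne_excess_le (G (Suc i) i) (G (Suc i) (Suc i)) (G (Suc (Suc i)) (Suc i)) (G (Suc (Suc i)) (Suc (Suc i))) (L i)"
        if "Suc (Suc i) \<le> n" for i
        using growth_excess[OF G' that, of "Suc i" "L i"] growth_excess_step(1)[OF G' that, of "Suc i" "L i"] that
        by simp
      ultimately show ?thesis
        unfolding segment_cond_def by (simp cong: conj_cong)
    qed
    ultimately show "(segment_cond c 0 n p K \<and> segment_cond c n n q L) =
       ((\<forall>i<n. shape_size (c' (2 * i + 1)) = shape_size (c' (2 * i)) + p i \<and>
         shape_size (c' (2 * i + 2)) = shape_size (c' (2 * i + 1)) + q i) \<and>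
       (\<forall>i. Suc (Suc i) \<le> n \<longrightarrow>
         ne_excess_le (c' (2 * i)) (c' (2 * i + 1)) (c' (2 * i + 2)) (c' (2 * i + 3)) (K i) \<and>
         ne_excess_le (c' (2 * i + 1)) (c' (2 * i + 2)) (c' (2 * i + 3)) (c' (2 * i + 4)) (L i)))"
      unfolding Suc_le_eq by (simp cong: conj_cong) blast
  qed simp_all
  then show ?thesis
    using card_concatenated_chains[OF assms, of n n a p K q L] by (simp add: mult_2)
qed

section \<open>The Littlewood--Richardson rule for chains of shapes\<close>

lemma sum_telescope_nat:
  fixes f :: "nat \<Rightarrow> nat"
  assumes "\<And>k. f k \<le> f (Suc k)"
  shows "f 0 + (\<Sum>k<n. f (Suc k) - f k) = f n"
proof (induction n)
  case (Suc n)
  then show ?case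
    using assms[of n] unfolding sum.lessThan_Suc by linarith
qed simp

lemma sum_telescope_int: "(\<Sum>k<n. f (Suc k) - f k) = f n - (f 0 :: int)"
  by (induction n) auto

lemma strip_chain_Suc_le:
  assumes "c \<in> strip_chains N a d"
  shows "c k i \<le> c (Suc k) i"
  using assms hstripD(1)[of "c k" "c (Suc k)" i] by (cases "k < N") (auto simp: strip_chains_def)

lemma strip_chain_shift_le:
  assumes "c \<in> strip_chains N a d" "antimono d"
  shows "c (Suc k) (Suc i) \<le> c k i"
proof (cases "k < N")
  case True
  then show ?thesis
    using assms(1) hstripD(2)[of "c k" "c (Suc k)" i] by (auto simp: strip_chains_def)
next
  case False
  then show ?thesis
    using assms antimonoD[of d i "Suc i"] by (auto simp: strip_chains_def)
qed

lemma strip_chains_vanish: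
  assumes "c \<in> strip_chains N a d" "\<forall>i\<ge>R. d i = 0"
  shows "\<forall>i\<ge>R. c k i = 0"
  using strip_chains_le[OF assms(1), of k] assms(2) by (metis le_funD le_zero_eq)

lemma strip_chains_empty:
  assumes "\<not> a \<le> d"
  shows "strip_chains N a d = {}"
proof -
  have "a \<le> d" if "c \<in> strip_chains N a d" for c
    using strip_chains_le[OF that, of 0] that by (simp add: strip_chains_def)
  then show ?thesis
    using assms by blast
qed

lemma strip_chains_antimono:
  assumes "c \<in> strip_chains N a d" "antimono a"
  shows "antimono d"
proof (cases N)
  case (Suc M)
  then have "hstrip (c M) d"
    using assms(1) unfolding strip_chains_def by (auto dest: spec[of _ M])
  then show ?thesis
    by (rule hstrip_antimono)
qed (use assms in \<open>auto simp: strip_chains_def\<close>)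

lemma antimono_zero: "antimono (\<lambda>_. 0 :: nat)"
  by (simp add: antimono_def)

text \<open>Inductively, letter \<open>j\<close> occurs in row \<open>j\<close> only. Above that row
  it would need letters \<open>j - 1\<close> in still higher rows, but these all lie in row
  \<open>j - 1\<close>; below it the strip condition forbids it, since \<open>c j\<close> has at
  most \<open>j\<close> rows. The multiplicity then fixes the length of row
  \<open>j\<close>.\<close>

lemma chain_eq_superstandard:
  fixes m :: shape
  assumes c: "c \<in> chains (\<lambda>_. 0) b l m (\<lambda>_. 0)" and "k \<le> l"
  shows "c k = (\<lambda>i. if i < k then m i else 0)"
  using assms(2)
proof (induction k rule: less_induct)
  case (less k)
  have strips: "hstrip (c j) (c (Suc j))" if "j < l" for j
    using c that by (simp add: chains_def strip_chains_def)
  have size: "shape_size (c (Suc j)) = shape_size (c j) + m j" if "j < l" for j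
    using c that by (simp add: chains_def segment_cond_def)
  show ?case
  proof (cases k)
    case 0
    then show ?thesis
      using c by (simp add: chains_def strip_chains_def)
  next
    case (Suc j)
    have IH: "c j = (\<lambda>i. if i < j then m i else 0)"
      using less Suc by simp
    have low: "c k i = m i" if "i < j" for i
    proof -
      obtain h where j: "j = Suc h"
        using \<open>i < j\<close> by (cases j) auto
      have IH': "c h = (\<lambda>i. if i < h then m i else 0)"
        using less Suc j by simp
      have "excess_le (c h) (c j) (c k) 0"
        using c less.prems Suc j unfolding chains_def segment_cond_def by auto
      then have "(\<Sum>i\<le>h. int (c k i) - int (c j i)) \<le> (\<Sum>i<h. int (c j i) - int (c h i))"
        unfolding excess_le_def by simp
      also have "\<dots> = 0"
        by (rule sum.neutral) (use IH IH' in \<open>simp add: j\<close>)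
      finally have "(\<Sum>i\<le>h. int (c k i) - int (c j i)) \<le> 0" .
      moreover have nonneg: "int (c k i) - int (c j i) \<ge> 0" for i
        using hstripD(1)[OF strips[of j]] less.prems Suc by simp
      moreover have "int (c k i) - int (c j i) \<le> (\<Sum>i\<le>h. int (c k i) - int (c j i))"
        using that j by (intro member_le_sum nonneg) auto
      ultimately have "int (c k i) - int (c j i) = 0"
        using nonneg[of i] by linarith
      then show ?thesis
        using IH that by simp
    qed
    have high: "c k i = 0" if "i \<ge> k" for i
    proof -
      have i: "i = Suc (i - 1)" "i - 1 \<ge> j"
        using that Suc by simp_all
      have "c k (Suc (i - 1)) \<le> c j (i - 1)"
        using hstripD(2)[OF strips[of j]] less.prems Suc by simp
      then show ?thesis
        using i IH by simp
    qed
    have "shape_size (c k) = (\<Sum>i<k. c k i)"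
      by (rule shape_size_eq) (use high in auto)
    also have "\<dots> = (\<Sum>i<j. m i) + c k j"
      using low Suc by simp
    finally have "shape_size (c k) = (\<Sum>i<j. m i) + c k j" .
    moreover have "shape_size (c j) = (\<Sum>i<j. m i)"
      by (subst shape_size_eq[of j]) (auto simp: IH)
    ultimately have "c k j = m j"
      using size[of j] less.prems Suc by simp
    then show ?thesis
      using low high Suc by (auto simp: fun_eq_iff less_Suc_eq not_less)
  qed
qed

lemma superstandard_in_chains:
  fixes m :: shape
  assumes "antimono m" "\<forall>i\<ge>l. m i = 0"
  shows "(\<lambda>k i. if i < k then m i else 0) \<in> chains (\<lambda>_. 0) m l m (\<lambda>_. 0)"
proof -
  define c :: "nat \<Rightarrow> shape" where "c k i = (if i < k then m i else 0)" for k i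
  have "hstrip (c k) (c (Suc k))" for k
    using assms(1) unfolding hstrip_def c_def by (auto simp: antimono_def)
  moreover have "c k = m" if "k \<ge> l" for k
    using assms(2) that by (auto simp: c_def fun_eq_iff)
  moreover have "shape_size (c k) = (\<Sum>i<k. m i)" for k
    by (subst shape_size_eq[of k]) (auto simp: c_def)
  moreover have "excess_le (c k) (c (Suc k)) (c (Suc (Suc k))) 0" for k
    unfolding excess_le_def
  proof
    fix r
    have "(\<Sum>i\<le>r. int (c (Suc (Suc k)) i) - int (c (Suc k) i)) =
        (\<Sum>i\<le>r. if i = Suc k then int (m (Suc k)) else 0)"
      by (rule sum.cong) (auto simp: c_def)
    also have "\<dots> \<le> (\<Sum>i<r. if i = k then int (m k) else 0)"
      using antimonoD[OF assms(1), of k "Suc k"] by (simp add: Suc_le_eq)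
    also have "\<dots> = (\<Sum>i<r. int (c (Suc k) i) - int (c k i))"
      by (rule sum.cong) (auto simp: c_def)
    finally show "(\<Sum>i\<le>r. int (c (Suc (Suc k)) i) - int (c (Suc k) i)) \<le>
        0 + (\<Sum>i<r. int (c (Suc k) i) - int (c k i))"
      by simp
  qed
  ultimately have "c \<in> chains (\<lambda>_. 0) m l m (\<lambda>_. 0)"
    unfolding chains_def strip_chains_def segment_cond_def by (simp add: c_def fun_eq_iff)
  moreover have "c = (\<lambda>k i. if i < k then m i else 0)"
    by (simp add: c_def fun_eq_iff)
  ultimately show ?thesis
    by simp
qed

lemma card_superstandard_chains:
  fixes m :: shape
  assumes "antimono m" "\<forall>i\<ge>l. m i = 0"
  shows "card (chains (\<lambda>_. 0) b l m (\<lambda>_. 0)) = (if b = m then 1 else 0)"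
proof -
  let ?s = "\<lambda>k i. if i < k then m i else 0"
  have uniq: "c = ?s \<and> b = m" if c: "c \<in> chains (\<lambda>_. 0) b l m (\<lambda>_. 0)" for c
  proof -
    have ends: "c k = b" if "k \<ge> l" for k
      using c that by (simp add: chains_def strip_chains_def)
    have b: "b = m"
    proof
      fix i
      have "b i = c l i"
        using ends[of l] by simp
      also have "\<dots> = m i"
        unfolding chain_eq_superstandard[OF c order_refl] using assms(2) by simp
      finally show "b i = m i" .
    qed
    have "c k = (\<lambda>i. if i < k then m i else 0)" for k
    proof (cases "k \<le> l")
      case True
      then show ?thesis
        by (rule chain_eq_superstandard[OF c])
    next
      case False
      then show ?thesis
        using ends[of k] b assms(2) by (simp add: fun_eq_iff)
    qed
    then show ?thesis
      using b by blast
  qed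
  have sub: "chains (\<lambda>_. 0) b l m (\<lambda>_. 0) \<subseteq> (if b = m then {?s} else {})"
  proof
    fix c assume "c \<in> chains (\<lambda>_. 0) b l m (\<lambda>_. 0)"
    from uniq[OF this] show "c \<in> (if b = m then {?s} else {})"
      by (elim conjE) simp
  qed
  show ?thesis
  proof (cases "b = m")
    case True
    then have "chains (\<lambda>_. 0) b l m (\<lambda>_. 0) = {?s}"
      using sub superstandard_in_chains[OF assms] by (intro equalityI) simp_all
    then show ?thesis
      using True by simp
  qed (use sub in simp)
qed

text \<open>
  Prefixing a chain by the superstandard tableau of shape \<open>m\<close> and moving the prefix to the end
  is jeu de taquin rectification.
\<close>

theorem card_chains_expansion:
  assumes "antimono m" "\<forall>i\<ge>l. m i = 0" "\<forall>i\<ge>R. d i = 0"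
  shows "card (chains m d n q L) =
    (\<Sum>b | b \<le> d. card (chains (\<lambda>_. 0) b n q L) * card (chains b d l m (\<lambda>_. 0)))"
proof -
  have "(\<Sum>b | b \<le> d. card (chains (\<lambda>_. 0) b n q L) * card (chains b d l m (\<lambda>_. 0))) =
      (\<Sum>b | b \<le> d. card (chains (\<lambda>_. 0) b l m (\<lambda>_. 0)) * card (chains b d n q L))"
    by (rule card_chains_swap[OF assms(3)])
  also have "\<dots> = (\<Sum>b | b \<le> d. if b = m then card (chains m d n q L) else 0)"
    by (rule sum.cong) (auto simp: card_superstandard_chains[OF assms(1,2)])
  also have "\<dots> = (if m \<le> d then card (chains m d n q L) else 0)"
    using finite_shapes_le[OF assms(3)] by (simp add: sum.delta')
  also have "\<dots> = card (chains m d n q L)"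
    by (simp add: chains_def strip_chains_empty)
  finally show ?thesis ..
qed

text \<open>Symmetry of Littlewood-Richardson coefficients: for content \<open>m'\<close> and excess
  0 the straight-shape factor in \<open>card_chains_expansion\<close> is 1 at \<open>b = m'\<close>
  and 0 elsewhere, so a single summand survives.\<close>

lemma card_LR_chains_commute:
  assumes "antimono m" "\<forall>i\<ge>l. m i = 0" "antimono m'" "\<forall>i\<ge>n. m' i = 0" "\<forall>i\<ge>R. d i = 0"
  shows "card (chains m d n m' (\<lambda>_. 0)) = card (chains m' d l m (\<lambda>_. 0))"
proof -
  have "card (chains m d n m' (\<lambda>_. 0)) =
      (\<Sum>b | b \<le> d. if b = m' then card (chains m' d l m (\<lambda>_. 0)) else 0)"
    unfolding card_chains_expansion[OF assms(1,2,5), of n m']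
    by (rule sum.cong) (auto simp: card_superstandard_chains[OF assms(3,4)])
  also have "\<dots> = (if m' \<le> d then card (chains m' d l m (\<lambda>_. 0)) else 0)"
    using finite_shapes_le[OF assms(5)] by (simp add: sum.delta')
  also have "\<dots> = card (chains m' d l m (\<lambda>_. 0))"
    by (simp add: chains_def strip_chains_empty)
  finally show ?thesis .
qed

section \<open>Companion tableaux\<close>

text \<open>
  The companion tableau has as many entries \<open>i\<close> in row \<open>j\<close> as the given one has entries \<open>j\<close> in
  row \<open>i\<close>; it exchanges the lattice word condition and column strictness.
\<close>

definition companion :: "(nat \<Rightarrow> shape) \<Rightarrow> nat \<Rightarrow> shape" where
  "companion c i j = (\<Sum>i'<i. c (Suc j) i' - c j i')"

text \<open>Here the bound \<open>m i - m (i + 1)\<close> originates: counting letters row by row,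
  rows \<open>i\<close> and \<open>i + 1\<close> start at different columns, and column strictness
  involves this offset of the inner shape.\<close>

lemma companion_in_chains:
  assumes c: "c \<in> chains m d r ka (\<lambda>_. 0)"
    and d: "antimono d" "\<forall>i\<ge>n. d i = 0" and ka: "\<forall>j\<ge>r. ka j = 0"
  shows "companion c \<in> chains (\<lambda>_. 0) ka n (\<lambda>i. d i - m i) (\<lambda>i. int (m i) - int (m (Suc i)))"
proof -
  have sc: "c \<in> strip_chains r m d"
    using c by (simp add: chains_def)
  note mono = strip_chain_Suc_le[OF sc]
  have c0: "c 0 = m" and cr: "c k = d" if "k \<ge> r" for k
    using sc that by (simp_all add: strip_chains_def)
  have c0: "c 0 = m"
    using sc by (simp add: strip_chains_def)
  have vanish: "companion c i j = 0" if "j \<ge> r" for i j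
    using that by (simp add: companion_def cr)
  have companion_int: "int (companion c i j) = (\<Sum>i'<i. int (c (Suc j) i') - int (c j i'))" for i j
    unfolding companion_def by (simp add: of_nat_diff mono)
  have diff: "int (companion c (Suc i) j) - int (companion c i j) = int (c (Suc j) i) - int (c j i)" for i j
    by (simp add: companion_int)
  have partial: "(\<Sum>j<s. int (companion c (Suc i) j) - int (companion c i j)) = int (c s i) - int (m i)" for i s
    unfolding diff using sum_telescope_int[of "\<lambda>k. int (c k i)" s] by (simp add: c0)
  have full: "companion c i = ka" if "i \<ge> n" for i
  proof
    fix j
    have z: "\<forall>x\<ge>i. c k x = 0" for k
      using strip_chains_vanish[OF sc d(2)] that by auto
    have "int (companion c i j) = int (shape_size (c (Suc j))) - int (shape_size (c j))"
      by (simp add: companion_int shape_size_eq[OF z] sum_subtractf)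
    also have "\<dots> = int (ka j)"
    proof (cases "j < r")
      case True
      then show ?thesis
        using c by (simp add: chains_def segment_cond_def)
    next
      case False
      then show ?thesis
        using ka by (simp add: cr)
    qed
    finally show "companion c i j = ka j"
      by simp
  qed
  have strip: "hstrip (companion c i) (companion c (Suc i))" for i
    unfolding hstrip_def
  proof (intro allI conjI)
    fix j
    show "companion c i j \<le> companion c (Suc i) j"
      by (simp add: companion_def)
    \<comment> \<open>Letters \<open>Suc j\<close> in rows up to \<open>i\<close> against letters
      \<open>j\<close> in rows before \<open>i\<close>: this is the bracketing condition with excess
      0.\<close>
    show "companion c (Suc i) (Suc j) \<le> companion c i j"
    proof (cases "Suc (Suc j) \<le> r")
      case True
      then have "excess_le (c j) (c (Suc j)) (c (Suc (Suc j))) 0"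
        using c by (simp add: chains_def segment_cond_def)
      then have "int (companion c (Suc i) (Suc j)) \<le> int (companion c i j)"
        unfolding companion_int excess_le_def lessThan_Suc_atMost by simp
      then show ?thesis
        by simp
    next
      case False
      then show ?thesis
        by (simp add: vanish)
    qed
  qed
  have size: "shape_size (companion c (Suc i)) = shape_size (companion c i) + (d i - m i)" for i
  proof -
    have z: "\<forall>x\<ge>r. companion c k x = 0" for k
      using vanish by simp
    have "int (shape_size (companion c (Suc i))) - int (shape_size (companion c i)) = int (d i) - int (m i)"
      using partial[of i r] by (simp add: shape_size_eq[OF z] sum_subtractf cr)
    moreover have "m i \<le> d i"
      using strip_chains_le[OF sc, of 0] c0 by (simp add: le_fun_def)
    ultimately show ?thesis
      by linarith
  qed
  \<comment> \<open>By \<open>partial\<close> the inequality at \<open>r\<close> says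
    \<open>c (r+1) (i+1) - m (i+1) <= (m i - m (i+1)) + (c r i - m i)\<close>. The inner parts
    cancel and leave \<open>c (r+1) (i+1) <= c r i\<close>, the strip condition of the original
    chain.\<close>
  have excess: "excess_le (companion c i) (companion c (Suc i)) (companion c (Suc (Suc i)))
      (int (m i) - int (m (Suc i)))" for i
    unfolding excess_le_def lessThan_Suc_atMost[symmetric] partial
    using strip_chain_shift_le[OF sc d(1)] by simp
  show ?thesis
    unfolding chains_def strip_chains_def segment_cond_def
    using full strip size excess by (simp add: companion_def fun_eq_iff)
qed

text \<open>The difference \<open>e (Suc i) j' - e i j'\<close> is the number of letters
  \<open>j'\<close> in row \<open>i\<close>; the rows of the original tableau are refilled from
  these numbers.\<close>

definition companion_inv :: "shape \<Rightarrow> (nat \<Rightarrow> shape) \<Rightarrow> nat \<Rightarrow> shape" where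
  "companion_inv m e j i = m i + (\<Sum>j'<j. e (Suc i) j' - e i j')"

text \<open>The roles are mirrored: the excess bounds on \<open>e\<close> give the strips, and the
  strips of \<open>e\<close> give excess 0.\<close>

lemma companion_inv_in_chains:
  assumes e: "e \<in> chains (\<lambda>_. 0) ka n (\<lambda>i. d i - m i) (\<lambda>i. int (m i) - int (m (Suc i)))"
    and md: "m \<le> d" "\<forall>i\<ge>n. d i = 0" and ka: "antimono ka" "\<forall>j\<ge>r. ka j = 0"
  shows "companion_inv m e \<in> chains m d r ka (\<lambda>_. 0)"
proof -
  have sc: "e \<in> strip_chains n (\<lambda>_. 0) ka"
    using e by (simp add: chains_def)
  note mono = strip_chain_Suc_le[OF sc]
  have e0: "e 0 = (\<lambda>_. 0)"
    using sc by (simp add: strip_chains_def)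
  have en: "e i = ka" if "i \<ge> n" for i
    using sc that by (simp add: strip_chains_def)
  have mn: "m i = 0" if "i \<ge> n" for i
    using md that by (metis le_fun_def le_zero_eq)
  have z: "\<forall>j\<ge>r. e i j = 0" for i
    by (rule strip_chains_vanish[OF sc ka(2)])
  have inv_int: "int (companion_inv m e j i) = int (m i) + (\<Sum>j'<j. int (e (Suc i) j') - int (e i j'))" for i j
    unfolding companion_inv_def by (simp add: of_nat_diff mono)
  have diff: "int (companion_inv m e (Suc j) i) - int (companion_inv m e j i) = int (e (Suc i) j) - int (e i j)" for i j
    by (simp add: inv_int)
  have partial: "(\<Sum>i<s. int (companion_inv m e (Suc j) i) - int (companion_inv m e j i)) = int (e s j)" for j s
    unfolding diff using sum_telescope_int[of "\<lambda>i. int (e i j)" s] by (simp add: e0)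
  have high: "companion_inv m e j i = 0" if "i \<ge> n" for i j
    using that by (simp add: companion_inv_def en mn)
  have full: "companion_inv m e j = d" if "j \<ge> r" for j
  proof
    fix i
    show "companion_inv m e j i = d i"
    proof (cases "i < n")
      case True
      have z': "\<forall>x\<ge>j. e k x = 0" for k
        using z that by auto
      have "int (companion_inv m e j i) = int (m i) + (int (shape_size (e (Suc i))) - int (shape_size (e i)))"
        by (simp add: inv_int shape_size_eq[OF z'] sum_subtractf)
      also have "\<dots> = int (d i)"
        using True e le_funD[OF md(1), of i] by (simp add: chains_def segment_cond_def)
      finally show ?thesis
        by simp
    next
      case False
      then show ?thesis
        using high md(2) by simp
    qed
  qed
  have strip: "hstrip (companion_inv m e j) (companion_inv m e (Suc j))" for j
    unfolding hstrip_def
  proof (intro allI conjI)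
    fix i
    show "companion_inv m e j i \<le> companion_inv m e (Suc j) i"
      by (simp add: companion_inv_def)
    show "companion_inv m e (Suc j) (Suc i) \<le> companion_inv m e j i"
    proof (cases "Suc (Suc i) \<le> n")
      case True
      then have "excess_le (e i) (e (Suc i)) (e (Suc (Suc i))) (int (m i) - int (m (Suc i)))"
        using e by (simp add: chains_def segment_cond_def)
      then have "int (companion_inv m e (Suc j) (Suc i)) \<le> int (companion_inv m e j i)"
        unfolding inv_int excess_le_def lessThan_Suc_atMost by (auto dest: spec[of _ j])
      then show ?thesis
        by simp
    next
      case False
      then show ?thesis
        by (simp add: high)
    qed
  qed
  have size: "shape_size (companion_inv m e (Suc j)) = shape_size (companion_inv m e j) + ka j" for j
  proof -
    have z': "\<forall>x\<ge>n. companion_inv m e k x = 0" for k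
      using high by simp
    have "int (shape_size (companion_inv m e (Suc j))) - int (shape_size (companion_inv m e j)) = int (ka j)"
      using partial[of j n] by (simp add: shape_size_eq[OF z'] sum_subtractf en)
    then show ?thesis
      by linarith
  qed
  have excess: "excess_le (companion_inv m e j) (companion_inv m e (Suc j)) (companion_inv m e (Suc (Suc j))) 0" for j
    unfolding excess_le_def lessThan_Suc_atMost[symmetric] partial
    using strip_chain_shift_le[OF sc ka(1)] by simp
  show ?thesis
    unfolding chains_def strip_chains_def segment_cond_def
    using full strip size excess by (simp add: companion_inv_def fun_eq_iff)
qed

lemma card_companion_chains:
  assumes "m \<le> d" "antimono d" "\<forall>i\<ge>n. d i = 0" "antimono ka" "\<forall>j\<ge>r. ka j = 0"
  shows "card (chains m d r ka (\<lambda>_. 0)) =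
    card (chains (\<lambda>_. 0) ka n (\<lambda>i. d i - m i) (\<lambda>i. int (m i) - int (m (Suc i))))"
proof (rule bij_betw_same_card[of companion], rule bij_betw_byWitness[where f' = "companion_inv m"])
  show "\<forall>c\<in>chains m d r ka (\<lambda>_. 0). companion_inv m (companion c) = c"
  proof (intro ballI ext)
    fix c j i assume "c \<in> chains m d r ka (\<lambda>_. 0)"
    then have sc: "c \<in> strip_chains r m d" "c 0 = m"
      by (simp_all add: chains_def strip_chains_def)
    have "companion_inv m (companion c) j i = c 0 i + (\<Sum>j'<j. c (Suc j') i - c j' i)"
      by (simp add: companion_inv_def companion_def sc(2))
    also have "\<dots> = c j i"
      by (rule sum_telescope_nat) (rule strip_chain_Suc_le[OF sc(1)])
    finally show "companion_inv m (companion c) j i = c j i" .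
  qed
  show "\<forall>e\<in>chains (\<lambda>_. 0) ka n (\<lambda>i. d i - m i) (\<lambda>i. int (m i) - int (m (Suc i))).
      companion (companion_inv m e) = e"
  proof (intro ballI ext)
    fix e i j assume "e \<in> chains (\<lambda>_. 0) ka n (\<lambda>i. d i - m i) (\<lambda>i. int (m i) - int (m (Suc i)))"
    then have sc: "e \<in> strip_chains n (\<lambda>_. 0) ka" "e 0 = (\<lambda>_. 0)"
      by (simp_all add: chains_def strip_chains_def)
    have "companion (companion_inv m e) i j = e 0 j + (\<Sum>i'<i. e (Suc i') j - e i' j)"
      by (simp add: companion_inv_def companion_def sc(2))
    also have "\<dots> = e i j"
      by (rule sum_telescope_nat) (rule strip_chain_Suc_le[OF sc(1)])
    finally show "companion (companion_inv m e) i j = e i j" .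
  qed
qed (use companion_in_chains companion_inv_in_chains assms in blast)+

text \<open>Symmetry turns the content \<open>m\<close> into the inner shape and \<open>ka\<close>
  into the content; the companion then turns the content \<open>ka\<close> into a straight
  shape.\<close>

lemma card_LR_chains:
  assumes "m \<le> d" "antimono m" "antimono d" "\<forall>i\<ge>n. d i = 0" "antimono ka" "\<forall>j\<ge>r. ka j = 0"
  shows "card (chains ka d n m (\<lambda>_. 0)) =
    card (chains (\<lambda>_. 0) ka n (\<lambda>i. d i - m i) (\<lambda>i. int (m i) - int (m (Suc i))))"
proof -
  have mn: "\<forall>i\<ge>n. m i = 0"
    using assms(1,4) by (metis le_fun_def le_zero_eq)
  show ?thesis
    using card_LR_chains_commute[OF assms(2) mn assms(5,6,4)] card_companion_chains[OF assms(1,3-6)]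
    by simp
qed

section \<open>Joining two skew shapes into one\<close>

text \<open>
  For large \<open>Q\<close> the two skew shapes sit in one skew shape with \<open>2 * n\<close> rows and share no column,
  so the product of their Schur functions is a single skew Schur function.
\<close>

definition join_shapes :: "nat \<Rightarrow> nat \<Rightarrow> shape \<Rightarrow> shape \<Rightarrow> shape" where
  "join_shapes n Q a b i = (if i < n then Q + a i else b (i - n))"

text \<open>No more letters can stay unmatched than there are. This makes a bracketing condition
  vacuous whenever its bound reaches the multiplicity.\<close>

lemma excess_le_size:
  assumes "hstrip a b" "hstrip b c" "\<forall>i\<ge>R. c i = 0" "int (shape_size c) \<le> int (shape_size b) + k"
  shows "excess_le a b c k"
  unfolding excess_le_def
proof
  fix r
  let ?M = "Suc (max R r)"
  have zc: "\<forall>i\<ge>?M. c i = 0"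
    using assms(3) by simp
  have zb: "\<forall>i\<ge>?M. b i = 0"
    using zc hstripD(1)[OF assms(2)] by (metis le_zero_eq)
  have "(\<Sum>i\<le>r. int (c i) - int (b i)) \<le> (\<Sum>i<?M. int (c i) - int (b i))"
    using hstripD(1)[OF assms(2)] by (intro sum_mono2) auto
  also have "\<dots> = int (shape_size c) - int (shape_size b)"
    by (simp add: shape_size_eq[OF zc] shape_size_eq[OF zb] sum_subtractf)
  also have "\<dots> \<le> k"
    using assms(4) by simp
  also have "\<dots> \<le> k + (\<Sum>i<r. int (b i) - int (a i))"
    using hstripD(1)[OF assms(1)] by (simp add: sum_nonneg)
  finally show "(\<Sum>i\<le>r. int (c i) - int (b i)) \<le> k + (\<Sum>i<r. int (b i) - int (a i))" .
qed

text \<open>The first \<open>n\<close> letters record the rows of the first factor, the last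
  \<open>n\<close> those of the second. Once the condition at the seam is seen to be automatic, the
  chain splits into two independent blocks, which can be shuffled.\<close>

theorem card_joined_chains:
  fixes l m l' m' :: shape and n :: nat
  assumes "m' \<le> l'" "l' 0 \<le> Q" "\<forall>i\<ge>R. ka i = 0"
  defines "d \<equiv> join_shapes n Q l l'" and "a \<equiv> join_shapes n Q m m'"
  shows "card (chains (\<lambda>_. 0) ka (2 * n) (\<lambda>i. d i - a i) (\<lambda>i. int (a i) - int (a (Suc i)))) =
    card (shuffled_chains (\<lambda>_. 0) ka n (\<lambda>i. l i - m i) (\<lambda>i. int (m i) - int (m (Suc i)))
      (\<lambda>i. l' i - m' i) (\<lambda>i. int (m' i) - int (m' (Suc i))))"
proof -
  let ?p = "\<lambda>i. d i - a i" and ?K = "\<lambda>i. int (a i) - int (a (Suc i))"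
  let ?p1 = "\<lambda>i. l i - m i" and ?K1 = "\<lambda>i. int (m i) - int (m (Suc i))"
  let ?p2 = "\<lambda>i. l' i - m' i" and ?K2 = "\<lambda>i. int (m' i) - int (m' (Suc i))"
  have p: "?p i = ?p1 i" if "i < n" for i
    using that by (simp add: d_def a_def join_shapes_def)
  have p': "?p (n + i) = ?p2 i" for i
    by (simp add: d_def a_def join_shapes_def)
  have K: "?K i = ?K1 i" if "Suc i < n" for i
    using that by (simp add: a_def join_shapes_def)
  have K': "?K (n + i) = ?K2 i" for i
    by (simp add: a_def join_shapes_def Suc_diff_le)
  have "segment_cond c 0 (2 * n) ?p ?K \<longleftrightarrow> segment_cond c 0 n ?p1 ?K1 \<and> segment_cond c n n ?p2 ?K2"
    if c: "c \<in> strip_chains (n + n) (\<lambda>_. 0) ka" for c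
  proof
    assume *: "segment_cond c 0 (2 * n) ?p ?K"
    show "segment_cond c 0 n ?p1 ?K1 \<and> segment_cond c n n ?p2 ?K2"
      unfolding segment_cond_def
    proof (intro conjI allI impI)
      fix i assume "i < n"
      then show "shape_size (c (0 + Suc i)) = shape_size (c (0 + i)) + ?p1 i"
        "shape_size (c (n + Suc i)) = shape_size (c (n + i)) + ?p2 i"
        using * p[of i] p'[of i] unfolding segment_cond_def
        by (auto dest: spec[of _ i] spec[of _ "n + i"])
    next
      fix i assume "Suc (Suc i) \<le> n"
      then show "excess_le (c (0 + i)) (c (0 + Suc i)) (c (0 + Suc (Suc i))) (?K1 i)"
        "excess_le (c (n + i)) (c (n + Suc i)) (c (n + Suc (Suc i))) (?K2 i)"
        using * K[of i] K'[of i] unfolding segment_cond_def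
        by (auto dest: spec[of _ i] spec[of _ "n + i"])
    qed
  next
    assume *: "segment_cond c 0 n ?p1 ?K1 \<and> segment_cond c n n ?p2 ?K2"
    show "segment_cond c 0 (2 * n) ?p ?K"
      unfolding segment_cond_def
    proof (intro conjI allI impI)
      fix i assume i: "i < 2 * n"
      show "shape_size (c (0 + Suc i)) = shape_size (c (0 + i)) + ?p i"
      proof (cases "i < n")
        case True
        then show ?thesis
          using * p[of i] by (simp add: segment_cond_def)
      next
        case False
        then obtain i' where "i = n + i'" "i' < n"
          using i by (metis add_less_cancel_left le_add_diff_inverse mult_2 not_less)
        then show ?thesis
          using * p'[of i'] by (simp add: segment_cond_def)
      qed
    next
      fix i assume i: "Suc (Suc i) \<le> 2 * n"
      consider "Suc (Suc i) \<le> n" | "n = Suc i" | i' where "i = n + i'" "Suc (Suc i') \<le> n"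
      proof -
        have "i = n + (i - n) \<and> Suc (Suc (i - n)) \<le> n" if "n \<le> i"
          using i that by linarith
        then show ?thesis
          using that by (metis not_less_eq_eq le_antisym not_less_eq)
      qed
      then show "excess_le (c (0 + i)) (c (0 + Suc i)) (c (0 + Suc (Suc i))) (?K i)"
      proof cases
        case 1
        then show ?thesis
          using * K[of i] by (simp add: segment_cond_def)
      next
        case 2
        \<comment> \<open>The seam: the bound here is \<open>Q + m (n-1) - m' 0\<close>, at least
          \<open>l' 0 - m' 0\<close> because \<open>l' 0 <= Q\<close>, and the latter is the
          multiplicity of letter \<open>n\<close>.\<close>
        have "shape_size (c (Suc (Suc i))) = shape_size (c (Suc i)) + ?p2 0"
          using * 2 by (auto simp: segment_cond_def dest: spec[of _ 0])
        moreover have "int (?p2 0) \<le> ?K i"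
          using 2 assms(2) le_funD[OF assms(1), of 0] by (simp add: a_def join_shapes_def)
        moreover have "hstrip (c i) (c (Suc i))" "hstrip (c (Suc i)) (c (Suc (Suc i)))"
          using c 2 by (simp_all add: strip_chains_def)
        ultimately show ?thesis
          using strip_chains_vanish[OF c assms(3)] by (auto intro!: excess_le_size)
      next
        case 3
        then show ?thesis
          using * K'[of i'] by (simp add: segment_cond_def)
      qed
    qed
  qed
  then have "chains (\<lambda>_. 0) ka (2 * n) ?p ?K =
      {c \<in> strip_chains (n + n) (\<lambda>_. 0) ka. segment_cond c 0 n ?p1 ?K1 \<and> segment_cond c n n ?p2 ?K2}"
    unfolding chains_def by (auto simp: mult_2)
  then show ?thesis
    using card_concatenated_chains[OF assms(3), of n n "\<lambda>_. 0" ?p1 ?K1 ?p2 ?K2]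
      card_shuffled_chains[OF assms(3), of "\<lambda>_. 0" n ?p1 ?K1 ?p2 ?K2] by simp
qed

section \<open>Northeast pairings\<close>

text \<open>Rows of squares are numbered from 1 while shapes are indexed from 0, hence the
  shift.\<close>

definition cells :: "shape \<Rightarrow> shape \<Rightarrow> square set" where
  "cells a b = {(i, j). 1 \<le> i \<and> a (i - 1) < j \<and> j \<le> b (i - 1)}"

lemma cells_iff [simp]:
  "(Suc i, j) \<in> cells a b \<longleftrightarrow> a i < j \<and> j \<le> b i" "(0, j) \<notin> cells a b"
  by (auto simp: cells_def)

lemma cellE:
  assumes "s \<in> cells a b"
  obtains i j where "s = (Suc i, j)" "a i < j" "j \<le> b i"
proof (cases s)
  case (Pair i j)
  then show ?thesis
    using assms that by (cases i) auto
qed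

lemma cells_rows:
  "{s \<in> cells a b. fst s \<le> r} = (\<lambda>(i, j). (Suc i, j)) ` (SIGMA i:{..<r}. {a i<..b i})"
proof (intro equalityI subsetI)
  fix s assume s: "s \<in> {s \<in> cells a b. fst s \<le> r}"
  then obtain i j where "s = (Suc i, j)" "a i < j" "j \<le> b i"
    by (auto elim: cellE)
  then show "s \<in> (\<lambda>(i, j). (Suc i, j)) ` (SIGMA i:{..<r}. {a i<..b i})"
    using s by (intro image_eqI[of _ _ "(i, j)"]) auto
qed auto

lemma finite_cells_rows: "finite {s \<in> cells a b. fst s \<le> r}"
  unfolding cells_rows by simp

lemma card_cells_rows: "card {s \<in> cells a b. fst s \<le> r} = (\<Sum>i<r. b i - a i)"
proof -
  have "inj_on (\<lambda>(i, j). (Suc i, j)) (SIGMA i:{..<r}. {a i<..b i})"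
    by (auto simp: inj_on_def)
  then show ?thesis
    unfolding cells_rows by (simp add: card_image)
qed

lemma cells_all_rows:
  assumes "\<forall>i\<ge>R. b i = 0"
  shows "{s \<in> cells a b. fst s \<le> R} = cells a b"
proof -
  have "fst s \<le> R" if "s \<in> cells a b" for s
    using that
  proof (rule cellE)
    fix i j assume "s = (Suc i, j)" "a i < j" "j \<le> b i"
    then show "fst s \<le> R"
      using assms by (cases "R \<le> i") auto
  qed
  then show ?thesis
    by blast
qed

lemma finite_cells:
  assumes "\<forall>i\<ge>R. b i = 0"
  shows "finite (cells a b)"
  using finite_cells_rows[of a b R] cells_all_rows[OF assms] by simp

lemma card_cells:
  assumes "a \<le> b" "\<forall>i\<ge>R. b i = 0"
  shows "card (cells a b) + shape_size a = shape_size b"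
proof -
  have za: "\<forall>i\<ge>R. a i = 0"
    using assms by (metis le_fun_def le_zero_eq)
  have "card (cells a b) = (\<Sum>i<R. b i - a i)"
    using card_cells_rows[of a b R] cells_all_rows[OF assms(2)] by simp
  then show ?thesis
    using assms(1) by (simp add: shape_size_eq[OF za] shape_size_eq[OF assms(2)] le_fun_def
        flip: sum.distrib)
qed

text \<open>
  Position in the listing of a horizontal strip from Northeast to Southwest. With deficiency \<open>k\<close>,
  pairing the cell of rank \<open>r\<close> with the one of rank \<open>r + k\<close> gives an optimal Northeast pairing.
\<close>

definition cell_rank :: "shape \<Rightarrow> shape \<Rightarrow> square \<Rightarrow> nat" where
  "cell_rank a b s = (\<Sum>i<fst s - 1. b i - a i) + (b (fst s - 1) - snd s) + 1"

lemma cell_rank_bounds: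
  assumes "s \<in> cells a b"
  shows "(\<Sum>i<fst s - 1. b i - a i) < cell_rank a b s" "cell_rank a b s \<le> (\<Sum>i<fst s. b i - a i)"
  using assms by (auto elim!: cellE simp: cell_rank_def)

lemma cell_rank_less:
  assumes "s \<in> cells a b" "t \<in> cells a b" "fst s < fst t"
  shows "cell_rank a b s < cell_rank a b t"
proof -
  have "cell_rank a b s \<le> (\<Sum>i<fst s. b i - a i)"
    by (rule cell_rank_bounds(2)[OF assms(1)])
  also have "\<dots> \<le> (\<Sum>i<fst t - 1. b i - a i)"
    using assms(3) by (intro sum_mono2) auto
  also have "\<dots> < cell_rank a b t"
    by (rule cell_rank_bounds(1)[OF assms(2)])
  finally show ?thesis .
qed

lemma inj_on_cell_rank: "inj_on (cell_rank a b) (cells a b)"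
proof (rule inj_onI)
  fix s t assume *: "s \<in> cells a b" "t \<in> cells a b" "cell_rank a b s = cell_rank a b t"
  then have "fst s = fst t"
    using cell_rank_less[of s a b t] cell_rank_less[of t a b s] by (metis less_irrefl linorder_neqE_nat)
  moreover obtain i j where s: "s = (Suc i, j)" "a i < j" "j \<le> b i"
    using *(1) by (rule cellE)
  moreover obtain i' j' where t: "t = (Suc i', j')" "a i' < j'" "j' \<le> b i'"
    using *(2) by (rule cellE)
  ultimately show "s = t"
    using *(3) by (auto simp: cell_rank_def)
qed

lemma cell_rank_bij:
  assumes "\<forall>i\<ge>R. b i = 0"
  shows "bij_betw (cell_rank a b) (cells a b) {1..card (cells a b)}"
proof -
  have "cell_rank a b ` cells a b \<subseteq> {1..card (cells a b)}"
  proof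
    fix k assume "k \<in> cell_rank a b ` cells a b"
    then obtain s where s: "s \<in> cells a b" "k = cell_rank a b s"
      by blast
    have "k \<le> card {t \<in> cells a b. fst t \<le> fst s}"
      using cell_rank_bounds(2)[OF s(1)] s(2) by (simp add: card_cells_rows)
    also have "\<dots> \<le> card (cells a b)"
      by (rule card_mono[OF finite_cells[OF assms]]) blast
    finally show "k \<in> {1..card (cells a b)}"
      using s by (simp add: cell_rank_def)
  qed
  moreover have "card (cell_rank a b ` cells a b) = card {1..card (cells a b)}"
    by (simp add: card_image[OF inj_on_cell_rank])
  ultimately have "cell_rank a b ` cells a b = {1..card (cells a b)}"
    by (intro card_subset_eq) simp_all
  then show ?thesis
    by (simp add: bij_betw_def inj_on_cell_rank)
qed

section \<open>Northeast matchings and the Hall-type inequality\<close>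

definition ne_matching :: "square set \<Rightarrow> square set \<Rightarrow> (square \<times> square) set \<Rightarrow> bool" where
  "ne_matching A C P \<longleftrightarrow> (\<forall>(s, t)\<in>P. s \<in> A \<and> t \<in> C \<and> northeast s t) \<and>
     pairwise (\<lambda>p q. disjnt {fst p, snd p} {fst q, snd q}) P"

text \<open>The easy half of Hall's theorem with deficiency: pairs ending in \<open>Y\<close> inject
  into \<open>X\<close>, and the remaining pairs inject into \<open>C - Y\<close>.\<close>

lemma card_ne_matching_le:
  assumes P: "ne_matching A C P" and fin: "finite A" "finite C"
    and Y: "Y \<subseteq> C" "\<And>s t. (s, t) \<in> P \<Longrightarrow> t \<in> Y \<Longrightarrow> s \<in> X" and X: "finite X"
  shows "card P + card Y \<le> card X + card C"
proof -
  have sub: "P \<subseteq> A \<times> C"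
    using P unfolding ne_matching_def by auto
  then have finP: "finite P"
    using fin finite_subset by blast
  have inj: "inj_on fst P" "inj_on snd P"
    using P unfolding ne_matching_def pairwise_def disjnt_def inj_on_def by blast+
  let ?P1 = "{p \<in> P. snd p \<in> Y}" and ?P2 = "{p \<in> P. snd p \<notin> Y}"
  have "card ?P1 \<le> card X"
  proof (rule card_inj_on_le[OF _ _ X])
    show "inj_on fst ?P1"
      using inj(1) by (rule inj_on_subset) blast
    show "fst ` ?P1 \<subseteq> X"
      using Y(2) by force
  qed
  moreover have "card ?P2 \<le> card (C - Y)"
  proof (rule card_inj_on_le)
    show "inj_on snd ?P2"
      using inj(2) by (rule inj_on_subset) blast
    show "snd ` ?P2 \<subseteq> C - Y"
      using sub by auto
  qed (use fin in simp)
  moreover have "card P = card ?P1 + card ?P2"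
  proof -
    have "card (?P1 \<union> ?P2) = card ?P1 + card ?P2"
      by (rule card_Un_disjoint) (use finP in auto)
    moreover have "?P1 \<union> ?P2 = P"
      by blast
    ultimately show ?thesis
      by simp
  qed
  moreover have "card (C - Y) + card Y = card C"
    using card_Diff_subset[OF finite_subset[OF Y(1) fin(2)] Y(1)] card_mono[OF fin(2) Y(1)] by simp
  ultimately show ?thesis
    by linarith
qed

text \<open>Within one row every square of \<open>d/c\<close> lies strictly to the right of every
  square of \<open>b/a\<close>, because \<open>b <= c\<close>. So weakly above becomes strictly
  above.\<close>

lemma ne_matching_row_less:
  assumes "hstrip b c" "s \<in> cells a b" "t \<in> cells c d" "northeast s t"
  shows "fst s < fst t"
proof -
  obtain i j where s: "s = (Suc i, j)" "a i < j" "j \<le> b i"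
    using assms(2) by (rule cellE)
  obtain i' j' where t: "t = (Suc i', j')" "c i' < j'" "j' \<le> d i'"
    using assms(3) by (rule cellE)
  have "i \<noteq> i'"
    using s t assms(4) hstripD(1)[OF assms(1), of i] by (auto simp: northeast_def)
  then show ?thesis
    using s t assms(4) by (simp add: northeast_def)
qed

lemma int_sum_diff:
  assumes "hstrip a b"
  shows "(\<Sum>i\<in>I. int (b i) - int (a i)) = int (\<Sum>i\<in>I. b i - a i)"
  using hstripD(1)[OF assms] by (simp add: of_nat_diff)

lemma ne_matching_imp_excess:
  assumes strips: "hstrip a b" "hstrip b c" "hstrip c d" and R: "\<forall>i\<ge>R. d i = 0"
    and P: "ne_matching (cells a b) (cells c d) P" "x \<le> card P"
  shows "ne_excess_le a b c d (int (card (cells c d)) - int x)"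
  unfolding ne_excess_le_def
proof
  fix r
  have Rb: "\<forall>i\<ge>R. b i = 0"
    using R hstripD(1)[OF strips(2)] hstripD(1)[OF strips(3)] by (metis le_zero_eq)
  note fin = finite_cells[OF Rb, of a] finite_cells[OF R, of c]
  have row: "fst s < fst t" if "(s, t) \<in> P" for s t
    using that P(1) ne_matching_row_less[OF strips(2)] unfolding ne_matching_def by fast
  \<comment> \<open>Squares number rows from 1: rows up to \<open>Suc r\<close> give the sum over
    \<open>i \<le> r\<close>, and their partners lie strictly above, in rows up to
    \<open>r\<close>.\<close>
  have "card P + card {t \<in> cells c d. fst t \<le> Suc r} \<le> card {s \<in> cells a b. fst s \<le> r} + card (cells c d)"
  proof (rule card_ne_matching_le[OF P(1) fin])
    fix s t assume st: "(s, t) \<in> P" "t \<in> {t \<in> cells c d. fst t \<le> Suc r}"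
    then have "s \<in> cells a b"
      using P(1) unfolding ne_matching_def by auto
    then show "s \<in> {s \<in> cells a b. fst s \<le> r}"
      using row[OF st(1)] st(2) by simp
  qed (use finite_cells_rows in auto)
  then have 1: "(\<Sum>i\<le>r. int (d i) - int (c i)) \<le>
      int (card (cells c d)) - int x + (\<Sum>i<r. int (b i) - int (a i))"
    using P(2) unfolding card_cells_rows int_sum_diff[OF strips(1)] int_sum_diff[OF strips(3)]
      lessThan_Suc_atMost by linarith
  \<comment> \<open>The second obstruction, which yields the boundary term: squares of
    \<open>d/c\<close> in row \<open>r + 2\<close> lie right of column \<open>c (Suc r)\<close>, so
    a partner in row \<open>r + 1\<close> must do so too. At most \<open>b r - c (Suc r)\<close>
    squares of \<open>b/a\<close> qualify there.\<close>
  let ?X = "{s \<in> cells a b. fst s \<le> r} \<union> Pair (Suc r) ` {c (Suc r)<..b r}"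
  have "card P + card {t \<in> cells c d. fst t \<le> Suc (Suc r)} \<le> card ?X + card (cells c d)"
  proof (rule card_ne_matching_le[OF P(1) fin])
    fix s t assume st: "(s, t) \<in> P" "t \<in> {t \<in> cells c d. fst t \<le> Suc (Suc r)}"
    then have s: "s \<in> cells a b" and ne: "northeast s t"
      using P(1) unfolding ne_matching_def by auto
    show "s \<in> ?X"
    proof (cases "fst s \<le> r")
      case True
      then show ?thesis
        using s by simp
    next
      case False
      then have rows: "fst s = Suc r" "fst t = Suc (Suc r)"
        using row[OF st(1)] st(2) by auto
      obtain i j where s': "s = (Suc i, j)" "a i < j" "j \<le> b i"
        using s by (rule cellE)
      obtain i' j' where t': "t = (Suc i', j')" "c i' < j'" "j' \<le> d i'"
        using st(2) by (auto elim: cellE)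
      have "c (Suc r) < j" "j \<le> b r"
        using rows s' t' ne by (auto simp: northeast_def)
      then show ?thesis
        using rows s' by simp
    qed
  qed (use finite_cells_rows in auto)
  moreover have "card ?X \<le> card {s \<in> cells a b. fst s \<le> r} + (b r - c (Suc r))"
  proof -
    have "card (Pair (Suc r) ` {c (Suc r)<..b r}) \<le> b r - c (Suc r)"
      using card_image_le[of "{c (Suc r)<..b r}" "Pair (Suc r)"] by simp
    then show ?thesis
      using card_Un_le[of "{s \<in> cells a b. fst s \<le> r}" "Pair (Suc r) ` {c (Suc r)<..b r}"] by linarith
  qed
  ultimately have "x + (\<Sum>i<Suc (Suc r). d i - c i) \<le> (\<Sum>i<r. b i - a i) + (b r - c (Suc r)) + card (cells c d)"
    using P(2) unfolding card_cells_rows by linarith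
  moreover have "b r - c (Suc r) + c (Suc r) = b r" "d (Suc r) - c (Suc r) + c (Suc r) = d (Suc r)"
    using hstripD[OF strips(2)] hstripD[OF strips(3)] by simp_all
  moreover have "(\<Sum>i<Suc (Suc r). d i - c i) = (\<Sum>i\<le>r. d i - c i) + (d (Suc r) - c (Suc r))"
    by (simp add: lessThan_Suc_atMost)
  ultimately have 2: "(\<Sum>i\<le>r. int (d i) - int (c i)) + (int (d (Suc r)) - int (b r)) \<le>
      int (card (cells c d)) - int x + (\<Sum>i<r. int (b i) - int (a i))"
    unfolding int_sum_diff[OF strips(1)] int_sum_diff[OF strips(3)] by linarith
  show "(\<Sum>i\<le>r. int (d i) - int (c i)) + max 0 (int (d (Suc r)) - int (b r)) \<le>
      int (card (cells c d)) - int x + (\<Sum>i<r. int (b i) - int (a i))"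
    using 1 2 unfolding max_def by (simp split: if_split)
qed

text \<open>The inequality without boundary term places \<open>s\<close> in a higher row than
  \<open>t\<close>; the one with boundary term compares their columns.\<close>

lemma excess_imp_northeast:
  assumes strips: "hstrip a b" "hstrip b c" "hstrip c d"
    and excess: "ne_excess_le a b c d (int k)"
    and s: "s \<in> cells a b" and t: "t \<in> cells c d"
    and rank: "cell_rank c d t = cell_rank a b s + k"
  shows "northeast s t"
proof -
  obtain i j where s': "s = (Suc i, j)" "a i < j" "j \<le> b i"
    using s by (rule cellE)
  obtain i' j' where t': "t = (Suc i', j')" "c i' < j'" "j' \<le> d i'"
    using t by (rule cellE)
  have rank_s: "int (cell_rank a b s) = (\<Sum>x<i. int (b x) - int (a x)) + (int (b i) - int j) + 1"
    using s' by (simp add: cell_rank_def int_sum_diff[OF strips(1)] of_nat_diff)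
  have rank_t: "int (cell_rank c d t) = (\<Sum>x<i'. int (d x) - int (c x)) + (int (d i') - int j') + 1"
    using t' by (simp add: cell_rank_def int_sum_diff[OF strips(3)] of_nat_diff)
  have E: "int (cell_rank c d t) = int (cell_rank a b s) + int k"
    using rank by simp
  \<comment> \<open>Otherwise the rank of \<open>t\<close> would be at most \<open>k\<close> plus
    the number of squares of \<open>b/a\<close> in the rows above \<open>s\<close>, which is less
    than \<open>k\<close> plus the rank of \<open>s\<close>.\<close>
  have "i < i'"
  proof (rule ccontr)
    assume "\<not> i < i'"
    then have "(\<Sum>x<i'. int (b x) - int (a x)) \<le> (\<Sum>x<i. int (b x) - int (a x))"
      using hstripD(1)[OF strips(1)] by (intro sum_mono2) auto
    moreover have "(\<Sum>x\<le>i'. int (d x) - int (c x)) \<le> int k + (\<Sum>x<i'. int (b x) - int (a x))"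
      using excess unfolding ne_excess_le_def max_def by (smt (verit))
    moreover have "(\<Sum>x\<le>i'. int (d x) - int (c x)) = (\<Sum>x<i'. int (d x) - int (c x)) + (int (d i') - int (c i'))"
      by (simp flip: lessThan_Suc_atMost)
    ultimately show False
      using rank_s rank_t E s' t' by linarith
  qed
  then obtain r where r: "i' = Suc r" "i \<le> r"
    by (metis less_Suc_eq_le less_imp_Suc_add)
  have "(\<Sum>x\<le>r. int (d x) - int (c x)) + (int (d (Suc r)) - int (b r)) \<le>
      int k + (\<Sum>x<r. int (b x) - int (a x))"
    using excess unfolding ne_excess_le_def max_def by (smt (verit))
  \<comment> \<open>Going from row \<open>m\<close> to row \<open>m + 1\<close> changes this
    expression by \<open>b (m+1) - a m\<close>, which is not positive for a horizontal strip; so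
    \<open>r\<close> may be replaced by the row of \<open>s\<close>.\<close>
  moreover have "(\<Sum>x<r. int (b x) - int (a x)) + int (b r) \<le> (\<Sum>x<i. int (b x) - int (a x)) + int (b i)"
    using r(2)
  proof (induction r rule: dec_induct)
    case (step m)
    then show ?case
      using hstripD(2)[OF strips(1), of m] by simp
  qed simp
  ultimately have "int j' \<le> int j"
    using rank_s rank_t E r by (simp add: lessThan_Suc_atMost)
  then show ?thesis
    using s' t' \<open>i < i'\<close> by (simp add: northeast_def)
qed

lemma excess_imp_ne_matching:
  assumes strips: "hstrip a b" "hstrip b c" "hstrip c d" and R: "\<forall>i\<ge>R. d i = 0"
    and x: "x \<le> card (cells c d)" and excess: "ne_excess_le a b c d (int (card (cells c d) - x))"
  shows "\<exists>P. ne_matching (cells a b) (cells c d) P \<and> x \<le> card P"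
proof -
  define k where "k = card (cells c d) - x"
  define P where "P = {(s, t) \<in> cells a b \<times> cells c d. cell_rank c d t = cell_rank a b s + k}"
  have Rb: "\<forall>i\<ge>R. b i = 0"
    using R hstripD(1)[OF strips(2)] hstripD(1)[OF strips(3)] by (metis le_zero_eq)
  note bij_A = cell_rank_bij[OF Rb, of a] and bij_C = cell_rank_bij[OF R, of c]
  have finP: "finite P"
    unfolding P_def using finite_cells[OF Rb, of a] finite_cells[OF R, of c]
    by (auto intro: finite_subset[of _ "cells a b \<times> cells c d"])
  have "ne_matching (cells a b) (cells c d) P"
    unfolding ne_matching_def
  proof (intro conjI)
    show "\<forall>(s, t)\<in>P. s \<in> cells a b \<and> t \<in> cells c d \<and> northeast s t"
      using excess_imp_northeast[OF strips] excess unfolding P_def k_def by blast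
    \<comment> \<open>Disjointness of pairs also compares the first square of one pair with the
      second square of another, so the two strips themselves must be disjoint.\<close>
    have disj: "cells a b \<inter> cells c d = {}"
    proof -
      have "s \<notin> cells c d" if "s \<in> cells a b" for s
        using that
      proof (rule cellE)
        fix i j assume "s = (Suc i, j)" "a i < j" "j \<le> b i"
        then show "s \<notin> cells c d"
          using hstripD(1)[OF strips(2), of i] by simp
      qed
      then show ?thesis
        by blast
    qed
    show "pairwise (\<lambda>p q. disjnt {fst p, snd p} {fst q, snd q}) P"
    proof (rule pairwiseI)
      fix p q assume pq: "p \<in> P" "q \<in> P" "p \<noteq> q"
      obtain s t s' t' where [simp]: "p = (s, t)" "q = (s', t')"
        by (cases p; cases q)
      have mem: "s \<in> cells a b" "t \<in> cells c d" "s' \<in> cells a b" "t' \<in> cells c d"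
        and rank: "cell_rank c d t = cell_rank a b s + k" "cell_rank c d t' = cell_rank a b s' + k"
        using pq(1,2) by (simp_all add: P_def)
      have "s = s' \<longleftrightarrow> t = t'"
        using inj_on_eq_iff[OF inj_on_cell_rank mem(1,3)] inj_on_eq_iff[OF inj_on_cell_rank mem(2,4)] rank
        by simp
      moreover have "s \<noteq> t'" "t \<noteq> s'"
        using mem disj by blast+
      ultimately show "disjnt {fst p, snd p} {fst q, snd q}"
        using pq(3) by auto
    qed
  qed
  moreover have "x \<le> card P"
  proof -
    \<comment> \<open>At \<open>r = R\<close> both sums exhaust their strips. Hence every rank above
      \<open>k\<close> in \<open>d/c\<close>, lowered by \<open>k\<close>, is attained in
      \<open>b/a\<close>.\<close>
    have "card (cells c d) \<le> k + card (cells a b)"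
    proof -
      have *: "\<forall>i\<ge>Suc R. d i = 0"
        using R by simp
      have "(\<Sum>i\<le>R. int (d i) - int (c i)) \<le> int k + (\<Sum>i<R. int (b i) - int (a i))"
        using excess unfolding ne_excess_le_def k_def[symmetric] max_def by (smt (verit))
      moreover have "card (cells a b) = (\<Sum>i<R. b i - a i)" "card (cells c d) = (\<Sum>i<Suc R. d i - c i)"
        using card_cells_rows[of a b R] cells_all_rows[OF Rb] card_cells_rows[of c d "Suc R"] cells_all_rows[OF *]
        by simp_all
      ultimately show ?thesis
        unfolding int_sum_diff[OF strips(1)] int_sum_diff[OF strips(3)] lessThan_Suc_atMost by linarith
    qed
    have "cell_rank c d ` snd ` P \<supseteq> {Suc k..card (cells c d)}"
    proof
      fix y assume y: "y \<in> {Suc k..card (cells c d)}"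
      then have "y \<in> cell_rank c d ` cells c d"
        using bij_C unfolding bij_betw_def by auto
      then obtain t where t: "t \<in> cells c d" "y = cell_rank c d t"
        by blast
      have "y - k \<in> cell_rank a b ` cells a b"
        using bij_A y \<open>card (cells c d) \<le> k + card (cells a b)\<close> unfolding bij_betw_def by auto
      then obtain s where s: "s \<in> cells a b" "y - k = cell_rank a b s"
        by blast
      have "(s, t) \<in> P"
        using s t y by (auto simp: P_def)
      then show "y \<in> cell_rank c d ` snd ` P"
        using t by force
    qed
    then have "card {Suc k..card (cells c d)} \<le> card (cell_rank c d ` snd ` P)"
      using finP by (intro card_mono) auto
    also have "\<dots> \<le> card P"
      using finP by (meson card_image_le finite_imageI order_trans)
    finally show ?thesis
      using x by (simp add: k_def)
  qed
  ultimately show ?thesis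
    by blast
qed

section \<open>Tableaux as chains of shapes\<close>

definition tableau_chain :: "shape \<Rightarrow> shape \<Rightarrow> (square \<Rightarrow> nat) \<Rightarrow> nat \<Rightarrow> shape" where
  "tableau_chain m d T k i = m i + card {j. (Suc i, j) \<in> cells m d \<and> T (Suc i, j) \<le> k}"

definition chain_tableau :: "shape \<Rightarrow> shape \<Rightarrow> (nat \<Rightarrow> shape) \<Rightarrow> square \<Rightarrow> nat" where
  "chain_tableau m d c s = (if s \<in> cells m d then LEAST k. snd s \<le> c k (fst s - 1) else 0)"

lemma interval_eq_card:
  fixes A :: "nat set"
  assumes "A \<subseteq> {a<..b}" "\<And>x y. x \<in> A \<Longrightarrow> a < y \<Longrightarrow> y < x \<Longrightarrow> y \<in> A"
  shows "A = {a<..a + card A}"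
proof (cases "A = {}")
  case False
  have fin: "finite A"
    using assms(1) finite_subset by blast
  have "A = {a<..Max A}"
  proof
    show "A \<subseteq> {a<..Max A}"
      using assms(1) fin by auto
    show "{a<..Max A} \<subseteq> A"
      using assms(2)[OF Max_in[OF fin False]] Max_in[OF fin False] by (auto simp: le_less)
  qed
  moreover have "a < Max A"
    using Max_in[OF fin False] assms(1) by auto
  ultimately show ?thesis
    by (metis card_greaterThanAtMost le_add_diff_inverse less_imp_le_nat)
qed simp

text \<open>Entries at most \<open>k\<close> form an initial segment of each row. This adjunction
  between entries and shapes drives both directions of the correspondence.\<close>

lemma tableau_chain_iff:
  assumes T: "is_ssyt (cells m d) T" and "m i < j" "j \<le> d i"
  shows "T (Suc i, j) \<le> k \<longleftrightarrow> j \<le> tableau_chain m d T k i"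
proof -
  let ?A = "{j. (Suc i, j) \<in> cells m d \<and> T (Suc i, j) \<le> k}"
  have "?A = {m i<..m i + card ?A}"
  proof (rule interval_eq_card)
    show "?A \<subseteq> {m i<..d i}"
      by auto
    fix x y assume xy: "x \<in> ?A" "m i < y" "y < x"
    then have "T (Suc i, y) \<le> T (Suc i, x)"
      using T unfolding is_ssyt_def by auto
    then show "y \<in> ?A"
      using xy by auto
  qed
  then have "j \<in> ?A \<longleftrightarrow> j \<in> {m i<..m i + card ?A}"
    by (rule arg_cong)
  then show ?thesis
    using assms(2,3) by (simp add: tableau_chain_def)
qed

lemma tableau_chain_mono: "tableau_chain m d T k \<le> tableau_chain m d T (Suc k)"
proof (rule le_funI)
  fix i
  have "finite {j. (Suc i, j) \<in> cells m d \<and> T (Suc i, j) \<le> Suc k}"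
    by (rule finite_subset[of _ "{..d i}"]) auto
  then show "tableau_chain m d T k i \<le> tableau_chain m d T (Suc k) i"
    unfolding tableau_chain_def by (intro add_left_mono card_mono) auto
qed

lemma tableau_chain_bounds:
  assumes "m \<le> d"
  shows "m i \<le> tableau_chain m d T k i" "tableau_chain m d T k i \<le> d i"
proof -
  show "m i \<le> tableau_chain m d T k i"
    by (simp add: tableau_chain_def)
  have "card {j. (Suc i, j) \<in> cells m d \<and> T (Suc i, j) \<le> k} \<le> card {m i<..d i}"
    by (rule card_mono) auto
  then show "tableau_chain m d T k i \<le> d i"
    using le_funD[OF assms, of i] by (simp add: tableau_chain_def)
qed

lemma tableau_chain_in_strip_chains:
  assumes md: "m \<le> d" "antimono m" "antimono d"
    and T: "is_ssyt (cells m d) T" "\<forall>s\<in>cells m d. T s \<le> N"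
  shows "tableau_chain m d T \<in> strip_chains N m d"
proof -
  have "tableau_chain m d T 0 i = m i" for i
  proof -
    have "T (Suc i, j) \<noteq> 0" if "(Suc i, j) \<in> cells m d" for j
      using T(1) that unfolding is_ssyt_def by fastforce
    then have "{j. (Suc i, j) \<in> cells m d \<and> T (Suc i, j) \<le> 0} = {}"
      by auto
    then show ?thesis
      unfolding tableau_chain_def by (simp only: card.empty add_0_right)
  qed
  moreover have "tableau_chain m d T k i = d i" if "k \<ge> N" for k i
  proof (cases "m i < d i")
    case True
    then have "T (Suc i, d i) \<le> k"
      using T(2) that by (meson cells_iff(1) order_refl order_trans)
    then have "d i \<le> tableau_chain m d T k i"
      using tableau_chain_iff[OF T(1) True] by simp
    then show ?thesis
      using tableau_chain_bounds(2)[OF md(1), of T k i] by simp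
  next
    case False
    then show ?thesis
      using tableau_chain_bounds(1)[OF md(1), of i T k] tableau_chain_bounds(2)[OF md(1), of T k i] by simp
  qed
  moreover have "hstrip (tableau_chain m d T k) (tableau_chain m d T (Suc k))" for k
    unfolding hstrip_def
  proof (intro allI conjI)
    fix i
    show "tableau_chain m d T k i \<le> tableau_chain m d T (Suc k) i"
      by (rule le_funD[OF tableau_chain_mono])
    let ?x = "tableau_chain m d T (Suc k) (Suc i)"
    show "?x \<le> tableau_chain m d T k i"
    proof (cases "?x \<le> m i")
      case True
      then show ?thesis
        using tableau_chain_bounds(1)[OF md(1), of i T k] by simp
    next
      case False
      have "m (Suc i) \<le> m i" "d (Suc i) \<le> d i"
        using antimonoD[OF md(2), of i "Suc i"] antimonoD[OF md(3), of i "Suc i"] by simp_all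
      then have x: "m (Suc i) < ?x" "?x \<le> d (Suc i)" "m i < ?x" "?x \<le> d i"
        using False tableau_chain_bounds(2)[OF md(1), of T "Suc k" "Suc i"] by simp_all
      have "T (Suc (Suc i), ?x) \<le> Suc k"
        using tableau_chain_iff[OF T(1) x(1,2)] by simp
      moreover have "T (Suc i, ?x) < T (Suc (Suc i), ?x)"
        using T(1) x unfolding is_ssyt_def by auto
      ultimately show ?thesis
        using tableau_chain_iff[OF T(1) x(3,4), of k] by simp
    qed
  qed
  ultimately show ?thesis
    unfolding strip_chains_def by (simp add: fun_eq_iff)
qed

lemma strip_chains_mono:
  assumes "c \<in> strip_chains N m d" "k \<le> k'"
  shows "c k i \<le> c k' i"
  using assms(2) by (rule lift_Suc_mono_le[of "\<lambda>k. c k i", OF strip_chain_Suc_le[OF assms(1)]])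

lemma chain_tableau_le_iff:
  assumes c: "c \<in> strip_chains N m d" and "m i < j" "j \<le> d i"
  shows "chain_tableau m d c (Suc i, j) \<le> k \<longleftrightarrow> j \<le> c k i"
proof -
  have "j \<le> c N i"
    using c assms(3) by (simp add: strip_chains_def)
  then have "j \<le> c (LEAST k. j \<le> c k i) i"
    by (rule LeastI)
  then have "j \<le> c k i" if "(LEAST k. j \<le> c k i) \<le> k"
    using strip_chains_mono[OF c that, of i] by linarith
  then have "(LEAST k. j \<le> c k i) \<le> k \<longleftrightarrow> j \<le> c k i"
    using Least_le[of "\<lambda>k. j \<le> c k i"] by blast
  then show ?thesis
    using assms(2,3) by (simp add: chain_tableau_def)
qed

lemma chain_tableau_ssyt:
  assumes md: "antimono m" "antimono d" and c: "c \<in> strip_chains N m d"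
  shows "is_ssyt (cells m d) (chain_tableau m d c)" "\<forall>s\<in>cells m d. chain_tableau m d c s \<le> N"
proof -
  have iff: "chain_tableau m d c (Suc i, j) \<le> k \<longleftrightarrow> j \<le> c k i" if "m i < j" "j \<le> d i" for i j k
    by (rule chain_tableau_le_iff[OF c that])
  have pos: "chain_tableau m d c (Suc i, j) \<ge> 1" if "m i < j" "j \<le> d i" for i j
    using iff[OF that, of 0] that c by (simp add: strip_chains_def)
  have row: "chain_tableau m d c (Suc i, j) \<le> chain_tableau m d c (Suc i, j')"
    if "m i < j" "j' \<le> d i" "j < j'" for i j j'
    using iff[of i j "chain_tableau m d c (Suc i, j')"] iff[of i j' "chain_tableau m d c (Suc i, j')"] that
    by simp
  have col: "chain_tableau m d c (Suc i, j) < chain_tableau m d c (Suc i', j)"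
    if ij: "m i < j" "j \<le> d i" "m i' < j" "j \<le> d i'" "i < i'" for i i' j
  proof -
    obtain k where k: "chain_tableau m d c (Suc i', j) = Suc k"
      using pos[OF ij(3,4)] by (cases "chain_tableau m d c (Suc i', j)") auto
    obtain h where h: "i' = Suc h" "i \<le> h"
      using ij(5) by (metis less_Suc_eq_le less_imp_Suc_add)
    have "j \<le> c (Suc k) i'"
      using iff[OF ij(3,4), of "Suc k"] k by simp
    also have "\<dots> \<le> c k h"
      unfolding h by (rule strip_chain_shift_le[OF c md(2)])
    also have "\<dots> \<le> c k i"
    proof -
      have "antimono (c k)"
      proof (cases "k < N")
        case True
        then show ?thesis
          using c hstrip_antimono(1) unfolding strip_chains_def by blast
      next
        case False
        then show ?thesis
          using c md(2) by (simp add: strip_chains_def)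
      qed
      then show ?thesis
        using h(2) by (rule antimonoD)
    qed
    finally show ?thesis
      using iff[OF ij(1,2), of k] k by simp
  qed
  show "is_ssyt (cells m d) (chain_tableau m d c)"
    unfolding is_ssyt_def
  proof (intro conjI allI ballI impI)
    fix s assume "s \<in> cells m d"
    then show "1 \<le> chain_tableau m d c s"
      using pos by (auto elim: cellE)
  next
    fix s assume "s \<notin> cells m d"
    then show "chain_tableau m d c s = 0"
      by (simp add: chain_tableau_def)
  next
    fix i j j' assume "(i, j) \<in> cells m d" "(i, j') \<in> cells m d" "j < j'"
    then show "chain_tableau m d c (i, j) \<le> chain_tableau m d c (i, j')"
      using row by (cases i) auto
  next
    fix i i' j assume "(i, j) \<in> cells m d" "(i', j) \<in> cells m d" "i < i'"
    then show "chain_tableau m d c (i, j) < chain_tableau m d c (i', j)"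
      using col by (cases i; cases i') auto
  qed
  show "\<forall>s\<in>cells m d. chain_tableau m d c s \<le> N"
  proof
    fix s assume "s \<in> cells m d"
    then obtain i j where "s = (Suc i, j)" "m i < j" "j \<le> d i"
      by (rule cellE)
    then show "chain_tableau m d c s \<le> N"
      using iff[of i j N] c by (simp add: strip_chains_def)
  qed
qed

lemma chain_tableau_inverse:
  assumes md: "m \<le> d" "antimono m" "antimono d"
    and T: "is_ssyt (cells m d) T" "\<forall>s\<in>cells m d. T s \<le> N"
  shows "chain_tableau m d (tableau_chain m d T) = T"
proof
  fix s
  show "chain_tableau m d (tableau_chain m d T) s = T s"
  proof (cases "s \<in> cells m d")
    case True
    then obtain i j where s: "s = (Suc i, j)" "m i < j" "j \<le> d i"
      by (rule cellE)
    have "chain_tableau m d (tableau_chain m d T) s \<le> k \<longleftrightarrow> T s \<le> k" for k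
      unfolding s(1) chain_tableau_le_iff[OF tableau_chain_in_strip_chains[OF md T] s(2,3)]
        tableau_chain_iff[OF T(1) s(2,3)] ..
    then show ?thesis
      by (meson order_antisym order_refl)
  next
    case False
    moreover have "T s = 0"
      using T(1) False unfolding is_ssyt_def by blast
    ultimately show ?thesis
      by (simp add: chain_tableau_def)
  qed
qed

lemma tableau_chain_inverse:
  assumes c: "c \<in> strip_chains N m d"
  shows "tableau_chain m d (chain_tableau m d c) = c"
proof (intro ext)
  fix k i
  have bounds: "m i \<le> c k i" "c k i \<le> d i"
    using strip_chains_mono[OF c, of 0 k i] strip_chains_le[OF c, of k] c
    by (simp_all add: strip_chains_def le_fun_def)
  have "{j. (Suc i, j) \<in> cells m d \<and> chain_tableau m d c (Suc i, j) \<le> k} = {m i<..c k i}"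
    using chain_tableau_le_iff[OF c] bounds by auto
  then show "tableau_chain m d (chain_tableau m d c) k i = c k i"
    using bounds by (simp add: tableau_chain_def del: cells_iff)
qed

theorem tableau_chain_bij:
  assumes "m \<le> d" "antimono m" "antimono d"
  shows "bij_betw (tableau_chain m d)
    {T. is_ssyt (cells m d) T \<and> (\<forall>s\<in>cells m d. T s \<le> N)} (strip_chains N m d)"
proof (rule bij_betw_byWitness[where f' = "chain_tableau m d"])
  show "tableau_chain m d ` {T. is_ssyt (cells m d) T \<and> (\<forall>s\<in>cells m d. T s \<le> N)} \<subseteq> strip_chains N m d"
    using tableau_chain_in_strip_chains[OF assms] by blast
  show "chain_tableau m d ` strip_chains N m d \<subseteq> {T. is_ssyt (cells m d) T \<and> (\<forall>s\<in>cells m d. T s \<le> N)}"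
    using chain_tableau_ssyt[OF assms(2,3)] by blast
  show "\<forall>T\<in>{T. is_ssyt (cells m d) T \<and> (\<forall>s\<in>cells m d. T s \<le> N)}.
      chain_tableau m d (tableau_chain m d T) = T"
    using chain_tableau_inverse[OF assms] by blast
  show "\<forall>c\<in>strip_chains N m d. tableau_chain m d (chain_tableau m d c) = c"
    using tableau_chain_inverse by blast
qed

lemma cells_with_entry:
  assumes "m \<le> d" "is_ssyt (cells m d) T"
  shows "{s \<in> cells m d. T s = Suc k} = cells (tableau_chain m d T k) (tableau_chain m d T (Suc k))"
proof -
  have "T (Suc i, j) = Suc k \<longleftrightarrow> tableau_chain m d T k i < j \<and> j \<le> tableau_chain m d T (Suc k) i"
    if "m i < j" "j \<le> d i" for i j
    using tableau_chain_iff[OF assms(2) that, of k] tableau_chain_iff[OF assms(2) that, of "Suc k"] by linarith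
  moreover have "m i < j \<and> j \<le> d i"
    if "tableau_chain m d T k i < j" "j \<le> tableau_chain m d T (Suc k) i" for i j
    using that tableau_chain_bounds(1)[OF assms(1), of i T k] tableau_chain_bounds(2)[OF assms(1), of T "Suc k" i]
    by linarith
  ultimately show ?thesis
    by (auto elim!: cellE)
qed

section \<open>Skew Schur functions and their products\<close>

definition shape_of :: "nat list \<Rightarrow> shape" where
  "shape_of la i = part la (Suc i)"

lemma shape_of_Nil: "shape_of [] = (\<lambda>_. 0)"
  by (simp add: shape_of_def part_def fun_eq_iff)

lemma shape_of_nth: "i < length la \<Longrightarrow> shape_of la i = la ! i"
  by (simp add: shape_of_def part_def)

lemma shape_of_vanish: "length la \<le> i \<Longrightarrow> shape_of la i = 0"
  by (simp add: shape_of_def part_def)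

lemma shape_of_antimono:
  assumes "is_partition la"
  shows "antimono (shape_of la)"
proof (rule antimonoI)
  fix i j :: nat assume "i \<le> j"
  show "shape_of la j \<le> shape_of la i"
  proof (cases "j < length la")
    case True
    then have "i = j \<or> la ! j \<le> la ! i"
      using assms \<open>i \<le> j\<close> unfolding is_partition_def sorted_wrt_iff_nth_less
      by (auto simp: le_less)
    then show ?thesis
      using True \<open>i \<le> j\<close> by (auto simp: shape_of_nth)
  qed (simp add: shape_of_vanish)
qed

lemma shape_of_nonzero_iff:
  assumes "is_partition la"
  shows "shape_of la i \<noteq> 0 \<longleftrightarrow> i < length la"
  using assms shape_of_nth[of i la] shape_of_vanish[of la i] nth_mem[of i la]
  unfolding is_partition_def by (metis neq0_conv not_less)

lemma shape_of_inject:
  assumes "is_partition la" "is_partition mu" "shape_of la = shape_of mu"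
  shows "la = mu"
proof (rule nth_equalityI)
  have "i < length la \<longleftrightarrow> i < length mu" for i
    using shape_of_nonzero_iff[OF assms(1), of i] shape_of_nonzero_iff[OF assms(2), of i] assms(3) by simp
  then show len: "length la = length mu"
    by (metis linorder_neqE_nat less_irrefl)
  show "la ! i = mu ! i" if "i < length la" for i
    using that len assms(3) shape_of_nth[of i la] shape_of_nth[of i mu] by simp
qed

lemma shape_of_surj:
  fixes b :: shape
  assumes "antimono b" "\<forall>i\<ge>R. b i = 0"
  obtains la where "is_partition la" "shape_of la = b"
proof
  define n where "n = (LEAST n. b n = 0)"
  have "b n = 0"
    unfolding n_def by (rule LeastI[of _ R]) (use assms(2) in simp)
  have pos: "b i > 0" if "i < n" for i
    using that not_less_Least unfolding n_def by blast
  have zero: "b i = 0" if "i \<ge> n" for i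
    using antimonoD[OF assms(1) that] \<open>b n = 0\<close> by simp
  show "is_partition (map b [0..<n])"
    unfolding is_partition_def sorted_wrt_iff_nth_less
    using pos antimonoD[OF assms(1)] by auto
  show "shape_of (map b [0..<n]) = b"
  proof
    fix i
    show "shape_of (map b [0..<n]) i = b i"
      using zero by (cases "i < n") (simp_all add: shape_of_nth shape_of_vanish)
  qed
qed

lemma skew_diagram_eq_cells: "skew_diagram la mu = cells (shape_of mu) (shape_of la)"
proof -
  have "1 \<le> i \<Longrightarrow> part mu i = shape_of mu (i - 1) \<and> part la i = shape_of la (i - 1)" for i
    by (simp add: shape_of_def)
  then show ?thesis
    unfolding skew_diagram_def cells_def by auto
qed

lemma is_skew_shapeD:
  assumes "is_skew_shape la mu"
  shows "shape_of mu \<le> shape_of la" "antimono (shape_of mu)" "antimono (shape_of la)"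
  using assms shape_of_antimono by (auto simp: is_skew_shape_def le_fun_def shape_of_def)

lemma is_skew_shape_Nil: "is_partition ka \<Longrightarrow> is_skew_shape ka []"
  by (auto simp: is_skew_shape_def is_partition_def part_def)

section \<open>Coefficients of skew Schur functions as numbers of chains\<close>

definition content_chains :: "nat \<Rightarrow> shape \<Rightarrow> shape \<Rightarrow> (nat \<Rightarrow> nat) \<Rightarrow> (nat \<Rightarrow> shape) set" where
  "content_chains N m d q =
     {c \<in> strip_chains N m d. \<forall>k<N. shape_size (c (Suc k)) = shape_size (c k) + q k}"

text \<open>Bounding the excess by the multiplicity itself imposes nothing, so the growth diagram
  results for \<open>chains\<close> also cover tableaux constrained by content only.\<close>

lemma content_chains_eq_chains:
  assumes "\<forall>i\<ge>R. d i = 0"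
  shows "content_chains N m d q = chains m d N q (\<lambda>i. int (q (Suc i)))"
proof -
  have "segment_cond c 0 N q (\<lambda>i. int (q (Suc i)))"
    if c: "c \<in> strip_chains N m d" and size: "\<forall>k<N. shape_size (c (Suc k)) = shape_size (c k) + q k" for c
    unfolding segment_cond_def
  proof (intro conjI allI impI)
    fix i assume "Suc (Suc i) \<le> N"
    then show "excess_le (c (0 + i)) (c (0 + Suc i)) (c (0 + Suc (Suc i))) (int (q (Suc i)))"
      using c size strip_chains_vanish[OF c assms]
      by (auto intro!: excess_le_size simp: strip_chains_def)
  qed (use size in simp)
  then show ?thesis
    unfolding content_chains_def chains_def segment_cond_def by auto
qed

lemma finite_content_chains:
  assumes "\<forall>i\<ge>R. d i = 0"
  shows "finite (content_chains N m d q)"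
  using finite_strip_chains[OF assms] unfolding content_chains_def by simp

lemma card_bij_betw_restrict:
  assumes "bij_betw f A B" "\<And>x. x \<in> A \<Longrightarrow> P x \<longleftrightarrow> Q (f x)"
  shows "card {x \<in> A. P x} = card {y \<in> B. Q y}"
proof -
  have "bij_betw f {x \<in> A. P x} {y \<in> B. Q y}"
    using assms unfolding bij_betw_def inj_on_def by auto
  then show ?thesis
    by (rule bij_betw_same_card)
qed

lemma card_entry:
  assumes "m \<le> d" "\<forall>i\<ge>R. d i = 0" "is_ssyt (cells m d) T"
  shows "card {s \<in> cells m d. T s = Suc k} + shape_size (tableau_chain m d T k) =
    shape_size (tableau_chain m d T (Suc k))"
proof -
  have "\<forall>i\<ge>R. tableau_chain m d T (Suc k) i = 0"
    using tableau_chain_bounds(2)[OF assms(1), of T "Suc k"] assms(2) by (metis le_zero_eq)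
  then show ?thesis
    unfolding cells_with_entry[OF assms(1,3)] by (rule card_cells[OF tableau_chain_mono])
qed

definition tableaux :: "nat \<Rightarrow> shape \<Rightarrow> shape \<Rightarrow> (square \<Rightarrow> nat) set" where
  "tableaux N m d = {T. is_ssyt (cells m d) T \<and> (\<forall>s\<in>cells m d. T s \<le> N)}"

definition tableau_content :: "shape \<Rightarrow> shape \<Rightarrow> (square \<Rightarrow> nat) \<Rightarrow> nat multiset" where
  "tableau_content m d T = image_mset T (mset_set (cells m d))"

lemma count_tableau_content:
  assumes "\<forall>i\<ge>R. d i = 0"
  shows "count (tableau_content m d T) r = card {s \<in> cells m d. T s = r}"
proof -
  have "T -` {r} \<inter> cells m d = {s \<in> cells m d. T s = r}"
    by auto
  then show ?thesis
    using finite_cells[OF assms, of m] by (simp add: tableau_content_def count_image_mset)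
qed

lemma count_tableau_content_Suc:
  assumes "m \<le> d" "\<forall>i\<ge>R. d i = 0" "is_ssyt (cells m d) T"
  shows "count (tableau_content m d T) (Suc k) + shape_size (tableau_chain m d T k) =
    shape_size (tableau_chain m d T (Suc k))"
  using card_entry[OF assms] by (simp add: count_tableau_content[OF assms(2)])

lemma tableau_content_zero:
  assumes "\<forall>i\<ge>R. d i = 0" "is_ssyt (cells m d) T"
  shows "0 \<notin># tableau_content m d T"
proof -
  have "T s \<noteq> 0" if "s \<in> cells m d" for s
    using assms(2) that unfolding is_ssyt_def by fastforce
  then have "0 \<notin> T ` cells m d"
    by (metis imageE)
  then show ?thesis
    using finite_cells[OF assms(1), of m] by (simp add: tableau_content_def)
qed

lemma tableau_content_le:
  assumes "\<forall>i\<ge>R. d i = 0" "is_ssyt (cells m d) T"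
  shows "T \<in> tableaux N m d \<longleftrightarrow> set_mset (tableau_content m d T) \<subseteq> {..N}"
  using finite_cells[OF assms(1), of m] assms(2) by (auto simp: tableaux_def tableau_content_def)

lemma mset_eq_iff_counts:
  fixes A B :: "nat multiset"
  assumes "0 \<notin># A" "set_mset A \<subseteq> {..N}" "0 \<notin># B" "set_mset B \<subseteq> {..N}"
  shows "A = B \<longleftrightarrow> (\<forall>k<N. count A (Suc k) = count B (Suc k))"
proof
  assume *: "\<forall>k<N. count A (Suc k) = count B (Suc k)"
  show "A = B"
  proof (rule multiset_eqI)
    fix r
    consider "r = 0" | k where "r = Suc k" "k < N" | "r > N"
      by (metis Suc_le_eq not0_implies_Suc not_le)
    then show "count A r = count B r"
    proof cases
      case 1
      then show ?thesis
        using assms(1,3) by (simp add: not_in_iff)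
    next
      case 2
      then show ?thesis
        using * by simp
    next
      case 3
      then have "r \<notin># A" "r \<notin># B"
        using assms(2,4) by auto
      then show ?thesis
        by (simp add: not_in_iff)
    qed
  qed
qed simp

text \<open>Monomials are arbitrary multisets of naturals, but the variables start at index 1;
  multisets containing 0 are a separate degenerate case.\<close>

lemma skew_schur_zero:
  assumes "is_skew_shape la mu" "0 \<in># M"
  shows "skew_schur la mu M = 0"
proof -
  have "\<forall>i\<ge>length la. shape_of la i = 0"
    by (simp add: shape_of_vanish)
  then have "{T. is_ssyt (skew_diagram la mu) T \<and> image_mset T (mset_set (skew_diagram la mu)) = M} = {}"
    using tableau_content_zero[of "length la" "shape_of la" "shape_of mu"] assms(2)
    unfolding skew_diagram_eq_cells tableau_content_def by blast
  then show ?thesis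
    unfolding skew_schur_def by (simp only: card.empty of_nat_0)
qed

lemma skew_schur_eq_tableaux:
  assumes "is_skew_shape la mu" "set_mset M \<subseteq> {..N}"
  shows "skew_schur la mu M = int (card {T \<in> tableaux N (shape_of mu) (shape_of la).
    tableau_content (shape_of mu) (shape_of la) T = M})"
proof -
  have R: "\<forall>i\<ge>length la. shape_of la i = 0"
    by (simp add: shape_of_vanish)
  have "{T. is_ssyt (cells (shape_of mu) (shape_of la)) T \<and> tableau_content (shape_of mu) (shape_of la) T = M} =
      {T \<in> tableaux N (shape_of mu) (shape_of la). tableau_content (shape_of mu) (shape_of la) T = M}"
    using tableau_content_le[OF R, of "shape_of mu" _ N] assms(2) by (auto simp: tableaux_def)
  then show ?thesis
    unfolding skew_schur_def skew_diagram_eq_cells tableau_content_def by simp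
qed

lemma skew_schur_eq_chains:
  assumes sk: "is_skew_shape la mu" and M: "0 \<notin># M" "set_mset M \<subseteq> {..N}"
  shows "skew_schur la mu M =
    int (card (content_chains N (shape_of mu) (shape_of la) (\<lambda>k. count M (Suc k))))"
proof -
  let ?m = "shape_of mu" and ?d = "shape_of la"
  note md = is_skew_shapeD[OF sk]
  have R: "\<forall>i\<ge>length la. ?d i = 0"
    by (simp add: shape_of_vanish)
  have "card {T \<in> tableaux N ?m ?d. tableau_content ?m ?d T = M} =
      card (content_chains N ?m ?d (\<lambda>k. count M (Suc k)))"
    unfolding content_chains_def
  proof (rule card_bij_betw_restrict)
    show "bij_betw (tableau_chain ?m ?d) (tableaux N ?m ?d) (strip_chains N ?m ?d)"
      unfolding tableaux_def by (rule tableau_chain_bij[OF md])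
    fix T assume T: "T \<in> tableaux N ?m ?d"
    then have ssyt: "is_ssyt (cells ?m ?d) T"
      by (simp add: tableaux_def)
    have "tableau_content ?m ?d T = M \<longleftrightarrow>
        (\<forall>k<N. count (tableau_content ?m ?d T) (Suc k) = count M (Suc k))"
      using mset_eq_iff_counts[OF tableau_content_zero[OF R ssyt] _ M] tableau_content_le[OF R ssyt] T
      by blast
    moreover have "count (tableau_content ?m ?d T) (Suc k) = count M (Suc k) \<longleftrightarrow>
        shape_size (tableau_chain ?m ?d T (Suc k)) =
        shape_size (tableau_chain ?m ?d T k) + count M (Suc k)" for k
      using count_tableau_content_Suc[OF md(1) R ssyt, of k] by linarith
    ultimately show "tableau_content ?m ?d T = M \<longleftrightarrow> (\<forall>k<N. shape_size (tableau_chain ?m ?d T (Suc k)) =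
        shape_size (tableau_chain ?m ?d T k) + count M (Suc k))"
      by simp
  qed
  then show ?thesis
    unfolding skew_schur_eq_tableaux[OF sk M(2)] by (rule arg_cong)
qed

lemma finite_mset_sums: "finite {(A, B). A + B = (M :: 'a multiset)}"
proof -
  have "finite (mset ` {xs. set xs \<subseteq> set_mset M \<and> length xs \<le> size M})"
    by (intro finite_imageI finite_lists_length_le) simp
  moreover have "{(A, B). A + B = M} \<subseteq>
      (\<lambda>A. (A, M - A)) ` mset ` {xs. set xs \<subseteq> set_mset M \<and> length xs \<le> size M}"
  proof
    fix p assume "p \<in> {(A, B). A + B = M}"
    then obtain A B where p: "p = (A, B)" "A + B = M"
      by blast
    obtain xs where xs: "mset xs = A"
      using ex_mset by blast
    have "set xs \<subseteq> set_mset M" "length xs \<le> size M"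
      unfolding p(2)[symmetric] xs[symmetric] by auto
    moreover have "p = (A, M - A)"
      unfolding p(1) p(2)[symmetric] by simp
    ultimately show "p \<in> (\<lambda>A. (A, M - A)) ` mset ` {xs. set xs \<subseteq> set_mset M \<and> length xs \<le> size M}"
      using xs by blast
  qed
  ultimately show ?thesis
    by (meson finite_imageI finite_subset)
qed

text \<open>The two shapes interact only in the strip condition between rows \<open>n - 1\<close>
  and \<open>n\<close>, and the shift by \<open>Q\<close> makes it automatic. A chain of joined
  shapes is thus a pair of chains run in parallel.\<close>

lemma card_join_content_chains:
  fixes l m l' m' :: shape and n :: nat
  assumes le: "m \<le> l" "m' \<le> l'" and Q: "l' 0 \<le> Q"
    and vanish: "\<forall>i\<ge>n. l i = 0" "\<forall>i\<ge>n. l' i = 0"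
  shows "card {p \<in> strip_chains N m l \<times> strip_chains N m' l'. \<forall>k<N.
      shape_size (fst p (Suc k)) + shape_size (snd p (Suc k)) = shape_size (fst p k) + shape_size (snd p k) + q k} =
    card (content_chains N (join_shapes n Q m m') (join_shapes n Q l l') q)"
proof -
  let ?J = "\<lambda>(c, c') k. join_shapes n Q (c k) (c' k)"
  let ?S = "\<lambda>C. (\<lambda>k i. if i < n then C k i - Q else 0, \<lambda>k i. C k (n + i))"
  let ?d = "join_shapes n Q l l'" and ?m = "join_shapes n Q m m'"
  have m_vanish: "\<forall>i\<ge>n. m i = 0"
    using le(1) vanish(1) by (metis le_fun_def le_zero_eq)
  have bij: "bij_betw ?J (strip_chains N m l \<times> strip_chains N m' l') (strip_chains N ?m ?d)"
  proof (rule bij_betw_byWitness[where f' = ?S])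
    show "\<forall>p\<in>strip_chains N m l \<times> strip_chains N m' l'. ?S (?J p) = p"
    proof
      fix p assume "p \<in> strip_chains N m l \<times> strip_chains N m' l'"
      then obtain c c' where p: "p = (c, c')" "c \<in> strip_chains N m l"
        by blast
      show "?S (?J p) = p"
        using strip_chains_vanish[OF p(2) vanish(1)]
        by (auto simp: p(1) join_shapes_def fun_eq_iff)
    qed
    show "\<forall>C\<in>strip_chains N ?m ?d. ?J (?S C) = C"
    proof (intro ballI ext)
      fix C k i assume C: "C \<in> strip_chains N ?m ?d"
      \<comment> \<open>In the first \<open>n\<close> rows the inner shape already has
        \<open>Q\<close> squares, so subtracting \<open>Q\<close> does not truncate.\<close>
      have "?m i \<le> C k i"
        using strip_chains_mono[OF C, of 0 k i] C by (simp add: strip_chains_def)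
      then show "?J (?S C) k i = C k i"
        by (auto simp: join_shapes_def)
    qed
    show "?J ` (strip_chains N m l \<times> strip_chains N m' l') \<subseteq> strip_chains N ?m ?d"
    proof
      fix C assume "C \<in> ?J ` (strip_chains N m l \<times> strip_chains N m' l')"
      then obtain c c' where c: "c \<in> strip_chains N m l" "c' \<in> strip_chains N m' l'"
        and C: "C = (\<lambda>k. join_shapes n Q (c k) (c' k))"
        by auto
      have "hstrip (C k) (C (Suc k))" if "k < N" for k
        unfolding hstrip_def
      proof (intro allI conjI)
        fix i
        have strips: "hstrip (c k) (c (Suc k))" "hstrip (c' k) (c' (Suc k))"
          using c that by (simp_all add: strip_chains_def)
        show "C k i \<le> C (Suc k) i"
          using strips[THEN hstripD(1)] by (simp add: C join_shapes_def)
        \<comment> \<open>Needed at the seam only, where row \<open>n\<close> lies below a row with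
          at least \<open>Q\<close> squares.\<close>
        have "c' (Suc k) 0 \<le> Q"
          using le_funD[OF strip_chains_le[OF c(2), of "Suc k"], of 0] Q by simp
        then show "C (Suc k) (Suc i) \<le> C k i"
          using strips[THEN hstripD(2)] by (auto simp: C join_shapes_def Suc_diff_le not_less le_Suc_eq)
      qed
      then show "C \<in> strip_chains N ?m ?d"
        using c unfolding C by (simp add: strip_chains_def)
    qed
    show "?S ` strip_chains N ?m ?d \<subseteq> strip_chains N m l \<times> strip_chains N m' l'"
    proof
      fix p assume "p \<in> ?S ` strip_chains N ?m ?d"
      then obtain C where C: "C \<in> strip_chains N ?m ?d" and p: "p = ?S C"
        by blast
      have strips: "hstrip (C k) (C (Suc k))" if "k < N" for k
        using C that by (simp add: strip_chains_def)
      have ends: "C 0 = ?m" "\<And>k. k \<ge> N \<Longrightarrow> C k = ?d"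
        using C by (simp_all add: strip_chains_def)
      have "hstrip (\<lambda>i. if i < n then C k i - Q else 0) (\<lambda>i. if i < n then C (Suc k) i - Q else 0)"
        "hstrip (\<lambda>i. C k (n + i)) (\<lambda>i. C (Suc k) (n + i))" if "k < N" for k
        using hstripD[OF strips[OF that]] unfolding hstrip_def by (auto intro: diff_le_mono)
      then show "p \<in> strip_chains N m l \<times> strip_chains N m' l'"
        using vanish m_vanish by (auto simp: p strip_chains_def ends join_shapes_def fun_eq_iff)
    qed
  qed
  have iff: "(\<forall>k<N. shape_size (fst p (Suc k)) + shape_size (snd p (Suc k)) =
        shape_size (fst p k) + shape_size (snd p k) + q k) \<longleftrightarrow>
      (\<forall>k<N. shape_size (?J p (Suc k)) = shape_size (?J p k) + q k)"
    if p_in: "p \<in> strip_chains N m l \<times> strip_chains N m' l'" for p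
  proof -
    obtain c c' where p: "p = (c, c')" "c \<in> strip_chains N m l" "c' \<in> strip_chains N m' l'"
      using p_in by blast
    \<comment> \<open>The shift adds the constant \<open>n * Q\<close>, which cancels in consecutive
      size differences.\<close>
    have "shape_size (join_shapes n Q (c k) (c' k)) = n * Q + shape_size (c k) + shape_size (c' k)" for k
    proof -
      have z: "\<forall>i\<ge>n. c k i = 0" "\<forall>i\<ge>n. c' k i = 0"
        by (rule strip_chains_vanish[OF p(2) vanish(1)], rule strip_chains_vanish[OF p(3) vanish(2)])
      then have "\<forall>i\<ge>n + n. join_shapes n Q (c k) (c' k) i = 0"
        by (simp add: join_shapes_def)
      then have "shape_size (join_shapes n Q (c k) (c' k)) = (\<Sum>i<n + n. join_shapes n Q (c k) (c' k) i)"
        by (rule shape_size_eq)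
      also have "\<dots> = (\<Sum>i<n. Q + c k i) + (\<Sum>i<n. c' k i)"
        unfolding lessThan_atLeast0 sum.atLeastLessThan_concat[of 0 n "n + n", symmetric, simplified]
        using sum.shift_bounds_nat_ivl[of "join_shapes n Q (c k) (c' k)" 0 n n]
        by (simp add: join_shapes_def)
      also have "\<dots> = n * Q + shape_size (c k) + shape_size (c' k)"
        by (simp add: sum.distrib shape_size_eq[OF z(1)] shape_size_eq[OF z(2)])
      finally show ?thesis .
    qed
    then show ?thesis
      by (simp add: p(1) add.assoc)
  qed
  show ?thesis
    unfolding content_chains_def by (rule card_bij_betw_restrict[OF bij]) (rule iff)
qed

lemma finite_tableaux:
  assumes "m \<le> d" "antimono m" "antimono d" "\<forall>i\<ge>R. d i = 0"
  shows "finite (tableaux N m d)"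
  using bij_betw_finite[OF tableau_chain_bij[OF assms(1-3), of N]] finite_strip_chains[OF assms(4)]
  unfolding tableaux_def by blast

lemma ps_mult_skew_schur_zero:
  assumes "is_skew_shape la mu" "is_skew_shape nu rho" "0 \<in># M"
  shows "ps_mult (skew_schur la mu) (skew_schur nu rho) M = 0"
  unfolding ps_mult_def
proof (rule sum.neutral, rule ballI)
  fix p assume "p \<in> {(A, B). A + B = M}"
  then obtain A B where p: "p = (A, B)" "A + B = M"
    by blast
  then have "0 \<in># A \<or> 0 \<in># B"
    using assms(3) by auto
  then show "(case p of (A, B) \<Rightarrow> skew_schur la mu A * skew_schur nu rho B) = 0"
    using skew_schur_zero[OF assms(1)] skew_schur_zero[OF assms(2)] p(1) by auto
qed

text \<open>Summing over all splittings of \<open>M\<close> forgets how the content is distributed: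
  what remains are pairs of tableaux whose joint content is \<open>M\<close>.\<close>

lemma ps_mult_skew_schur:
  assumes sk: "is_skew_shape la mu" "is_skew_shape nu rho"
    and M: "0 \<notin># M" "set_mset M \<subseteq> {..N}"
  shows "ps_mult (skew_schur la mu) (skew_schur nu rho) M =
    int (card {p \<in> strip_chains N (shape_of mu) (shape_of la) \<times> strip_chains N (shape_of rho) (shape_of nu).
      \<forall>k<N. shape_size (fst p (Suc k)) + shape_size (snd p (Suc k)) =
        shape_size (fst p k) + shape_size (snd p k) + count M (Suc k)})"
proof -
  let ?m = "shape_of mu" and ?l = "shape_of la" and ?m' = "shape_of rho" and ?l' = "shape_of nu"
  let ?X = "\<lambda>A. {T \<in> tableaux N ?m ?l. tableau_content ?m ?l T = A}"
  let ?Y = "\<lambda>B. {T \<in> tableaux N ?m' ?l'. tableau_content ?m' ?l' T = B}"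
  note ml = is_skew_shapeD[OF sk(1)] and ml' = is_skew_shapeD[OF sk(2)]
  have R: "\<forall>i\<ge>length la. ?l i = 0" "\<forall>i\<ge>length nu. ?l' i = 0"
    by (simp_all add: shape_of_vanish)
  note fin = finite_tableaux[OF ml R(1), of N] finite_tableaux[OF ml' R(2), of N]
  have "ps_mult (skew_schur la mu) (skew_schur nu rho) M =
      (\<Sum>p\<in>{(A, B). A + B = M}. int (card (?X (fst p) \<times> ?Y (snd p))))"
    unfolding ps_mult_def
  proof (rule sum.cong[OF refl])
    fix p assume "p \<in> {(A, B). A + B = M}"
    then obtain A B where p: "p = (A, B)" "A + B = M"
      by blast
    then have "set_mset A \<subseteq> {..N}" "set_mset B \<subseteq> {..N}"
      using M(2) by auto
    then show "(case p of (A, B) \<Rightarrow> skew_schur la mu A * skew_schur nu rho B) =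
        int (card (?X (fst p) \<times> ?Y (snd p)))"
      using skew_schur_eq_tableaux[OF sk(1)] skew_schur_eq_tableaux[OF sk(2)] p(1)
      by (simp add: card_cartesian_product)
  qed
  also have "\<dots> = int (card (\<Union>p\<in>{(A, B). A + B = M}. ?X (fst p) \<times> ?Y (snd p)))"
    unfolding of_nat_sum[symmetric]
  proof (intro arg_cong[where f = int] card_UN_disjoint[symmetric])
    show "\<forall>p\<in>{(A, B). A + B = M}. finite (?X (fst p) \<times> ?Y (snd p))"
      using fin by simp
    show "finite {(A, B). A + B = M}"
      by (rule finite_mset_sums)
    show "\<forall>p\<in>{(A, B). A + B = M}. \<forall>q\<in>{(A, B). A + B = M}. p \<noteq> q \<longrightarrow>
        (?X (fst p) \<times> ?Y (snd p)) \<inter> (?X (fst q) \<times> ?Y (snd q)) = {}"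
      by auto
  qed
  also have "(\<Union>p\<in>{(A, B). A + B = M}. ?X (fst p) \<times> ?Y (snd p)) =
      {p \<in> tableaux N ?m ?l \<times> tableaux N ?m' ?l'.
        tableau_content ?m ?l (fst p) + tableau_content ?m' ?l' (snd p) = M}"
    by auto
  also have "card \<dots> = card {p \<in> strip_chains N ?m ?l \<times> strip_chains N ?m' ?l'.
      \<forall>k<N. shape_size (fst p (Suc k)) + shape_size (snd p (Suc k)) =
        shape_size (fst p k) + shape_size (snd p k) + count M (Suc k)}"
  proof (rule card_bij_betw_restrict)
    show "bij_betw (map_prod (tableau_chain ?m ?l) (tableau_chain ?m' ?l'))
        (tableaux N ?m ?l \<times> tableaux N ?m' ?l') (strip_chains N ?m ?l \<times> strip_chains N ?m' ?l')"
      unfolding tableaux_def by (intro bij_betw_map_prod tableau_chain_bij ml ml')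
    fix p assume "p \<in> tableaux N ?m ?l \<times> tableaux N ?m' ?l'"
    then obtain T T' where p: "p = (T, T')" "T \<in> tableaux N ?m ?l" "T' \<in> tableaux N ?m' ?l'"
      by blast
    let ?A = "tableau_content ?m ?l T" and ?B = "tableau_content ?m' ?l' T'"
    have ssyt: "is_ssyt (cells ?m ?l) T" "is_ssyt (cells ?m' ?l') T'"
      using p(2,3) by (simp_all add: tableaux_def)
    have "0 \<notin># ?A + ?B"
      using tableau_content_zero[OF R(1) ssyt(1)] tableau_content_zero[OF R(2) ssyt(2)] by simp
    moreover have "set_mset (?A + ?B) \<subseteq> {..N}"
      using tableau_content_le[OF R(1) ssyt(1)] tableau_content_le[OF R(2) ssyt(2)] p(2,3) by simp
    ultimately have "?A + ?B = M \<longleftrightarrow> (\<forall>k<N. count (?A + ?B) (Suc k) = count M (Suc k))"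
      by (rule mset_eq_iff_counts[OF _ _ M])
    moreover have "count (?A + ?B) (Suc k) = count M (Suc k) \<longleftrightarrow>
        shape_size (tableau_chain ?m ?l T (Suc k)) + shape_size (tableau_chain ?m' ?l' T' (Suc k)) =
        shape_size (tableau_chain ?m ?l T k) + shape_size (tableau_chain ?m' ?l' T' k) + count M (Suc k)" for k
      using count_tableau_content_Suc[OF ml(1) R(1) ssyt(1), of k]
        count_tableau_content_Suc[OF ml'(1) R(2) ssyt(2), of k] by (simp, linarith)
    ultimately show "(tableau_content ?m ?l (fst p) + tableau_content ?m' ?l' (snd p) = M) =
        (\<forall>k<N. shape_size (fst (map_prod (tableau_chain ?m ?l) (tableau_chain ?m' ?l') p) (Suc k)) +
            shape_size (snd (map_prod (tableau_chain ?m ?l) (tableau_chain ?m' ?l') p) (Suc k)) =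
          shape_size (fst (map_prod (tableau_chain ?m ?l) (tableau_chain ?m' ?l') p) k) +
            shape_size (snd (map_prod (tableau_chain ?m ?l) (tableau_chain ?m' ?l') p) k) + count M (Suc k))"
      by (simp add: p(1))
  qed
  finally show ?thesis .
qed

section \<open>Linear independence of Schur functions\<close>

text \<open>
  The coefficients of Schur functions at these monomials are Kostka numbers, which are
  unitriangular for the dominance order.
\<close>

definition row_content :: "nat list \<Rightarrow> nat multiset" where
  "row_content ka = (\<Sum>i<length ka. replicate_mset (ka ! i) (Suc i))"

lemma count_row_content:
  "count (row_content ka) (Suc i) = shape_of ka i" "count (row_content ka) 0 = 0"
  by (auto simp: row_content_def count_sum shape_of_nth shape_of_vanish not_less sum.delta')

lemma set_row_content: "0 \<notin># row_content ka" "set_mset (row_content ka) \<subseteq> {..length ka}"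
proof -
  show "0 \<notin># row_content ka"
    by (simp add: not_in_iff count_row_content)
  show "set_mset (row_content ka) \<subseteq> {..length ka}"
  proof
    fix r assume r: "r \<in># row_content ka"
    show "r \<in> {..length ka}"
    proof (cases r)
      case (Suc i)
      then have "shape_of ka i \<noteq> 0"
        using r count_row_content(1)[of ka i] by (metis count_eq_zero_iff)
      then show ?thesis
        using Suc shape_of_vanish[of ka i] by (cases "i < length ka") simp_all
    qed simp
  qed
qed

text \<open>In a straight shape the first \<open>k\<close> letters occupy only the first
  \<open>k\<close> rows. This is the triangularity of the Kostka numbers.\<close>

lemma content_chain_partial_sum_le:
  assumes c: "c \<in> content_chains N (\<lambda>_. 0) b q" and "k \<le> N"
  shows "(\<Sum>i<k. q i) \<le> (\<Sum>i<k. b i)"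
proof -
  have sc: "c \<in> strip_chains N (\<lambda>_. 0) b"
    using c by (simp add: content_chains_def)
  have size: "shape_size (c k) = (\<Sum>i<k. q i) \<and> (\<forall>i\<ge>k. c k i = 0)"
    using assms(2)
  proof (induction k)
    case 0
    then show ?case
      using sc by (simp add: strip_chains_def shape_size_def)
  next
    case (Suc k)
    have "hstrip (c k) (c (Suc k))"
      using sc Suc.prems by (simp add: strip_chains_def)
    then have "c (Suc k) i = 0" if "i \<ge> Suc k" for i
      using that Suc hstripD(2)[of "c k" "c (Suc k)" "i - 1"] by simp
    then show ?case
      using c Suc by (simp add: content_chains_def)
  qed
  have "(\<Sum>i<k. q i) = (\<Sum>i<k. c k i)"
    using size shape_size_eq[of k "c k"] by simp
  also have "\<dots> \<le> (\<Sum>i<k. b i)"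
    using strip_chains_le[OF sc, of k] by (intro sum_mono) (simp add: le_fun_def)
  finally show ?thesis .
qed

lemma schur_row_content_pos:
  assumes "is_partition ka"
  shows "schur ka (row_content ka) > 0"
proof -
  let ?b = "shape_of ka"
  have R: "\<forall>i\<ge>length ka. ?b i = 0"
    by (simp add: shape_of_vanish)
  have "(\<lambda>k i. if i < k then ?b i else 0) \<in> content_chains (length ka) (\<lambda>_. 0) ?b ?b"
    using superstandard_in_chains[OF shape_of_antimono[OF assms] R]
    by (simp add: chains_def content_chains_def segment_cond_def)
  then have "card (content_chains (length ka) (\<lambda>_. 0) ?b ?b) > 0"
    using finite_content_chains[OF R] by (auto simp: card_gt_0_iff)
  then show ?thesis
    using skew_schur_eq_chains[OF is_skew_shape_Nil[OF assms] set_row_content]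
    by (simp add: count_row_content shape_of_Nil)
qed

lemma schur_row_content_dominance:
  assumes "is_partition ka" "is_partition ka'" "schur ka' (row_content ka) \<noteq> 0" "k \<le> N" "length ka \<le> N"
  shows "(\<Sum>i<k. shape_of ka i) \<le> (\<Sum>i<k. shape_of ka' i)"
proof -
  have "set_mset (row_content ka) \<subseteq> {..N}"
    using set_row_content(2)[of ka] assms(5) by (auto dest!: subsetD)
  then have "schur ka' (row_content ka) = int (card (content_chains N (\<lambda>_. 0) (shape_of ka') (shape_of ka)))"
    using skew_schur_eq_chains[OF is_skew_shape_Nil[OF assms(2)] set_row_content(1)]
    by (simp add: count_row_content shape_of_Nil)
  then have "content_chains N (\<lambda>_. 0) (shape_of ka') (shape_of ka) \<noteq> {}"
    using assms(3) by auto
  then show ?thesis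
    using content_chain_partial_sum_le assms(4) by blast
qed

text \<open>Among the shapes with nonzero coefficient take one that is maximal for dominance and
  compare coefficients at its row content: no other shape contributes there.\<close>

lemma schur_independent:
  assumes fin: "finite S" and part: "\<And>ka. ka \<in> S \<Longrightarrow> is_partition ka"
    and zero: "\<And>M. (\<Sum>ka\<in>S. e ka * schur ka M) = 0" and "ka \<in> S"
  shows "e ka = (0 :: int)"
proof (rule ccontr)
  assume "e ka \<noteq> 0"
  define N where "N = Max (length ` S)"
  \<comment> \<open>Adding up all partial sums gives a number that strictly increases along
    dominance, so a maximum of \<open>\<Phi>\<close> supplies a maximal shape. Since
    \<open>N\<close> bounds all lengths, equal partial sums up to \<open>N\<close> force equal
    shapes.\<close>
  define \<Phi> where "\<Phi> ka = (\<Sum>k\<le>N. \<Sum>i<k. shape_of ka i)" for ka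
  define S' where "S' = {ka \<in> S. e ka \<noteq> 0}"
  have S': "finite S'" "S' \<noteq> {}"
    using fin \<open>ka \<in> S\<close> \<open>e ka \<noteq> 0\<close> by (auto simp: S'_def)
  have len: "length x \<le> N" if "x \<in> S" for x
    using fin that by (simp add: N_def)
  have "Max (\<Phi> ` S') \<in> \<Phi> ` S'"
    using S' by (intro Max_in) auto
  then obtain mx where mx: "mx \<in> S'" "\<And>x. x \<in> S' \<Longrightarrow> \<Phi> x \<le> \<Phi> mx"
    using S' by (metis (no_types, lifting) Max_ge finite_imageI image_eqI image_iff)
  have mx_S: "mx \<in> S" "e mx \<noteq> 0"
    using mx(1) by (simp_all add: S'_def)
  have "e x * schur x (row_content mx) = 0" if "x \<in> S" "x \<noteq> mx" for x
  proof (rule ccontr)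
    assume nz: "e x * schur x (row_content mx) \<noteq> 0"
    then have x: "x \<in> S'" "schur x (row_content mx) \<noteq> 0"
      using that by (auto simp: S'_def)
    have dom: "(\<Sum>i<k. shape_of mx i) \<le> (\<Sum>i<k. shape_of x i)" if "k \<le> N" for k
      by (rule schur_row_content_dominance[OF part[OF mx_S(1)] part[OF \<open>x \<in> S\<close>] x(2) that len[OF mx_S(1)]])
    have eq: "(\<Sum>i<k. shape_of mx i) = (\<Sum>i<k. shape_of x i)" if "k \<le> N" for k
    proof (rule ccontr)
      assume "(\<Sum>i<k. shape_of mx i) \<noteq> (\<Sum>i<k. shape_of x i)"
      then have "(\<Sum>i<k. shape_of mx i) < (\<Sum>i<k. shape_of x i)"
        using dom[OF that] by simp
      then have "\<Phi> mx < \<Phi> x"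
        unfolding \<Phi>_def using dom that by (intro sum_strict_mono_ex1) auto
      then show False
        using mx(2)[OF x(1)] by simp
    qed
    have "shape_of mx i = shape_of x i" for i
    proof (cases "i < N")
      case True
      then show ?thesis
        using eq[of i] eq[of "Suc i"] by simp
    next
      case False
      then show ?thesis
        using len[OF mx_S(1)] len[OF \<open>x \<in> S\<close>] by (simp add: shape_of_vanish)
    qed
    then have "mx = x"
      using part mx_S(1) \<open>x \<in> S\<close> by (intro shape_of_inject) auto
    then show False
      using that by simp
  qed
  then have "(\<Sum>x\<in>S. e x * schur x (row_content mx)) = e mx * schur mx (row_content mx)"
    using fin mx_S(1) by (simp add: sum.remove[of S mx] sum.neutral)
  moreover have "schur mx (row_content mx) \<noteq> 0"
    using schur_row_content_pos[OF part[OF mx_S(1)]] by simp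
  ultimately show False
    using zero[of "row_content mx"] mx_S(2) by simp
qed

lemma schur_expansion_unique:
  assumes "is_schur_expansion f c" "is_schur_expansion f c'"
  shows "c = c'"
proof
  fix ka
  let ?S = "{ka. c ka \<noteq> 0} \<union> {ka. c' ka \<noteq> 0}"
  have fin: "finite ?S"
    using assms unfolding is_schur_expansion_def by simp
  have "f M = (\<Sum>ka\<in>?S. c ka * schur ka M)" "f M = (\<Sum>ka\<in>?S. c' ka * schur ka M)" for M
  proof -
    have "f M = (\<Sum>ka | c ka \<noteq> 0. c ka * schur ka M)" "f M = (\<Sum>ka | c' ka \<noteq> 0. c' ka * schur ka M)"
      using assms unfolding is_schur_expansion_def by metis+
    moreover have "(\<Sum>ka | c ka \<noteq> 0. c ka * schur ka M) = (\<Sum>ka\<in>?S. c ka * schur ka M)"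
      "(\<Sum>ka | c' ka \<noteq> 0. c' ka * schur ka M) = (\<Sum>ka\<in>?S. c' ka * schur ka M)"
      using fin by (auto intro!: sum.mono_neutral_left)
    ultimately show "f M = (\<Sum>ka\<in>?S. c ka * schur ka M)" "f M = (\<Sum>ka\<in>?S. c' ka * schur ka M)"
      by simp_all
  qed
  then have "(\<Sum>ka\<in>?S. (c ka - c' ka) * schur ka M) = 0" for M
    unfolding left_diff_distrib sum_subtractf by (metis diff_self)
  moreover have "is_partition ka" if "ka \<in> ?S" for ka
    using assms that unfolding is_schur_expansion_def by blast
  ultimately have "c ka - c' ka = 0" if "ka \<in> ?S"
    using fin that by (intro schur_independent[of ?S "\<lambda>ka. c ka - c' ka"]) auto
  then show "c ka = c' ka"
    by (cases "ka \<in> ?S") auto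
qed

section \<open>Peelable tableaux\<close>

lemma ne_matching_empty: "ne_matching A C {}"
  by (simp add: ne_matching_def)

lemma ne_excess_le_mono: "ne_excess_le a b c d k \<Longrightarrow> k \<le> k' \<Longrightarrow> ne_excess_le a b c d k'"
  unfolding ne_excess_le_def by (meson add_right_mono order_trans)

text \<open>The lower strip has \<open>l - m\<close> squares, so at least \<open>l - m'\<close>
  pairs means at most \<open>(l - m) - (l - m') = m' - m\<close> squares without partner. It is
  applied with \<open>l\<close>, \<open>m\<close> from one row and \<open>m'\<close> the inner part
  of the row before.\<close>

lemma ne_matching_iff_excess:
  assumes strips: "hstrip a b" "hstrip b c" "hstrip c d" and R: "\<forall>i\<ge>R. d i = 0"
    and size: "shape_size d = shape_size c + (l - m)" and ml: "m \<le> l" "m \<le> m'"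
  shows "(\<exists>P. ne_matching (cells a b) (cells c d) P \<and> l - m' \<le> card P) \<longleftrightarrow>
    ne_excess_le a b c d (int m' - int m)"
proof -
  have card: "card (cells c d) = l - m"
    using card_cells[OF hstrip_mono[OF strips(3)] R] size by linarith
  show ?thesis
  proof (cases "m' \<le> l")
    case True
    then have "int (card (cells c d)) - int (l - m') = int m' - int m"
      "int (card (cells c d) - (l - m')) = int m' - int m" "l - m' \<le> card (cells c d)"
      using card ml by (simp_all add: of_nat_diff)
    then show ?thesis
      using ne_matching_imp_excess[OF strips R, of _ "l - m'"] excess_imp_ne_matching[OF strips R, of "l - m'"]
      by metis
  next
    case False
    \<comment> \<open>If \<open>l < m'\<close>, then \<open>l - m'\<close> is truncated to 0 and the
      empty matching suffices; the bound \<open>m' - m\<close> exceeds the number of squares of the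
      strip, so the excess condition holds as well.\<close>
    have "ne_excess_le a b c d (int (card (cells c d)) - int 0)"
      by (rule ne_matching_imp_excess[OF strips R ne_matching_empty]) simp
    then have "ne_excess_le a b c d (int m' - int m)"
      by (rule ne_excess_le_mono) (use False ml card in \<open>simp add: of_nat_diff\<close>)
    moreover have "l - m' = 0"
      using False by simp
    ultimately show ?thesis
      using ne_matching_empty by (metis le0)
  qed
qed

section \<open>Rows and common columns of the shuffle diagram\<close>

lemma image_cells: "f ` cells a b = {f (Suc i, j) | i j. a i < j \<and> j \<le> b i}"
proof (intro equalityI subsetI)
  fix y assume "y \<in> f ` cells a b"
  then obtain s where "y = f s" "s \<in> cells a b"
    by blast
  then show "y \<in> {f (Suc i, j) | i j. a i < j \<and> j \<le> b i}"
    by (auto elim!: cellE)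
qed auto

lemma shuffle_diagram_iff:
  "(Suc (2 * i), x) \<in> shuffle_diagram la mu nu rho \<longleftrightarrow>
     (\<exists>j. x = 2 * j - 1 \<and> shape_of mu i < j \<and> j \<le> shape_of la i)"
  "(Suc (Suc (2 * i)), x) \<in> shuffle_diagram la mu nu rho \<longleftrightarrow>
     (\<exists>j. x = 2 * j \<and> shape_of rho i < j \<and> j \<le> shape_of nu i)"
proof -
  have parity: "2 * i \<noteq> Suc (2 * i')" "Suc (2 * i) \<noteq> 2 * i'" for i i' :: nat
    by presburger+
  show "(Suc (2 * i), x) \<in> shuffle_diagram la mu nu rho \<longleftrightarrow>
      (\<exists>j. x = 2 * j - 1 \<and> shape_of mu i < j \<and> j \<le> shape_of la i)"
    and "(Suc (Suc (2 * i)), x) \<in> shuffle_diagram la mu nu rho \<longleftrightarrow>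
      (\<exists>j. x = 2 * j \<and> shape_of rho i < j \<and> j \<le> shape_of nu i)"
    unfolding shuffle_diagram_def skew_diagram_eq_cells image_cells by (auto simp: parity)
qed

lemma inj_on_double_pred: "inj_on (\<lambda>j :: nat. 2 * j - 1) {m<..l}"
proof (rule inj_onI)
  fix x y assume "x \<in> {m<..l}" "y \<in> {m<..l}" and eq: "2 * x - 1 = 2 * y - 1"
  then have "x \<ge> 1" "y \<ge> 1"
    by auto
  then show "x = y"
    using eq by linarith
qed

lemma shuffle_row_card:
  "card {s \<in> shuffle_diagram la mu nu rho. fst s = Suc (2 * i)} = shape_of la i - shape_of mu i"
  "card {s \<in> shuffle_diagram la mu nu rho. fst s = Suc (Suc (2 * i))} = shape_of nu i - shape_of rho i"
proof -
  have "{s \<in> shuffle_diagram la mu nu rho. fst s = Suc (2 * i)} =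
      (\<lambda>j. (Suc (2 * i), 2 * j - 1)) ` {shape_of mu i<..shape_of la i}"
    by (auto simp: shuffle_diagram_iff)
  moreover have "inj_on (\<lambda>j. (Suc (2 * i), 2 * j - 1)) {shape_of mu i<..shape_of la i}"
    using inj_on_double_pred by (auto simp: inj_on_def)
  ultimately show "card {s \<in> shuffle_diagram la mu nu rho. fst s = Suc (2 * i)} = shape_of la i - shape_of mu i"
    by (simp add: card_image)
  have "{s \<in> shuffle_diagram la mu nu rho. fst s = Suc (Suc (2 * i))} =
      (\<lambda>j. (Suc (Suc (2 * i)), 2 * j)) ` {shape_of rho i<..shape_of nu i}"
    by (auto simp: shuffle_diagram_iff)
  moreover have "inj_on (\<lambda>j. (Suc (Suc (2 * i)), 2 * j)) {shape_of rho i<..shape_of nu i}"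
    by (auto simp: inj_on_def)
  ultimately show "card {s \<in> shuffle_diagram la mu nu rho. fst s = Suc (Suc (2 * i))} = shape_of nu i - shape_of rho i"
    by (simp add: card_image)
qed

text \<open>Since parts weakly decrease, two consecutive rows of a skew shape overlap from the inner
  end of the upper row to the outer end of the lower row; truncated subtraction covers the case of
  no overlap.\<close>

lemma common_columns_shuffle:
  assumes "is_skew_shape la mu" "is_skew_shape nu rho"
  shows "common_columns (shuffle_diagram la mu nu rho) (Suc (2 * i)) = shape_of la (Suc i) - shape_of mu i"
    and "common_columns (shuffle_diagram la mu nu rho) (Suc (Suc (2 * i))) = shape_of nu (Suc i) - shape_of rho i"
proof -
  note ml = is_skew_shapeD[OF assms(1)] and ml' = is_skew_shapeD[OF assms(2)]
  have next_row: "Suc (2 * i) + 2 = Suc (2 * Suc i)" "Suc (Suc (2 * i)) + 2 = Suc (Suc (2 * Suc i))"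
    by simp_all
  have le: "shape_of mu (Suc i) \<le> shape_of mu i" "shape_of la (Suc i) \<le> shape_of la i"
    "shape_of rho (Suc i) \<le> shape_of rho i" "shape_of nu (Suc i) \<le> shape_of nu i"
    using ml(2,3) ml'(2,3) by (simp_all add: antimono_def)
  have "{x. (Suc (2 * i), x) \<in> shuffle_diagram la mu nu rho \<and>
        (Suc (2 * i) + 2, x) \<in> shuffle_diagram la mu nu rho} =
      (\<lambda>j. 2 * j - 1) ` {shape_of mu i<..shape_of la (Suc i)}"
    (is "?L = ?R")
  proof (intro equalityI subsetI)
    fix x assume "x \<in> ?L"
    then obtain j j' where j: "x = 2 * j - 1" "shape_of mu i < j"
      and j': "x = 2 * j' - 1" "shape_of mu (Suc i) < j'" "j' \<le> shape_of la (Suc i)"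
      unfolding next_row shuffle_diagram_iff by blast
    have "j = j'"
      using j j' by linarith
    then show "x \<in> ?R"
      using j j' by auto
  next
    fix x assume "x \<in> ?R"
    then obtain j where "x = 2 * j - 1" "shape_of mu i < j" "j \<le> shape_of la (Suc i)"
      by auto
    then show "x \<in> ?L"
      unfolding next_row mem_Collect_eq shuffle_diagram_iff using le(1,2) by (intro conjI exI[of _ j]) simp_all
  qed
  then show "common_columns (shuffle_diagram la mu nu rho) (Suc (2 * i)) = shape_of la (Suc i) - shape_of mu i"
    unfolding common_columns_def using inj_on_double_pred by (simp add: card_image)
  have "{x. (Suc (Suc (2 * i)), x) \<in> shuffle_diagram la mu nu rho \<and>
        (Suc (Suc (2 * i)) + 2, x) \<in> shuffle_diagram la mu nu rho} =
      (\<lambda>j. 2 * j) ` {shape_of rho i<..shape_of nu (Suc i)}"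
    (is "?L = ?R")
  proof (intro equalityI subsetI)
    fix x assume "x \<in> ?L"
    then obtain j j' where j: "x = 2 * j" "shape_of rho i < j"
      and j': "x = 2 * j'" "shape_of rho (Suc i) < j'" "j' \<le> shape_of nu (Suc i)"
      unfolding next_row shuffle_diagram_iff by blast
    then show "x \<in> ?R"
      by auto
  next
    fix x assume "x \<in> ?R"
    then obtain j where "x = 2 * j" "shape_of rho i < j" "j \<le> shape_of nu (Suc i)"
      by auto
    then show "x \<in> ?L"
      unfolding next_row mem_Collect_eq shuffle_diagram_iff using le(3,4) by (intro conjI exI[of _ j]) simp_all
  qed
  moreover have "inj_on (\<lambda>j :: nat. 2 * j) {shape_of rho i<..shape_of nu (Suc i)}"
    by (auto simp: inj_on_def)
  ultimately show "common_columns (shuffle_diagram la mu nu rho) (Suc (Suc (2 * i))) = shape_of nu (Suc i) - shape_of rho i"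
    unfolding common_columns_def by (simp add: card_image)
qed

lemma all_even_odd_iff: "(\<forall>k. P k) \<longleftrightarrow> (\<forall>i. P (2 * i) \<and> P (Suc (2 * i)))" for P :: "nat \<Rightarrow> bool"
  by (metis even_two_times_div_two odd_two_times_div_two_succ Suc_eq_plus1)

text \<open>Tableau entry \<open>Suc k\<close> is step \<open>k\<close> of the chain, so the entries
  \<open>i\<close> and \<open>i + 2\<close> become the strips at steps \<open>k\<close> and
  \<open>k + 2\<close>, with \<open>k = i - 1\<close>.\<close>

lemma is_peelable_iff:
  assumes ssyt: "is_ssyt (young_diagram ka) T"
  defines "c \<equiv> tableau_chain (\<lambda>_. 0) (shape_of ka) T"
  shows "is_peelable D ka T \<longleftrightarrow>
    (\<forall>k. shape_size (c (Suc k)) = shape_size (c k) + card {s \<in> D. fst s = Suc k}) \<and>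
    (\<forall>k. \<exists>P. ne_matching (cells (c k) (c (Suc k))) (cells (c (k + 2)) (c (k + 3))) P \<and>
      common_columns D (Suc k) \<le> card P)"
proof -
  let ?b = "shape_of ka"
  have Y: "young_diagram ka = cells (\<lambda>_. 0) ?b"
    by (simp add: skew_diagram_eq_cells shape_of_Nil)
  have le: "(\<lambda>_. 0) \<le> ?b"
    by (simp add: le_fun_def)
  have ssyt': "is_ssyt (cells (\<lambda>_. 0) ?b) T"
    using ssyt by (simp add: Y)
  note entries = cells_with_entry[OF le ssyt']
  have all_pos: "(\<forall>r\<ge>1. P r) \<longleftrightarrow> (\<forall>k. P (Suc k))" for P :: "nat \<Rightarrow> bool"
    by (metis One_nat_def Suc_le_D le_add1 plus_1_eq_Suc)
  have R: "\<forall>i\<ge>length ka. ?b i = 0"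
    by (simp add: shape_of_vanish)
  have sizes: "card {s \<in> cells (\<lambda>_. 0) ?b. T s = Suc k} = x \<longleftrightarrow>
      shape_size (c (Suc k)) = shape_size (c k) + x" for k x
    using card_entry[OF le R ssyt', of k] unfolding c_def by linarith
  have matching: "(\<forall>(s, t)\<in>P. s \<in> cells (\<lambda>_. 0) ?b \<and> t \<in> cells (\<lambda>_. 0) ?b \<and>
        T s = Suc k \<and> T t = Suc k + 2 \<and> northeast s t) \<and>
      pairwise (\<lambda>p q. disjnt {fst p, snd p} {fst q, snd q}) P \<longleftrightarrow>
      ne_matching (cells (c k) (c (Suc k))) (cells (c (k + 2)) (c (k + 3))) P" for k P
  proof -
    have "Suc k + 2 = Suc (k + 2)" "k + 3 = Suc (k + 2)"
      by simp_all
    then show ?thesis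
      unfolding ne_matching_def c_def by (simp only: entries[symmetric]) (simp only: mem_Collect_eq, fast)
  qed
  show ?thesis
    unfolding is_peelable_def Y all_pos sizes using ssyt'
    by (simp only: matching[symmetric] conj_assoc simp_thms)
qed

text \<open>Rows of the diagram beyond \<open>2 * n\<close> are empty, so entries are bounded by
  \<open>2 * n\<close>. This turns the conditions over all rows into the finitely many conditions of
  \<open>shuffled_chains\<close>.\<close>

theorem card_peelable:
  assumes sk: "is_skew_shape la mu" "is_skew_shape nu rho" and ka: "is_partition ka"
    and n: "length la \<le> n" "length nu \<le> n"
  shows "card {T. is_peelable (shuffle_diagram la mu nu rho) ka T} =
    card (shuffled_chains (\<lambda>_. 0) (shape_of ka) n
      (\<lambda>i. shape_of la i - shape_of mu i) (\<lambda>i. int (shape_of mu i) - int (shape_of mu (Suc i)))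
      (\<lambda>i. shape_of nu i - shape_of rho i) (\<lambda>i. int (shape_of rho i) - int (shape_of rho (Suc i))))"
proof -
  let ?D = "shuffle_diagram la mu nu rho" and ?b = "shape_of ka" and ?z = "\<lambda>_ :: nat. 0 :: nat"
  let ?l = "shape_of la" and ?m = "shape_of mu" and ?l' = "shape_of nu" and ?m' = "shape_of rho"
  have vanish: "?l i = 0" "?l' i = 0" if "i \<ge> n" for i
    using that n by (simp_all add: shape_of_vanish)
  have Y: "young_diagram ka = cells ?z ?b"
    by (simp add: skew_diagram_eq_cells shape_of_Nil)
  have R: "\<forall>i\<ge>length ka. ?b i = 0"
    by (simp add: shape_of_vanish)
  have row_empty: "card {s \<in> ?D. fst s = Suc k} = 0" if "k \<ge> 2 * n" for k
  proof (cases "even k")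
    case True
    then obtain i where "k = 2 * i" by blast
    then show ?thesis
      using that vanish(1)[of i] by (simp add: shuffle_row_card)
  next
    case False
    then obtain i where "k = Suc (2 * i)"
      by (auto elim: oddE)
    then show ?thesis
      using that vanish(2)[of i] by (simp add: shuffle_row_card)
  qed
  have "card {T. is_peelable ?D ka T} = card {T \<in> tableaux (2 * n) ?z ?b. is_peelable ?D ka T}"
  proof (rule arg_cong[where f = card])
    have "T \<in> tableaux (2 * n) ?z ?b" if T: "is_peelable ?D ka T" for T
    proof -
      have ssyt: "is_ssyt (cells ?z ?b) T"
        and rows: "\<And>r. r \<ge> 1 \<Longrightarrow> card {s \<in> cells ?z ?b. T s = r} = card {s \<in> ?D. fst s = r}"
        using T by (simp_all add: is_peelable_def Y)
      have "T s \<le> 2 * n" if s: "s \<in> cells ?z ?b" for s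
      proof (rule ccontr)
        assume "\<not> T s \<le> 2 * n"
        then obtain k where k: "T s = Suc k" "k \<ge> 2 * n"
          by (cases "T s") auto
        have "card {s \<in> cells ?z ?b. T s = Suc k} = card {s \<in> ?D. fst s = Suc k}"
          by (rule rows) simp
        then have empty: "card {s \<in> cells ?z ?b. T s = Suc k} = 0"
          using row_empty[OF k(2)] by (rule trans)
        have "finite {s \<in> cells ?z ?b. T s = Suc k}"
          using finite_cells[OF R] by simp
        then have "{s \<in> cells ?z ?b. T s = Suc k} = {}"
          using empty by (rule iffD1[OF card_0_eq])
        moreover have "s \<in> {s \<in> cells ?z ?b. T s = Suc k}"
          using s k(1) by (intro CollectI conjI)
        ultimately show False
          by (simp only: empty_iff)
      qed
      then show ?thesis
        using ssyt unfolding tableaux_def by simp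
    qed
    then show "{T. is_peelable ?D ka T} = {T \<in> tableaux (2 * n) ?z ?b. is_peelable ?D ka T}"
      by (intro Collect_cong iffI conjI; (elim conjE)?)
  qed
  also have "\<dots> = card (shuffled_chains ?z ?b n (\<lambda>i. ?l i - ?m i) (\<lambda>i. int (?m i) - int (?m (Suc i)))
      (\<lambda>i. ?l' i - ?m' i) (\<lambda>i. int (?m' i) - int (?m' (Suc i))))"
    unfolding shuffled_chains_def
  proof (rule card_bij_betw_restrict)
    have le: "?z \<le> ?b"
      by (simp add: le_fun_def)
    show bij: "bij_betw (tableau_chain ?z ?b) (tableaux (2 * n) ?z ?b) (strip_chains (2 * n) ?z ?b)"
      unfolding tableaux_def
      by (rule tableau_chain_bij[OF le antimono_zero shape_of_antimono[OF ka]])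
    fix T assume T: "T \<in> tableaux (2 * n) ?z ?b"
    define c where "c = tableau_chain ?z ?b T"
    have c: "c \<in> strip_chains (2 * n) ?z ?b"
      using bij T unfolding c_def bij_betw_def by blast
    have strip: "hstrip (c k) (c (Suc k))" if "k < 2 * n" for k
      using c that by (simp add: strip_chains_def)
    have final: "c k = ?b" if "k \<ge> 2 * n" for k
      using c that by (simp add: strip_chains_def)
    note zero = strip_chains_vanish[OF c R]
    let ?size = "\<lambda>k. shape_size (c (Suc k)) = shape_size (c k) + card {s \<in> ?D. fst s = Suc k}"
    let ?ne = "\<lambda>k. \<exists>P. ne_matching (cells (c k) (c (Suc k))) (cells (c (k + 2)) (c (k + 3))) P \<and>
      common_columns ?D (Suc k) \<le> card P"
    have size_iff: "(\<forall>k. ?size k) \<longleftrightarrow>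
        (\<forall>i<n. shape_size (c (2 * i + 1)) = shape_size (c (2 * i)) + (?l i - ?m i) \<and>
          shape_size (c (2 * i + 2)) = shape_size (c (2 * i + 1)) + (?l' i - ?m' i))"
    proof -
      define S where "S i \<longleftrightarrow> ?size (2 * i) \<and> ?size (Suc (2 * i))" for i
      have arith: "2 * i + 1 = Suc (2 * i)" "2 * i + 2 = Suc (Suc (2 * i))" for i :: nat
        by simp_all
      have S_iff: "S i \<longleftrightarrow> shape_size (c (2 * i + 1)) = shape_size (c (2 * i)) + (?l i - ?m i) \<and>
          shape_size (c (2 * i + 2)) = shape_size (c (2 * i + 1)) + (?l' i - ?m' i)" for i
        unfolding S_def arith shuffle_row_card ..
      have S_high: "S i" if "\<not> i < n" for i
      proof -
        have k: "2 * n \<le> 2 * i" "2 * n \<le> Suc (2 * i)" "2 * n \<le> Suc (Suc (2 * i))"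
          using that by simp_all
        show ?thesis
          unfolding S_def final[OF k(1)] final[OF k(2)] final[OF k(3)] row_empty[OF k(1)] row_empty[OF k(2)]
          by simp
      qed
      have "(\<forall>k. ?size k) \<longleftrightarrow> (\<forall>i. S i)"
        unfolding S_def by (rule all_even_odd_iff)
      also have "\<dots> \<longleftrightarrow> (\<forall>i<n. S i)"
        using S_high by blast
      finally show ?thesis
        unfolding S_iff .
    qed
    \<comment> \<open>The sizes are assumed because the number of pairs translates into an excess
      only when the strips have the prescribed numbers of squares.\<close>
    have ne_iff: "(\<forall>k. ?ne k) \<longleftrightarrow> (\<forall>i. Suc (Suc i) \<le> n \<longrightarrow>
        ne_excess_le (c (2 * i)) (c (2 * i + 1)) (c (2 * i + 2)) (c (2 * i + 3)) (int (?m i) - int (?m (Suc i))) \<and>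
        ne_excess_le (c (2 * i + 1)) (c (2 * i + 2)) (c (2 * i + 3)) (c (2 * i + 4))
          (int (?m' i) - int (?m' (Suc i))))"
      if sizes: "\<forall>k. ?size k"
    proof -
      have even: "?ne (2 * i) \<longleftrightarrow> ne_excess_le (c (2 * i)) (c (2 * i + 1)) (c (2 * i + 2)) (c (2 * i + 3))
          (int (?m i) - int (?m (Suc i)))" if i: "Suc (Suc i) \<le> n" for i
      proof -
        have "hstrip (c (2 * i)) (c (2 * i + 1))" "hstrip (c (2 * i + 1)) (c (2 * i + 2))"
          "hstrip (c (2 * i + 2)) (c (2 * i + 3))"
          using strip[of "2 * i"] strip[of "2 * i + 1"] strip[of "2 * i + 2"] i
          by (simp_all add: numeral_eq_Suc)
        moreover have "shape_size (c (2 * i + 3)) = shape_size (c (2 * i + 2)) + (?l (Suc i) - ?m (Suc i))"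
          using spec[OF sizes, of "2 * Suc i"] unfolding shuffle_row_card by (simp add: numeral_eq_Suc)
        moreover have "?m (Suc i) \<le> ?l (Suc i)" "?m (Suc i) \<le> ?m i"
          using is_skew_shapeD(1)[OF sk(1)] antimonoD[OF is_skew_shapeD(2)[OF sk(1)], of i "Suc i"]
          by (simp_all add: le_fun_def)
        ultimately show ?thesis
          using ne_matching_iff_excess[of "c (2 * i)" "c (2 * i + 1)" "c (2 * i + 2)" "c (2 * i + 3)"
              "length ka" "?l (Suc i)" "?m (Suc i)" "?m i"] zero
          unfolding common_columns_shuffle[OF sk] by simp
      qed
      have odd: "?ne (Suc (2 * i)) \<longleftrightarrow> ne_excess_le (c (2 * i + 1)) (c (2 * i + 2)) (c (2 * i + 3)) (c (2 * i + 4))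
          (int (?m' i) - int (?m' (Suc i)))" if i: "Suc (Suc i) \<le> n" for i
      proof -
        have strips: "hstrip (c (2 * i + 1)) (c (2 * i + 2))" "hstrip (c (2 * i + 2)) (c (2 * i + 3))"
          "hstrip (c (2 * i + 3)) (c (2 * i + 4))"
          using strip[of "2 * i + 1"] strip[of "2 * i + 2"] strip[of "2 * i + 3"] i
          by (simp_all add: numeral_eq_Suc)
        have size: "shape_size (c (2 * i + 4)) = shape_size (c (2 * i + 3)) + (?l' (Suc i) - ?m' (Suc i))"
          using spec[OF sizes, of "Suc (2 * Suc i)"] unfolding shuffle_row_card by (simp add: numeral_eq_Suc)
        have le: "?m' (Suc i) \<le> ?l' (Suc i)" "?m' (Suc i) \<le> ?m' i"
          using is_skew_shapeD(1)[OF sk(2)] antimonoD[OF is_skew_shapeD(2)[OF sk(2)], of i "Suc i"]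
          by (simp_all add: le_fun_def)
        have arith: "2 * i + 1 = Suc (2 * i)" "2 * i + 2 = Suc (Suc (2 * i))"
          "2 * i + 3 = Suc (2 * i) + 2" "2 * i + 4 = Suc (2 * i) + 3"
          by simp_all
        show ?thesis
          using ne_matching_iff_excess[OF strips zero size le]
          unfolding common_columns_shuffle[OF sk] arith .
      qed
      \<comment> \<open>Here the lower of the two compared rows is empty in either factor, so no
        column is shared and the empty matching suffices.\<close>
      have trivial: "?ne (2 * i) \<and> ?ne (Suc (2 * i))" if "\<not> Suc (Suc i) \<le> n" for i
      proof -
        have "?l (Suc i) = 0" "?l' (Suc i) = 0"
          using that vanish by simp_all
        then have "common_columns ?D (Suc (2 * i)) = 0" "common_columns ?D (Suc (Suc (2 * i))) = 0"
          unfolding common_columns_shuffle[OF sk] by simp_all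
        then show ?thesis
          using ne_matching_empty by (metis le0)
      qed
      define F where "F k \<longleftrightarrow> ?ne k" for k
      have F_iff: "F (2 * i) \<and> F (Suc (2 * i)) \<longleftrightarrow> (Suc (Suc i) \<le> n \<longrightarrow>
        ne_excess_le (c (2 * i)) (c (2 * i + 1)) (c (2 * i + 2)) (c (2 * i + 3)) (int (?m i) - int (?m (Suc i))) \<and>
        ne_excess_le (c (2 * i + 1)) (c (2 * i + 2)) (c (2 * i + 3)) (c (2 * i + 4))
          (int (?m' i) - int (?m' (Suc i))))" for i
      proof (cases "Suc (Suc i) \<le> n")
        case True
        show ?thesis
          unfolding F_def by (simp only: even[OF True] odd[OF True] True simp_thms)
      next
        case False
        have "F (2 * i)" "F (Suc (2 * i))"
          using trivial[OF False] unfolding F_def by (rule conjunct1, rule conjunct2)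
        then show ?thesis
          by (simp only: False simp_thms)
      qed
      have "(\<forall>k. F k) \<longleftrightarrow> (\<forall>i. F (2 * i) \<and> F (Suc (2 * i)))"
        by (rule all_even_odd_iff)
      then show ?thesis
        unfolding F_iff unfolding F_def .
    qed
    have ssyt: "is_ssyt (young_diagram ka) T"
      using T by (simp only: tableaux_def mem_Collect_eq Y)
    have peel: "is_peelable ?D ka T \<longleftrightarrow> (\<forall>k. ?size k) \<and> (\<forall>k. ?ne k)"
      unfolding c_def by (rule is_peelable_iff[OF ssyt])
    show "is_peelable ?D ka T \<longleftrightarrow>
       (\<forall>i<n. shape_size (tableau_chain ?z ?b T (2 * i + 1)) = shape_size (tableau_chain ?z ?b T (2 * i)) + (?l i - ?m i) \<and>
         shape_size (tableau_chain ?z ?b T (2 * i + 2)) = shape_size (tableau_chain ?z ?b T (2 * i + 1)) + (?l' i - ?m' i)) \<and>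
       (\<forall>i. Suc (Suc i) \<le> n \<longrightarrow>
         ne_excess_le (tableau_chain ?z ?b T (2 * i)) (tableau_chain ?z ?b T (2 * i + 1))
           (tableau_chain ?z ?b T (2 * i + 2)) (tableau_chain ?z ?b T (2 * i + 3)) (int (?m i) - int (?m (Suc i))) \<and>
         ne_excess_le (tableau_chain ?z ?b T (2 * i + 1)) (tableau_chain ?z ?b T (2 * i + 2))
           (tableau_chain ?z ?b T (2 * i + 3)) (tableau_chain ?z ?b T (2 * i + 4)) (int (?m' i) - int (?m' (Suc i))))"
      unfolding c_def[symmetric] by (rule trans[OF peel conj_cong[OF size_iff ne_iff[OF iffD2[OF size_iff]]]])
  qed
  finally show ?thesis .
qed

section \<open>The Schur expansion of the product\<close>

lemma join_shapes_antimono: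
  assumes "antimono a" "antimono b" "b 0 \<le> Q"
  shows "antimono (join_shapes n Q a b)"
proof (rule antimonoI)
  fix i j :: nat assume "i \<le> j"
  have "a j \<le> a i"
    by (rule antimonoD[OF assms(1) \<open>i \<le> j\<close>])
  moreover have "b (j - n) \<le> b (i - n)"
    by (rule antimonoD[OF assms(2) diff_le_mono[OF \<open>i \<le> j\<close>]])
  moreover have "b (j - n) \<le> b 0"
    by (rule antimonoD[OF assms(2) le0])
  ultimately show "join_shapes n Q a b j \<le> join_shapes n Q a b i"
    unfolding join_shapes_def using assms(3) \<open>i \<le> j\<close> by (simp split: if_split)
qed

text \<open>The product counts tableaux of the joined shape \<open>d/a\<close>. Its expansion has as
  coefficient at \<open>ka\<close> the number of Littlewood-Richardson chains from \<open>ka\<close>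
  to \<open>d\<close> with content \<open>a\<close>, and these are equinumerous with the peelable
  tableaux.\<close>

theorem ps_mult_skew_schur_expansion:
  assumes sk: "is_skew_shape la mu" "is_skew_shape nu rho"
  shows "is_schur_expansion (ps_mult (skew_schur la mu) (skew_schur nu rho))
    (\<lambda>ka. if is_partition ka then int (card {T. is_peelable (shuffle_diagram la mu nu rho) ka T}) else 0)"
proof -
  let ?l = "shape_of la" and ?m = "shape_of mu" and ?l' = "shape_of nu" and ?m' = "shape_of rho"
  let ?z = "\<lambda>_ :: nat. 0 :: nat"
  let ?c = "\<lambda>ka. if is_partition ka then int (card {T. is_peelable (shuffle_diagram la mu nu rho) ka T}) else 0"
  note ml = is_skew_shapeD[OF sk(1)] and ml' = is_skew_shapeD[OF sk(2)]
  define n where "n = max (length la) (length nu)"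
  define Q where "Q = ?l' 0"
  define d where "d = join_shapes n Q ?l ?l'"
  define a where "a = join_shapes n Q ?m ?m'"
  have n: "length la \<le> n" "length nu \<le> n"
    by (simp_all add: n_def)
  then have vanish: "\<forall>i\<ge>n. ?l i = 0" "\<forall>i\<ge>n. ?l' i = 0"
    by (simp_all add: shape_of_vanish)
  have Q: "?l' 0 \<le> Q" "?m' 0 \<le> Q"
    using le_funD[OF ml'(1), of 0] by (simp_all add: Q_def)
  have d0: "\<forall>i\<ge>2 * n. d i = 0"
    using vanish by (simp add: d_def join_shapes_def)
  have le: "a \<le> d"
    using ml(1) ml'(1) by (simp add: a_def d_def join_shapes_def le_fun_def)
  have a0: "\<forall>i\<ge>2 * n. a i = 0"
    using d0 le by (metis le_fun_def le_zero_eq)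
  have anti: "antimono a" "antimono d"
    unfolding a_def d_def using ml(2,3) ml'(2,3) Q by (simp_all add: join_shapes_antimono)
  have peel: "card {T. is_peelable (shuffle_diagram la mu nu rho) ka T} =
      card (chains (shape_of ka) d (2 * n) a (\<lambda>_. 0))" if ka: "is_partition ka" for ka
  proof -
    have R: "\<forall>i\<ge>length ka. shape_of ka i = 0"
      by (simp add: shape_of_vanish)
    have "card {T. is_peelable (shuffle_diagram la mu nu rho) ka T} =
        card (chains ?z (shape_of ka) (2 * n) (\<lambda>i. d i - a i) (\<lambda>i. int (a i) - int (a (Suc i))))"
      unfolding card_peelable[OF sk ka n] a_def d_def by (rule card_joined_chains[OF ml'(1) Q(1) R, symmetric])
    also have "\<dots> = card (chains (shape_of ka) d (2 * n) a (\<lambda>_. 0))"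
      by (rule card_LR_chains[OF le anti d0 shape_of_antimono[OF ka] R, symmetric])
    finally show ?thesis .
  qed
  \<comment> \<open>A finite index set containing the support: a chain from \<open>ka\<close> to
    \<open>d\<close> exists only if \<open>ka\<close> is contained in \<open>d\<close>.\<close>
  define S where "S = {ka. is_partition ka \<and> shape_of ka \<le> d}"
  have inj: "inj_on shape_of S"
    unfolding S_def by (auto intro!: inj_onI shape_of_inject)
  have finS: "finite S"
    by (rule inj_on_finite[OF inj _ finite_shapes_le[OF d0]]) (auto simp: S_def)
  have supp: "{ka. ?c ka \<noteq> 0} \<subseteq> S"
  proof
    fix ka assume "ka \<in> {ka. ?c ka \<noteq> 0}"
    then have ka: "is_partition ka" "?c ka \<noteq> 0"
      by (auto split: if_splits)
    then have "chains (shape_of ka) d (2 * n) a (\<lambda>_. 0) \<noteq> {}"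
      using peel[OF ka(1)] by auto
    then have "shape_of ka \<le> d"
      using strip_chains_empty[of "shape_of ka" d "2 * n"] unfolding chains_def by blast
    then show "ka \<in> S"
      using ka(1) by (simp add: S_def)
  qed
  have expansion: "ps_mult (skew_schur la mu) (skew_schur nu rho) M = (\<Sum>ka\<in>S. ?c ka * schur ka M)" for M
  proof (cases "0 \<in># M")
    case True
    then have "schur ka M = 0" if "ka \<in> S" for ka
      using that skew_schur_zero[OF is_skew_shape_Nil] by (simp add: S_def)
    then show ?thesis
      using ps_mult_skew_schur_zero[OF sk True] by simp
  next
    case False
    obtain N where N: "set_mset M \<subseteq> {..N}"
      using finite_nat_set_iff_bounded_le[of "set_mset M"] by auto
    define q where "q k = count M (Suc k)" for k
    let ?L = "\<lambda>i. int (q (Suc i))"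
    let ?g = "\<lambda>b. card (chains ?z b N q ?L) * card (chains b d (2 * n) a (\<lambda>_. 0))"
    have product: "ps_mult (skew_schur la mu) (skew_schur nu rho) M = int (card (content_chains N a d q))"
      unfolding ps_mult_skew_schur[OF sk False N] a_def d_def q_def[symmetric]
        card_join_content_chains[OF ml(1) ml'(1) Q(1) vanish] ..
    have "card (content_chains N a d q) = (\<Sum>b | b \<le> d. ?g b)"
      unfolding content_chains_eq_chains[OF d0] by (rule card_chains_expansion[OF anti(1) a0 d0])
    also have "(\<Sum>b | b \<le> d. ?g b) = (\<Sum>b\<in>shape_of ` S. ?g b)"
    proof (rule sum.mono_neutral_right[OF finite_shapes_le[OF d0]])
      show "shape_of ` S \<subseteq> {b. b \<le> d}"
        by (auto simp: S_def)
      show "\<forall>b\<in>{b. b \<le> d} - shape_of ` S. ?g b = 0"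
      proof
        fix b assume b: "b \<in> {b. b \<le> d} - shape_of ` S"
        have b0: "\<forall>i\<ge>2 * n. b i = 0"
        proof (intro allI impI)
          fix i assume "2 * n \<le> i"
          moreover have "b i \<le> d i"
            using b by (simp add: le_fun_def)
          ultimately show "b i = 0"
            using d0 by simp
        qed
        \<comment> \<open>The sum runs over all functions below \<open>d\<close>. Those outside the
          image of \<open>S\<close> are not weakly decreasing, and no chain of horizontal strips
          from the empty shape ends in such a function.\<close>
        have "\<not> antimono b"
        proof
          assume "antimono b"
          then obtain ka where "is_partition ka" "shape_of ka = b"
            using b0 by (rule shape_of_surj)
          then show False
            using b by (auto simp: S_def)
        qed
        then have "chains ?z b N q ?L = {}"
          using strip_chains_antimono[OF _ antimono_zero] unfolding chains_def by blast
        then show "?g b = 0"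
          by simp
      qed
    qed
    also have "\<dots> = (\<Sum>ka\<in>S. ?g (shape_of ka))"
      unfolding sum.reindex[OF inj] comp_def ..
    finally have count: "card (content_chains N a d q) = (\<Sum>ka\<in>S. ?g (shape_of ka))" .
    have "int (\<Sum>ka\<in>S. ?g (shape_of ka)) = (\<Sum>ka\<in>S. ?c ka * schur ka M)"
      unfolding of_nat_sum
    proof (rule sum.cong[OF refl])
      fix ka assume "ka \<in> S"
      then have ka: "is_partition ka"
        by (simp add: S_def)
      have R: "\<forall>i\<ge>length ka. shape_of ka i = 0"
        by (simp add: shape_of_vanish)
      have "schur ka M = int (card (chains ?z (shape_of ka) N q ?L))"
        using skew_schur_eq_chains[OF is_skew_shape_Nil[OF ka] False N]
        by (simp add: shape_of_Nil q_def[symmetric] content_chains_eq_chains[OF R])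
      then show "int (?g (shape_of ka)) = ?c ka * schur ka M"
        using ka by (simp add: peel[OF ka])
    qed
    then show ?thesis
      unfolding product count .
  qed
  have "(\<Sum>ka | ?c ka \<noteq> 0. ?c ka * schur ka M) = (\<Sum>ka\<in>S. ?c ka * schur ka M)" for M
    by (rule sum.mono_neutral_left[OF finS supp]) auto
  then show ?thesis
    unfolding is_schur_expansion_def using finite_subset[OF supp finS] expansion
    by (auto simp: fun_eq_iff)
qed

theorem theorem1p2:
  fixes la mu nu rho ka :: "nat list"
  assumes "is_skew_shape la mu" and "is_skew_shape nu rho" and "is_partition ka"
  shows "lr_coeff la mu nu rho ka =
    int (card {T. is_peelable (shuffle_diagram la mu nu rho) ka T})"
proof -
  note expansion = ps_mult_skew_schur_expansion[OF assms(1,2)]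
  have "lr_coeff la mu nu rho =
      (\<lambda>ka. if is_partition ka then int (card {T. is_peelable (shuffle_diagram la mu nu rho) ka T}) else 0)"
    unfolding lr_coeff_def
    by (rule the_equality[where P = "is_schur_expansion _", OF expansion])
      (rule schur_expansion_unique[OF _ expansion])
  then show ?thesis
    using assms(3) by simp
qed

end
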